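(* Let $f:\mathbb R_+\cup\{\infty\}\to[0,1]\cup\{-\infty\}$ be upper semi-continuous, and suppose $\mathrm{dom}(f)$ is a closed subset $\mathcal I$ of $[0,\infty]$ with $0<\min(\mathcal I)<\infty$. Then there exists a homogeneously multifractal Hölder continuous function $F$ such that $\underline f^H_F=f$ on $\mathbb R_+\cup\{\infty\}$.
   Context: Work on $\mathbb R$ ($d=1$). Fix an orthonormal wavelet basis $\{\psi_I\}$ indexed by the dyadic intervals $I$ of $\mathbb R$, whose mother wavelet belongs to the Schwartz class, with the $\psi_I$ normalized to have the same supremum norm. For a bounded Hölder continuous $F:\mathbb R\to\mathbb R$ with wavelet coefficients $\{\lambda_I\}$, set $L_I=\sup\{|\lambda_{I'}|\}$, the supremum over dyadic intervals $I'$ contained in $I$ or in one of the two dyadic intervals of the same generation as $I$ neighboring $I$. For $x\in\mathbb R$, $I_n(x)$ is the closure of the dyadic interval $[k2^{-n},(k+1)2^{-n})$ containing $x$. $\mathrm{supp}(F)=\{x\in[0,1]:L_{I_n(x)}>0\ \forall n\ge1\}$. The pointwise Hölder exponent is $h_F(x_0)=\sup\{h\ge0:\exists P\in\mathbb R[X],\ |F(x)-P(x-x_0)|=O(|x-x_0|^h)\text{ as }x\to x_0\}$. For $h\in\mathbb R\cup\{\infty\}$, $\underline E(F,h)=\{x\in\mathrm{supp}(F):h_F(x)=h\}$ and $\underline f^H_F(h)=\dim_H\underline E(F,h)$ (with $\dim_H\emptyset=-\infty$). $F$ is homogeneously multifractal if for every $h$, $\dim_H(\underline E(F,h)\cap B)$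 does not depend on the ball $B$ whose interior intersects $\mathrm{supp}(F)$. $\mathrm{dom}(f)=\{h:f(h)>-\infty\}$; upper semi-continuity on $\mathbb R_+\cup\{\infty\}$ refers to the topology generated by open subsets of $\mathbb R_+$ and sets $(\alpha,\infty)\cup\{\infty\}$. *)

theory Defs
  imports "HOL-Analysis.Analysis" "HOL-Library.Landau_Symbols"
          "HOL-Computational_Algebra.Polynomial"
begin

definition schwartz :: "(real \<Rightarrow> real) \<Rightarrow> bool" where
  "schwartz \<psi> \<longleftrightarrow>
     (\<forall>n x. ((deriv ^^ n) \<psi>) differentiable (at x)) \<and>
     (\<forall>m n. \<exists>C. \<forall>x. \<bar>x ^ m * (deriv ^^ n) \<psi> x\<bar> \<le> C)"

definition dyadic_int :: "int \<Rightarrow> int \<Rightarrow> real set" where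
  "dyadic_int j k = {real_of_int k * 2 powr (- real_of_int j) ..< real_of_int (k+1) * 2 powr (- real_of_int j)}"

definition orthonormal_wavelet :: "(real \<Rightarrow> real) \<Rightarrow> bool" where
  "orthonormal_wavelet \<psi> \<longleftrightarrow>
     schwartz \<psi> \<and>
     (\<forall>j k j' k' :: int.
        (LINT x|lborel. 2 powr (real_of_int j / 2) * \<psi> (2 powr real_of_int j * x - real_of_int k)
                     * (2 powr (real_of_int j' / 2) * \<psi> (2 powr real_of_int j' * x - real_of_int k')))
        = (if j = j' \<and> k = k' then 1 else 0)) \<and>
     (\<forall>g :: real \<Rightarrow> real.
        g \<in> borel_measurable lborel \<and> integrable lborel (\<lambda>x. (g x)\<^sup>2) \<and>
        (\<forall>j k :: int. (LINT x|lborel. g x * \<psi> (2 powr real_of_int j * x - real_of_int k)) = 0)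
        \<longrightarrow> (AE x in lborel. g x = 0))"

text \<open>Wavelet coefficients, with L^infinity-normalised wavelets psi_I(x) = psi(2^j x - k).\<close>
definition wcoef :: "(real \<Rightarrow> real) \<Rightarrow> (real \<Rightarrow> real) \<Rightarrow> int \<Rightarrow> int \<Rightarrow> real" where
  "wcoef \<psi> F j k = 2 powr real_of_int j *
      (LINT x|lborel. F x * \<psi> (2 powr real_of_int j * x - real_of_int k))"

definition wleader :: "(real \<Rightarrow> real) \<Rightarrow> (real \<Rightarrow> real) \<Rightarrow> int \<Rightarrow> int \<Rightarrow> ereal" where
  "wleader \<psi> F j k =
     (SUP p \<in> {(j', k'). \<exists>i \<in> {k - 1, k, k + 1}. dyadic_int j' k' \<subseteq> dyadic_int j i}.
        ereal \<bar>wcoef \<psi> F (fst p) (snd p)\<bar>)"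

definition wsupp :: "(real \<Rightarrow> real) \<Rightarrow> (real \<Rightarrow> real) \<Rightarrow> real set" where
  "wsupp \<psi> F = {x \<in> {0..1}. \<forall>n::nat. n \<ge> 1 \<longrightarrow>
       wleader \<psi> F (int n) \<lfloor>2 ^ n * x\<rfloor> > 0}"

definition hoelder_continuous :: "(real \<Rightarrow> real) \<Rightarrow> bool" where
  "hoelder_continuous F \<longleftrightarrow>
     (\<exists>\<alpha> C. \<alpha> > 0 \<and> (\<forall>x y. \<bar>F x - F y\<bar> \<le> C * \<bar>x - y\<bar> powr \<alpha>))"

definition hoelder_exp :: "(real \<Rightarrow> real) \<Rightarrow> real \<Rightarrow> ereal" where
  "hoelder_exp F x0 = Sup {ereal h | h. h \<ge> 0 \<and>
      (\<exists>P :: real poly. (\<lambda>x. F x - poly P (x - x0)) \<in> O[at x0](\<lambda>x. \<bar>x - x0\<bar> powr h))}"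

definition diam_pow :: "real \<Rightarrow> real set \<Rightarrow> real" where
  "diam_pow s U = (if U = {} then 0 else if s = 0 then 1 else diameter U powr s)"

definition hausdorff_pre :: "real \<Rightarrow> real \<Rightarrow> real set \<Rightarrow> ennreal" where
  "hausdorff_pre s \<delta> A =
     (INF U \<in> {U :: nat \<Rightarrow> real set. A \<subseteq> (\<Union>i. U i) \<and> (\<forall>i. bounded (U i) \<and> diameter (U i) \<le> \<delta>)}.
        (\<Sum>i. ennreal (diam_pow s (U i))))"

definition hausdorff_measure :: "real \<Rightarrow> real set \<Rightarrow> ennreal" where
  "hausdorff_measure s A = (SUP \<delta> \<in> {0<..}. hausdorff_pre s \<delta> A)"

definition dim_H :: "real set \<Rightarrow> ereal" where
  "dim_H A = (if A = {} then -\<infinity> else Inf {ereal s | s. s \<ge> 0 \<and> hausdorff_measure s A = 0})"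

definition iso_set :: "(real \<Rightarrow> real) \<Rightarrow> (real \<Rightarrow> real) \<Rightarrow> ereal \<Rightarrow> real set" where
  "iso_set \<psi> F h = {x \<in> wsupp \<psi> F. hoelder_exp F x = h}"

definition spectrum :: "(real \<Rightarrow> real) \<Rightarrow> (real \<Rightarrow> real) \<Rightarrow> ereal \<Rightarrow> ereal" where
  "spectrum \<psi> F h = dim_H (iso_set \<psi> F h)"

definition real_balls :: "real set set" where
  "real_balls = {ball c r | c r. r > 0} \<union> {cball c r | c r. r > 0}"

definition homogeneously_multifractal :: "(real \<Rightarrow> real) \<Rightarrow> (real \<Rightarrow> real) \<Rightarrow> bool" where
  "homogeneously_multifractal \<psi> F \<longleftrightarrow>
     (\<forall>h B B'. B \<in> real_balls \<longrightarrow> B' \<in> real_balls \<longrightarrow>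
        interior B \<inter> wsupp \<psi> F \<noteq> {} \<longrightarrow> interior B' \<inter> wsupp \<psi> F \<noteq> {} \<longrightarrow>
        dim_H (iso_set \<psi> F h \<inter> B) = dim_H (iso_set \<psi> F h \<inter> B'))"

definition usc_on_pos :: "(ereal \<Rightarrow> ereal) \<Rightarrow> bool" where
  "usc_on_pos f \<longleftrightarrow> (\<forall>t. openin (top_of_set {0..\<infinity>}) {h \<in> {0..\<infinity>}. f h < t})"

end

theory Submission
  imports Defs "HOL-Real_Asymp.Real_Asymp" "HOL-Probability.Sinc_Integral"
begin

text \<open>
  \<open>F\<close> is a wavelet series whose nonzero coefficients live on a tree of dyadic intervals at
  superexponentially growing scales. The children of a node are grouped into blocks with labels
  \<open>m\<close>; a block carries coefficients of exponent \<open>h\<^sub>m\<close> and about \<open>2\<^sup>s\<^sup>j\<close> equally spaced intervals of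
  length \<open>2\<^sup>-\<^sup>j\<close>, \<open>s = f h\<^sub>m\<close>, where the pairs \<open>(h\<^sub>m, f h\<^sub>m)\<close> are dense in the graph of \<open>f\<close> over its domain.
  Different blocks are so far apart that only the labels along the branch of a point matter: its
  exponent is the lower limit of the \<open>h\<^sub>m\<close> along the branch, which lies in the closed domain. Because
  of the lacunarity, the number of intervals of one generation is essentially determined by the last
  label, so covering by infinitely many generations and semicontinuity give the upper bound for the
  dimension, while branches along which \<open>(h\<^sub>m, f h\<^sub>m)\<close> converges to \<open>(h, f h)\<close> give the lower bound,
  inside every node of the tree.
\<close>

section \<open>Schwartz functions and finite differences\<close>

text \<open>The wavelet is merely of rapid decay, so every coefficient influences the function at
  every point. The exponent at \<open>x0\<close> is nevertheless local, because nodes carrying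
  another exponent stay at distance about 2^(-b), where b = o(J) at scale 2^(-J). Inside that
  distance, decay makes them smaller than any prescribed power of 2^(-J). Outside it, |x - x0|^h is
  at least 2^(-o(J)), a loss that half of the uniform decay 2^(-\<eta> J) absorbs, \<eta> being the
  minimum of the domain of f. That a small coefficient exponent really destroys regularity is shown
  by finite differences. Super-geometric growth of the scales isolates one layer: seen at its scale,
  the coarser layers are polynomials up to a tiny error, and the finer ones are bounded by a power
  of the next, far smaller scale. The same growth makes the number 2^(J n) of possible ancestors
  negligible against 2^(t J(n+1)) for every t > 0, which is why counting needs no history.\<close>

lemma alternating_binomial_poly_eq_0:
  fixes p :: "real poly"
  assumes "degree p < N"
  shows "(\<Sum>i\<le>N. (-1) ^ i * real (N choose i) * poly p (real i)) = 0"
  using assms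
proof (induction N arbitrary: p)
  case 0
  then show ?case by simp
next
  case (Suc N)
  \<comment> \<open>Pascal's rule turns the alternating sum of order N + 1 for \<open>p\<close> into
    the one of order N for \<open>q\<close>, and forming \<open>q\<close> cancels the leading
    coefficient of \<open>p\<close>.\<close>
  define q where "q = p - pcompose p [:1, 1:]"
  have split: "(\<Sum>i\<le>Suc N. (-1) ^ i * real (Suc N choose i) * poly p (real i))
      = (\<Sum>i\<le>N. (-1) ^ i * real (N choose i) * poly q (real i))"
  proof -
    have "(\<Sum>i\<le>Suc N. (-1) ^ i * real (Suc N choose i) * poly p (real i))
        = poly p 0 + (\<Sum>i\<le>N. (-1) ^ Suc i * real (Suc N choose Suc i) * poly p (real (Suc i)))"
      by (subst sum.atMost_Suc_shift) simp
    also have "\<dots> = poly p 0 + (\<Sum>i\<le>N. (-1) ^ Suc i * real (N choose Suc i) * poly p (real (Suc i)))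
        + (\<Sum>i\<le>N. (-1) ^ Suc i * real (N choose i) * poly p (real (Suc i)))"
      by (simp add: sum.distrib[symmetric] algebra_simps)
    also have "poly p 0 + (\<Sum>i\<le>N. (-1) ^ Suc i * real (N choose Suc i) * poly p (real (Suc i)))
        = (\<Sum>i\<le>Suc N. (-1) ^ i * real (N choose i) * poly p (real i))"
      by (simp add: sum.atMost_Suc_shift[of _ N] del: sum.atMost_Suc)
    also have "\<dots> = (\<Sum>i\<le>N. (-1) ^ i * real (N choose i) * poly p (real i))"
      by simp
    finally show ?thesis
      by (simp add: q_def poly_pcompose sum.distrib[symmetric] algebra_simps sum_subtractf)
  qed
  show ?case
  proof (cases "degree p = 0")
    case True
    then obtain c where "p = [:c:]" by (rule degree_eq_zeroE)
    then have "q = 0" by (simp add: q_def)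
    then show ?thesis by (simp only: split) simp
  next
    case False
    have "degree (pcompose p [:1, 1:]) = degree p" by (simp add: degree_pcompose)
    moreover have "lead_coeff (pcompose p [:1, 1:]) = lead_coeff p"
      by (subst lead_coeff_comp) auto
    ultimately have "coeff q (degree p) = 0" "degree q \<le> degree p"
      by (auto simp: q_def intro: degree_diff_le)
    then have "degree q < degree p" using False
      by (metis degree_0 le_neq_implies_less leading_coeff_0_iff zero_less_iff_neq_zero)
    then have "degree q < N" using Suc.prems by simp
    then show ?thesis by (simp only: split Suc.IH)
  qed
qed

lemma alternating_binomial_poly_affine_eq_0:
  fixes p :: "real poly"
  assumes "degree p < N"
  shows "(\<Sum>i\<le>N. (-1) ^ i * real (N choose i) * poly p (a + b * real i)) = 0"
proof -
  have "degree (pcompose p [:a, b:]) \<le> degree p" by (simp add: degree_pcompose)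
  then have "degree (pcompose p [:a, b:]) < N" using assms by simp
  from alternating_binomial_poly_eq_0[OF this] show ?thesis
    by (simp add: poly_pcompose algebra_simps)
qed

lemma alternating_binomial_abs_le:
  fixes g :: "nat \<Rightarrow> real"
  assumes "\<And>i. i \<le> N \<Longrightarrow> \<bar>g i\<bar> \<le> B"
  shows "\<bar>\<Sum>i\<le>N. (-1) ^ i * real (N choose i) * g i\<bar> \<le> 2 ^ N * B"
proof -
  have "\<bar>\<Sum>i\<le>N. (-1) ^ i * real (N choose i) * g i\<bar> \<le> (\<Sum>i\<le>N. real (N choose i) * B)"
    by (rule order_trans[OF sum_abs], rule sum_mono)
       (auto simp: abs_mult power_abs intro!: mult_left_mono assms)
  also have "\<dots> = 2 ^ N * B"
    using choose_row_sum[of N]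
    by (simp add: sum_distrib_right[symmetric] atLeast0AtMost flip: of_nat_sum)
  finally show ?thesis .
qed

lemma schwartz_decay:
  assumes "schwartz \<psi>"
  obtains C where "C > 0" "\<And>u. \<bar>(deriv ^^ i) \<psi> u\<bar> \<le> C / (1 + \<bar>u\<bar>) ^ M"
proof -
  from assms obtain C0 where C0: "\<And>x. \<bar>x ^ 0 * (deriv ^^ i) \<psi> x\<bar> \<le> C0"
    unfolding schwartz_def by blast
  from assms obtain C1 where C1: "\<And>x. \<bar>x ^ M * (deriv ^^ i) \<psi> x\<bar> \<le> C1"
    unfolding schwartz_def by blast
  define C where "C = 2 ^ M * (\<bar>C0\<bar> + \<bar>C1\<bar> + 1)"
  have "\<bar>(deriv ^^ i) \<psi> u\<bar> * (1 + \<bar>u\<bar>) ^ M \<le> C" for u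
  proof (cases "\<bar>u\<bar> \<le> 1")
    case True
    have "\<bar>(deriv ^^ i) \<psi> u\<bar> * (1 + \<bar>u\<bar>) ^ M \<le> (\<bar>C0\<bar> + \<bar>C1\<bar> + 1) * 2 ^ M"
      using C0[of u] True by (intro mult_mono power_mono) auto
    then show ?thesis by (simp add: C_def mult.commute)
  next
    case False
    have "\<bar>(deriv ^^ i) \<psi> u\<bar> * (1 + \<bar>u\<bar>) ^ M \<le> \<bar>(deriv ^^ i) \<psi> u\<bar> * (2 * \<bar>u\<bar>) ^ M"
      using False by (intro mult_left_mono power_mono) auto
    also have "\<dots> = 2 ^ M * \<bar>u ^ M * (deriv ^^ i) \<psi> u\<bar>"
      by (simp add: power_mult_distrib abs_mult power_abs)
    also have "\<dots> \<le> 2 ^ M * (\<bar>C0\<bar> + \<bar>C1\<bar> + 1)"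
      using C1[of u] by (intro mult_left_mono) auto
    finally show ?thesis by (simp add: C_def)
  qed
  then have "\<bar>(deriv ^^ i) \<psi> u\<bar> \<le> C / (1 + \<bar>u\<bar>) ^ M" for u
    by (subst pos_le_divide_eq) auto
  moreover have "C > 0" by (auto simp: C_def)
  ultimately show ?thesis using that by blast
qed

text \<open>The point is uniformity in \<open>u\<close>. Replacing \<open>u\<close> by its floor
  changes one plus the distance to an integer by a factor of at most 2, hence the factor 4 on
  squares; the centred sum is then split into nonnegative and negative integers, on each of which
  the absolute value is injective.\<close>

lemma inverse_square_int_sum_bounded:
  obtains C :: real where "C > 0"
    "\<And>A u. finite A \<Longrightarrow> (\<Sum>k\<in>A. 1 / (1 + \<bar>u - real_of_int k\<bar>)\<^sup>2) \<le> C"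
proof -
  define T where "T = (\<Sum>n. 1 / (real (Suc n))\<^sup>2)"
  have sm: "summable (\<lambda>n. 1 / (real (Suc n))\<^sup>2)"
    using inverse_power_summable[of 2, where 'a=real]
    by (subst summable_Suc_iff) (simp add: field_simps)
  have half: "(\<Sum>k\<in>A. 1 / (1 + \<bar>real_of_int k\<bar>)\<^sup>2) \<le> T"
    if "finite A" "inj_on (\<lambda>k. nat \<bar>k\<bar>) A" for A
  proof -
    have "(\<Sum>k\<in>A. 1 / (1 + \<bar>real_of_int k\<bar>)\<^sup>2) = (\<Sum>k\<in>A. 1 / (real (Suc (nat \<bar>k\<bar>)))\<^sup>2)"
      by (intro sum.cong) auto
    also have "\<dots> = (\<Sum>n\<in>(\<lambda>k. nat \<bar>k\<bar>) ` A. 1 / (real (Suc n))\<^sup>2)"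
      by (subst sum.reindex[OF that(2)]) simp
    also have "\<dots> \<le> T" unfolding T_def
      by (intro sum_le_suminf sm) (auto simp: that)
    finally show ?thesis .
  qed
  have int: "(\<Sum>k\<in>A. 1 / (1 + \<bar>real_of_int k\<bar>)\<^sup>2) \<le> 2 * T" if "finite A" for A
  proof -
    have "(\<Sum>k\<in>A. 1 / (1 + \<bar>real_of_int k\<bar>)\<^sup>2)
       = (\<Sum>k\<in>A \<inter> {0..}. 1 / (1 + \<bar>real_of_int k\<bar>)\<^sup>2) + (\<Sum>k\<in>A - {0..}. 1 / (1 + \<bar>real_of_int k\<bar>)\<^sup>2)"
      using that by (rule sum.Int_Diff)
    also have "\<dots> \<le> T + T"
      by (intro add_mono half) (auto simp: that inj_on_def)
    finally show ?thesis by simp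
  qed
  have "(\<Sum>k\<in>A. 1 / (1 + \<bar>u - real_of_int k\<bar>)\<^sup>2) \<le> 4 * (2 * T)" if "finite A" for A u
  proof -
    have "(\<Sum>k\<in>A. 1 / (1 + \<bar>u - real_of_int k\<bar>)\<^sup>2)
        \<le> (\<Sum>k\<in>A. 4 * (1 / (1 + \<bar>real_of_int (k - \<lfloor>u\<rfloor>)\<bar>)\<^sup>2))"
    proof (rule sum_mono)
      fix k
      have "1 + \<bar>real_of_int (k - \<lfloor>u\<rfloor>)\<bar> \<le> 2 * (1 + \<bar>u - real_of_int k\<bar>)"
      proof -
        have "1 + \<bar>a - b\<bar> \<le> 2 * (1 + \<bar>u - a\<bar>)" if "b \<le> u" "u < b + 1" for a b :: real
          using that by (smt (verit))
        then show ?thesis by (simp only: of_int_diff) simp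
      qed
      then have "(1 + \<bar>real_of_int (k - \<lfloor>u\<rfloor>)\<bar>)\<^sup>2 \<le> (2 * (1 + \<bar>u - real_of_int k\<bar>))\<^sup>2"
        by (rule power_mono) auto
      then have "(1 + \<bar>real_of_int (k - \<lfloor>u\<rfloor>)\<bar>)\<^sup>2 \<le> 4 * (1 + \<bar>u - real_of_int k\<bar>)\<^sup>2"
        by (simp only: power_mult_distrib) simp
      moreover have "(1 + \<bar>real_of_int (k - \<lfloor>u\<rfloor>)\<bar>)\<^sup>2 > 0" "(1 + \<bar>u - real_of_int k\<bar>)\<^sup>2 > 0"
        by (auto intro!: zero_less_power simp del: of_int_diff)
      ultimately show "1 / (1 + \<bar>u - real_of_int k\<bar>)\<^sup>2
          \<le> 4 * (1 / (1 + \<bar>real_of_int (k - \<lfloor>u\<rfloor>)\<bar>)\<^sup>2)"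
        by (simp only: divide_simps) simp
    qed
    also have "\<dots> = 4 * (\<Sum>k\<in>(\<lambda>k. k - \<lfloor>u\<rfloor>) ` A. 1 / (1 + \<bar>real_of_int k\<bar>)\<^sup>2)"
      by (subst sum.reindex) (auto simp: inj_on_def sum_distrib_left)
    also have "\<dots> \<le> 4 * (2 * T)" using int[of "(\<lambda>k. k - \<lfloor>u\<rfloor>) ` A"] that by simp
    finally show ?thesis .
  qed
  moreover have "4 * (2 * T) \<le> 8 * \<bar>T\<bar> + 1" "8 * \<bar>T\<bar> + 1 > 0" by auto
  ultimately show ?thesis using that[of "8 * \<bar>T\<bar> + 1"] by (meson order_trans)
qed

text \<open>Two powers of the decay are spent on summability over the lattice; the remaining
  \<open>M\<close> are uniformly at most R^(-M) on lattice points that are \<open>R\<close>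
  away.\<close>

lemma schwartz_lattice_sum:
  assumes "schwartz \<psi>"
  obtains C where "C > 0"
    "\<And>u R A. finite A \<Longrightarrow> 1 \<le> R \<Longrightarrow> (\<And>k. k \<in> A \<Longrightarrow> R \<le> 1 + \<bar>u - real_of_int k\<bar>) \<Longrightarrow>
       (\<Sum>k\<in>A. \<bar>(deriv ^^ i) \<psi> (u - real_of_int k)\<bar>) \<le> C / R ^ M"
proof -
  obtain C where C: "C > 0" "\<And>u. \<bar>(deriv ^^ i) \<psi> u\<bar> \<le> C / (1 + \<bar>u\<bar>) ^ (M + 2)"
    using schwartz_decay[OF assms] by blast
  obtain C' :: real where C': "C' > 0"
      "\<And>A u. finite A \<Longrightarrow> (\<Sum>k\<in>A. 1 / (1 + \<bar>u - real_of_int k\<bar>)\<^sup>2) \<le> C'"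
    using inverse_square_int_sum_bounded by blast
  have "(\<Sum>k\<in>A. \<bar>(deriv ^^ i) \<psi> (u - real_of_int k)\<bar>) \<le> (C * C') / R ^ M"
    if A: "finite A" "1 \<le> R" "\<And>k. k \<in> A \<Longrightarrow> R \<le> 1 + \<bar>u - real_of_int k\<bar>" for u R A
  proof -
    have "(\<Sum>k\<in>A. \<bar>(deriv ^^ i) \<psi> (u - real_of_int k)\<bar>)
        \<le> (\<Sum>k\<in>A. (C / R ^ M) * (1 / (1 + \<bar>u - real_of_int k\<bar>)\<^sup>2))"
    proof (rule sum_mono)
      fix k assume "k \<in> A"
      have "\<bar>(deriv ^^ i) \<psi> (u - real_of_int k)\<bar> \<le> C / (1 + \<bar>u - real_of_int k\<bar>) ^ (M + 2)"
        by (rule C)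
      also have "\<dots> = (C / (1 + \<bar>u - real_of_int k\<bar>) ^ M) * (1 / (1 + \<bar>u - real_of_int k\<bar>)\<^sup>2)"
        by (simp add: power_add power2_eq_square)
      also have "\<dots> \<le> (C / R ^ M) * (1 / (1 + \<bar>u - real_of_int k\<bar>)\<^sup>2)"
        using A(2) A(3)[OF \<open>k \<in> A\<close>] C(1)
        by (intro mult_right_mono divide_left_mono power_mono mult_pos_pos zero_less_power) auto
      finally show "\<bar>(deriv ^^ i) \<psi> (u - real_of_int k)\<bar>
          \<le> (C / R ^ M) * (1 / (1 + \<bar>u - real_of_int k\<bar>)\<^sup>2)" .
    qed
    also have "\<dots> = (C / R ^ M) * (\<Sum>k\<in>A. 1 / (1 + \<bar>u - real_of_int k\<bar>)\<^sup>2)"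
      by (simp add: sum_distrib_left)
    also have "\<dots> \<le> (C / R ^ M) * C'"
      using C(1) A(2) by (intro mult_left_mono C' A) auto
    finally show ?thesis by simp
  qed
  then show ?thesis using that[of "C * C'"] C(1) C'(1) by auto
qed

text \<open>A step so large that only the first term of the difference survives the decay.\<close>
lemma schwartz_finite_difference_nonzero:
  assumes "schwartz \<psi>" "\<psi> u \<noteq> 0"
  obtains t where "t > 0" "(\<Sum>i\<le>N. (-1) ^ i * real (N choose i) * \<psi> (u + t * real i)) \<noteq> 0"
proof -
  obtain C where C: "C > 0" "\<And>u. \<bar>\<psi> u\<bar> \<le> C / (1 + \<bar>u\<bar>) ^ 1"
    using schwartz_decay[OF assms(1), of 0 1] by auto
  \<comment> \<open>The summand |u| compensates the offset of the progression. All later samples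
    then have modulus at least 2^N C / |\<psi> u|, where the decay makes |\<psi>| smaller than
    |\<psi> u| / 2^N, and 2^N is the total weight of the binomial coefficients.\<close>
  define t where "t = \<bar>u\<bar> + 2 ^ N * C / \<bar>\<psi> u\<bar> + 1"
  have t: "t > 0" using C(1) by (auto simp: t_def intro!: add_nonneg_pos)
  define g where "g i = (if i = 0 then 0 else \<psi> (u + t * real i))" for i :: nat
  have g: "\<bar>g i\<bar> \<le> C / (1 + 2 ^ N * C / \<bar>\<psi> u\<bar>)" for i
  proof (cases "i = 0")
    case True
    then show ?thesis using C(1) by (simp add: g_def)
  next
    case False
    then have "t * 1 \<le> t * real i" using t by (intro mult_left_mono) auto
    then have "2 ^ N * C / \<bar>\<psi> u\<bar> \<le> \<bar>u + t * real i\<bar>"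
      using t_def abs_ge_minus_self[of u] abs_ge_self[of "u + t * real i"]
      unfolding mult_1_right by argo
    then have "C / (1 + \<bar>u + t * real i\<bar>) ^ 1 \<le> C / (1 + 2 ^ N * C / \<bar>\<psi> u\<bar>)"
      using C(1) by (auto intro!: divide_left_mono mult_pos_pos add_pos_nonneg)
    then show ?thesis using C(2)[of "u + t * real i"] False by (simp add: g_def)
  qed
  have eq: "(\<Sum>i\<le>N. (-1) ^ i * real (N choose i) * \<psi> (u + t * real i))
      = \<psi> u + (\<Sum>i\<le>N. (-1) ^ i * real (N choose i) * g i)"
    by (subst (1 2) sum.atMost_shift) (simp add: g_def)
  have "\<bar>\<Sum>i\<le>N. (-1) ^ i * real (N choose i) * g i\<bar> \<le> 2 ^ N * (C / (1 + 2 ^ N * C / \<bar>\<psi> u\<bar>))"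
    by (rule alternating_binomial_abs_le) (rule g)
  also have "\<dots> < \<bar>\<psi> u\<bar>"
  proof -
    have "2 ^ N * C < \<bar>\<psi> u\<bar> * (1 + 2 ^ N * C / \<bar>\<psi> u\<bar>)"
      using assms(2) by (simp add: ring_distribs)
    moreover have "1 + 2 ^ N * C / \<bar>\<psi> u\<bar> > 0" using C(1) by (simp add: add_pos_nonneg)
    ultimately show ?thesis by (simp add: pos_divide_less_eq)
  qed
  finally have "(\<Sum>i\<le>N. (-1) ^ i * real (N choose i) * \<psi> (u + t * real i)) \<noteq> 0"
    unfolding eq by linarith
  with t show ?thesis using that by blast
qed

section \<open>Lacunary wavelet series\<close>

text \<open>There are two kinds of separation. By \<open>sep\<close>, the distance of nodes of one
  level, in units of 2^(-J n), tends to infinity, so a layer seen at its own scale near a node looks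
  like a single wavelet. By \<open>sep_ex\<close>, nodes with different exponents are at true
  distance at least 2^(-b n), and \<open>b_small\<close> makes this eventually larger than any fixed
  negative power of 2^(J n). \<open>lacunary\<close> asks for growth faster than every geometric
  rate.\<close>

locale wavelet_series =
  fixes \<psi> :: "real \<Rightarrow> real" and J :: "nat \<Rightarrow> nat" and Nd :: "nat \<Rightarrow> int set"
    and ex :: "nat \<Rightarrow> int \<Rightarrow> real" and \<eta> :: real and b :: "nat \<Rightarrow> real"
  assumes schwartz: "schwartz \<psi>"
    and J: "strict_mono J"
    and lacunary: "\<And>A::real. eventually (\<lambda>n. A * J n \<le> J (Suc n)) sequentially"
    and finite_Nd: "finite (Nd n)"
    and eta_pos: "\<eta> > 0"
    and ex_ge: "k \<in> Nd n \<Longrightarrow> \<eta> \<le> ex n k"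
    and sep: "k \<in> Nd n \<Longrightarrow> k' \<in> Nd n \<Longrightarrow> k \<noteq> k' \<Longrightarrow> real n \<le> \<bar>real_of_int k - real_of_int k'\<bar>"
    and sep_ex: "k \<in> Nd n \<Longrightarrow> k' \<in> Nd n \<Longrightarrow> ex n k \<noteq> ex n k' \<Longrightarrow>
      2 powr (J n - b n) \<le> \<bar>real_of_int k - real_of_int k'\<bar>"
    and b_nonneg: "0 \<le> b n"
    and b_small: "\<And>\<epsilon>::real. \<epsilon> > 0 \<Longrightarrow> eventually (\<lambda>n. b n \<le> \<epsilon> * J n) sequentially"
begin

text \<open>The index \<open>i\<close> is the order of differentiation. Carrying it in the
  definition makes all derivatives of a layer available to Taylor's formula.\<close>

definition wterm :: "nat \<Rightarrow> nat \<Rightarrow> real \<Rightarrow> int \<Rightarrow> real" where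
  "wterm i n x k = 2 powr (- (ex n k * J n)) * ((2 ^ J n) ^ i * (deriv ^^ i) \<psi> (2 ^ J n * x - real_of_int k))"

definition layer :: "nat \<Rightarrow> nat \<Rightarrow> real \<Rightarrow> real" where
  "layer i n x = (\<Sum>k\<in>Nd n. wterm i n x k)"

definition F :: "real \<Rightarrow> real" where
  "F x = (\<Sum>n. layer 0 n x)"

definition node :: "nat \<Rightarrow> real \<Rightarrow> int" where
  "node n x = \<lfloor>2 ^ J n * x\<rfloor>"

text \<open>Stands in for \<open>wsupp\<close>, with which it coincides once the nodes are nested
  with margins (\<open>wsupp_eq\<close>).\<close>

definition K :: "real set" where
  "K = {x. \<forall>n. node n x \<in> Nd n}"

definition E :: "nat \<Rightarrow> real \<Rightarrow> real" where
  "E n x = ex n (node n x)"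

lemma J_ge: "n \<le> J n"
  using J by (rule strict_mono_imp_increasing)

lemma powr_J: "2 powr real (J n) = 2 ^ J n"
  by (simp add: powr_realpow)

lemma powr_neg_J_le: "0 \<le> c \<Longrightarrow> 2 powr (- (c * real (J n))) \<le> (2 powr (- c)) ^ n"
proof -
  assume c: "0 \<le> c"
  have "2 powr (- (c * real (J n))) \<le> 2 powr (- c * real n)"
    using c J_ge[of n] by (simp add: mult_left_mono)
  also have "\<dots> = (2 powr (- c)) ^ n"
    by (simp add: powr_powr flip: powr_realpow)
  finally show ?thesis .
qed

lemma summable_powr_neg_J: "0 < c \<Longrightarrow> summable (\<lambda>n. 2 powr (- (c * real (J n))))"
  by (rule summable_comparison_test'[where g = "\<lambda>n. (2 powr (- c)) ^ n" and N = 0])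
     (auto intro!: summable_geometric powr_neg_J_le simp: powr_less_one)

lemma layer_deriv: "(layer i n has_real_derivative layer (Suc i) n x) (at x)"
proof -
  have "((\<lambda>x. wterm i n x k) has_real_derivative wterm (Suc i) n x k) (at x)" for k
  proof -
    have "((deriv ^^ i) \<psi>) differentiable (at y)" for y
      using schwartz unfolding schwartz_def by blast
    then have d: "((deriv ^^ i) \<psi> has_real_derivative (deriv ^^ Suc i) \<psi> y) (at y)" for y
      by (simp add: DERIV_deriv_iff_real_differentiable)
    show ?thesis unfolding wterm_def
      by (rule derivative_eq_intros DERIV_chain2[OF d] refl | simp)+
  qed
  then show ?thesis unfolding layer_def[abs_def] by (intro DERIV_sum)
qed

lemma layer_continuous: "continuous_on UNIV (layer i n)"
  by (intro continuous_at_imp_continuous_on ballI DERIV_isCont[OF layer_deriv])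

text \<open>The common source of all estimates of layers: they differ only in the set
  \<open>A\<close> of nodes kept, the lower bound \<open>e\<close> for their exponents, and the
  distance \<open>R\<close> together with the number \<open>M\<close> of powers of decay that are
  exploited.\<close>

lemma part_bound:
  obtains C where "C > 0"
    "\<And>n x A R e. A \<subseteq> Nd n \<Longrightarrow> 1 \<le> R \<Longrightarrow> (\<And>k. k \<in> A \<Longrightarrow> R \<le> 1 + \<bar>2 ^ J n * x - real_of_int k\<bar>) \<Longrightarrow>
       (\<And>k. k \<in> A \<Longrightarrow> e \<le> ex n k) \<Longrightarrow>
       \<bar>\<Sum>k\<in>A. wterm i n x k\<bar> \<le> C * (2 ^ J n) ^ i * 2 powr (- (e * J n)) / R ^ M"
proof -
  obtain C where C: "C > 0"
    "\<And>u R A. finite A \<Longrightarrow> 1 \<le> R \<Longrightarrow> (\<And>k. k \<in> A \<Longrightarrow> R \<le> 1 + \<bar>u - real_of_int k\<bar>) \<Longrightarrow>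
       (\<Sum>k\<in>A. \<bar>(deriv ^^ i) \<psi> (u - real_of_int k)\<bar>) \<le> C / R ^ M"
    using schwartz_lattice_sum[OF schwartz] by blast
  show ?thesis
  proof (rule that[OF C(1)])
    fix n x A R e
    assume A: "A \<subseteq> Nd n" "1 \<le> R" "\<And>k. k \<in> A \<Longrightarrow> R \<le> 1 + \<bar>2 ^ J n * x - real_of_int k\<bar>"
      "\<And>k. k \<in> A \<Longrightarrow> e \<le> ex n k"
    have "\<bar>\<Sum>k\<in>A. wterm i n x k\<bar>
        \<le> (\<Sum>k\<in>A. 2 powr (- (e * J n)) * ((2 ^ J n) ^ i * \<bar>(deriv ^^ i) \<psi> (2 ^ J n * x - real_of_int k)\<bar>))"
      by (rule order_trans[OF sum_abs], rule sum_mono)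
         (auto simp: wterm_def abs_mult power_abs intro!: mult_right_mono A(4))
    also have "\<dots> = 2 powr (- (e * J n)) * (2 ^ J n) ^ i *
        (\<Sum>k\<in>A. \<bar>(deriv ^^ i) \<psi> (2 ^ J n * x - real_of_int k)\<bar>)"
      by (simp add: sum_distrib_left mult_ac)
    also have "\<dots> \<le> 2 powr (- (e * J n)) * (2 ^ J n) ^ i * (C / R ^ M)"
      using A by (intro mult_left_mono C(2) finite_subset[OF A(1) finite_Nd]) auto
    finally show "\<bar>\<Sum>k\<in>A. wterm i n x k\<bar> \<le> C * (2 ^ J n) ^ i * 2 powr (- (e * J n)) / R ^ M"
      by (simp add: mult_ac)
  qed
qed

section \<open>Convergence of the series and uniform regularity\<close>

lemma layer_bound:
  obtains C where "C > 0" "\<And>n x. \<bar>layer i n x\<bar> \<le> C * (2 ^ J n) ^ i * 2 powr (- (\<eta> * J n))"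
proof -
  obtain C where C: "C > 0"
    "\<And>n x A R e. A \<subseteq> Nd n \<Longrightarrow> 1 \<le> R \<Longrightarrow> (\<And>k. k \<in> A \<Longrightarrow> R \<le> 1 + \<bar>2 ^ J n * x - real_of_int k\<bar>) \<Longrightarrow>
       (\<And>k. k \<in> A \<Longrightarrow> e \<le> ex n k) \<Longrightarrow>
       \<bar>\<Sum>k\<in>A. wterm i n x k\<bar> \<le> C * (2 ^ J n) ^ i * 2 powr (- (e * J n)) / R ^ 0"
    using part_bound[of i 0] by blast
  have "\<bar>layer i n x\<bar> \<le> C * (2 ^ J n) ^ i * 2 powr (- (\<eta> * J n))" for n x
    unfolding layer_def using C(2)[of "Nd n" n 1 x \<eta>] ex_ge by simp
  with C(1) that show ?thesis by blast
qed

lemma layer0_bound: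
  obtains C where "C > 0" "\<And>n x. \<bar>layer 0 n x\<bar> \<le> C * 2 powr (- (\<eta> * J n))"
  using that layer_bound[of 0] by auto

lemma summable_layer0: "summable (\<lambda>n. \<bar>layer 0 n x\<bar>)"
proof -
  obtain C where C: "C > 0" "\<And>n x. \<bar>layer 0 n x\<bar> \<le> C * 2 powr (- (\<eta> * J n))"
    using layer0_bound by blast
  show ?thesis
    by (rule summable_comparison_test'[where g = "\<lambda>n. C * 2 powr (- (\<eta> * J n))" and N = 0])
       (auto intro!: C summable_mult summable_powr_neg_J eta_pos)
qed

lemma summable_layer: "summable (\<lambda>n. layer 0 n x)"
  by (rule summable_rabs_cancel[OF summable_layer0])

lemma F_bounded: "bounded (range F)"
proof -
  obtain C where C: "C > 0" "\<And>n x. \<bar>layer 0 n x\<bar> \<le> C * 2 powr (- (\<eta> * J n))"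
    using layer0_bound by blast
  have "\<bar>F x\<bar> \<le> (\<Sum>n. C * 2 powr (- (\<eta> * J n)))" for x
  proof -
    have "\<bar>F x\<bar> \<le> (\<Sum>n. \<bar>layer 0 n x\<bar>)" unfolding F_def by (rule summable_rabs[OF summable_layer0])
    also have "\<dots> \<le> (\<Sum>n. C * 2 powr (- (\<eta> * J n)))"
      by (intro suminf_le C summable_layer0 summable_mult summable_powr_neg_J eta_pos)
    finally show ?thesis .
  qed
  then show ?thesis by (auto simp: bounded_iff intro!: exI)
qed

text \<open>Each layer is interpolated between its sup bound, used for |x - y| > 2^(-J n), and its
  derivative bound, used below that scale. The exponent \<alpha> is at most 1 because only first
  derivatives enter, and below \<eta> so that the factor 2^(-(\<eta> - \<alpha>) J n) is left for
  summation.\<close>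

lemma F_hoelder: "hoelder_continuous F"
proof -
  obtain C where C: "C > 0" "\<And>n x. \<bar>layer 0 n x\<bar> \<le> C * 2 powr (- (\<eta> * J n))"
    using layer0_bound by blast
  obtain D where D: "D > 0" "\<And>n x. \<bar>layer 1 n x\<bar> \<le> D * 2 ^ J n * 2 powr (- (\<eta> * J n))"
    using layer_bound[of 1] by auto
  define \<alpha> where "\<alpha> = min 1 (\<eta> / 2)"
  have \<alpha>: "0 < \<alpha>" "\<alpha> \<le> 1" "\<alpha> < \<eta>" using eta_pos by (auto simp: \<alpha>_def)
  define B where "B = 2 * C + D"
  have B: "B > 0" using C(1) D(1) by (simp add: B_def)
  have each: "\<bar>layer 0 n x - layer 0 n y\<bar> \<le> (B * 2 powr (- ((\<eta> - \<alpha>) * J n))) * \<bar>x - y\<bar> powr \<alpha>" for n x y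
  proof -
    have le: "\<bar>layer 0 n x - layer 0 n y\<bar> \<le> B * 2 powr (- (\<eta> * J n)) * (2 ^ J n * \<bar>x - y\<bar>) powr \<alpha>"
    proof (cases "2 ^ J n * \<bar>x - y\<bar> \<le> 1")
      case True
      have "\<bar>layer 0 n x - layer 0 n y\<bar> \<le> (D * 2 ^ J n * 2 powr (- (\<eta> * J n))) * \<bar>x - y\<bar>"
        using field_differentiable_bound[of UNIV "layer 0 n" "layer 1 n"
            "D * 2 ^ J n * 2 powr (- (\<eta> * J n))" x y] layer_deriv[of 0 n] D(2)
        by auto
      also have "\<dots> = D * 2 powr (- (\<eta> * J n)) * (2 ^ J n * \<bar>x - y\<bar>)" by simp
      also have "\<dots> \<le> B * 2 powr (- (\<eta> * J n)) * (2 ^ J n * \<bar>x - y\<bar>) powr \<alpha>"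
      proof (intro mult_mono)
        show "2 ^ J n * \<bar>x - y\<bar> \<le> (2 ^ J n * \<bar>x - y\<bar>) powr \<alpha>"
          using powr_mono'[of \<alpha> 1 "2 ^ J n * \<bar>x - y\<bar>"] True \<alpha> by simp
      qed (use C(1) D(1) in \<open>auto simp: B_def\<close>)
      finally show ?thesis .
    next
      case False
      have "\<bar>layer 0 n x - layer 0 n y\<bar> \<le> 2 * C * 2 powr (- (\<eta> * J n))"
        using C(2)[of n x] C(2)[of n y] by linarith
      also have "\<dots> \<le> B * 2 powr (- (\<eta> * J n)) * (2 ^ J n * \<bar>x - y\<bar>) powr \<alpha>"
      proof -
        have "(1::real) \<le> (2 ^ J n * \<bar>x - y\<bar>) powr \<alpha>"
          using False \<alpha> by (intro ge_one_powr_ge_zero) auto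
        then have "2 * C * 2 powr (- (\<eta> * J n)) * 1
            \<le> B * 2 powr (- (\<eta> * J n)) * (2 ^ J n * \<bar>x - y\<bar>) powr \<alpha>"
          using C(1) D(1) by (intro mult_mono) (auto simp: B_def)
        then show ?thesis by simp
      qed
      finally show ?thesis .
    qed
    have "2 powr (- (\<eta> * J n)) * (2 ^ J n * \<bar>x - y\<bar>) powr \<alpha>
        = 2 powr (- ((\<eta> - \<alpha>) * J n)) * \<bar>x - y\<bar> powr \<alpha>"
      by (simp add: powr_mult powr_J[symmetric] powr_powr powr_add[symmetric] algebra_simps)
    then show ?thesis using le by (simp add: mult.assoc)
  qed
  define S where "S = (\<Sum>n. B * 2 powr (- ((\<eta> - \<alpha>) * J n)))"
  have sm: "summable (\<lambda>n. B * 2 powr (- ((\<eta> - \<alpha>) * J n)))"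
    using \<alpha> by (intro summable_mult summable_powr_neg_J) auto
  have "\<bar>F x - F y\<bar> \<le> S * \<bar>x - y\<bar> powr \<alpha>" for x y
  proof -
    have "\<bar>F x - F y\<bar> = \<bar>\<Sum>n. layer 0 n x - layer 0 n y\<bar>"
      by (simp add: F_def suminf_diff summable_layer)
    also have "\<dots> \<le> (\<Sum>n. (B * 2 powr (- ((\<eta> - \<alpha>) * J n))) * \<bar>x - y\<bar> powr \<alpha>)"
    proof -
      have s: "summable (\<lambda>n. (B * 2 powr (- ((\<eta> - \<alpha>) * J n))) * \<bar>x - y\<bar> powr \<alpha>)"
        by (intro summable_mult2 sm)
      have s': "summable (\<lambda>n. \<bar>layer 0 n x - layer 0 n y\<bar>)"
        by (rule summable_comparison_test'[OF s, of 0]) (use each in auto)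
      show ?thesis
        by (rule order_trans[OF summable_rabs[OF s']]) (intro suminf_le each s s')
    qed
    also have "\<dots> = S * \<bar>x - y\<bar> powr \<alpha>"
      unfolding S_def by (rule suminf_mult2[symmetric, OF sm])
    finally show ?thesis .
  qed
  then show ?thesis unfolding hoelder_continuous_def using \<alpha>(1) by blast
qed

lemma F_continuous: "continuous_on UNIV F"
proof -
  obtain \<alpha> C where h: "\<alpha> > 0" "\<And>x y. \<bar>F x - F y\<bar> \<le> C * \<bar>x - y\<bar> powr \<alpha>"
    using F_hoelder unfolding hoelder_continuous_def by blast
  have "(F \<longlongrightarrow> F x) (at x)" for x
  proof -
    have "((\<lambda>y. C * \<bar>y - x\<bar> powr \<alpha>) \<longlongrightarrow> C * \<bar>x - x\<bar> powr \<alpha>) (at x)"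
      by (rule tendsto_intros tendsto_powr' | use h(1) in simp)+
    then have "((\<lambda>y. C * \<bar>y - x\<bar> powr \<alpha>) \<longlongrightarrow> 0) (at x)" by simp
    then have "((\<lambda>y. F y - F x) \<longlongrightarrow> 0) (at x)"
      by (rule Lim_null_comparison[rotated]) (use h(2) in auto)
    then show ?thesis by (simp add: LIM_zero_iff)
  qed
  then show ?thesis by (simp add: continuous_on_def)
qed

section \<open>Size of one layer near a point of the limit set\<close>

lemma dist_node: "\<bar>2 ^ J n * x - real_of_int (node n x)\<bar> \<le> 1"
  unfolding node_def by linarith

text \<open>Nodes with an exponent other than that of \<open>x0\<close> remain at distance about
  2^(J n - b n) / 2 from x, in units of 2^(-J n). Since b n \<le> J n / 2, each power of decay gains
  2^(-J n / 2) up to a constant, so M \<ge> 2 H powers give 2^(-H J n) for \<open>H\<close> as large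
  as desired.\<close>

lemma far_part:
  fixes H :: real
  obtains C where "C > 0"
    "\<And>n x0 x. node n x0 \<in> Nd n \<Longrightarrow> b n \<le> J n / 2 \<Longrightarrow> \<bar>x - x0\<bar> \<le> 2 powr (- b n) / 2 \<Longrightarrow>
      \<bar>\<Sum>k\<in>{k \<in> Nd n. ex n k \<noteq> E n x0}. wterm i n x k\<bar> \<le> C * (2 ^ J n) ^ i * 2 powr (- (H * J n))"
proof -
  define M where "M = nat \<lceil>2 * H\<rceil>"
  have M: "2 * H \<le> M" unfolding M_def by linarith
  obtain C where C: "C > 0"
    "\<And>n x A R e. A \<subseteq> Nd n \<Longrightarrow> 1 \<le> R \<Longrightarrow> (\<And>k. k \<in> A \<Longrightarrow> R \<le> 1 + \<bar>2 ^ J n * x - real_of_int k\<bar>) \<Longrightarrow>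
       (\<And>k. k \<in> A \<Longrightarrow> e \<le> ex n k) \<Longrightarrow>
       \<bar>\<Sum>k\<in>A. wterm i n x k\<bar> \<le> C * (2 ^ J n) ^ i * 2 powr (- (e * J n)) / R ^ M"
    using part_bound[of i M] by blast
  have "\<bar>\<Sum>k\<in>{k \<in> Nd n. ex n k \<noteq> E n x0}. wterm i n x k\<bar>
      \<le> (C * 2 ^ M) * (2 ^ J n) ^ i * 2 powr (- (H * J n))"
    if n: "node n x0 \<in> Nd n" "b n \<le> J n / 2" "\<bar>x - x0\<bar> \<le> 2 powr (- b n) / 2" for n x0 x
  proof -
    define g where "g = (2::real) powr (J n - b n) / 2"
    define R where "R = max 1 g"
    have "\<bar>\<Sum>k\<in>{k \<in> Nd n. ex n k \<noteq> E n x0}. wterm i n x k\<bar>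
        \<le> C * (2 ^ J n) ^ i * 2 powr (- (\<eta> * J n)) / R ^ M"
    proof (rule C(2))
      fix k assume "k \<in> {k \<in> Nd n. ex n k \<noteq> E n x0}"
      then have k: "k \<in> Nd n" "ex n k \<noteq> ex n (node n x0)" by (auto simp: E_def)
      then show "\<eta> \<le> ex n k" by (simp add: ex_ge)
      have "2 * g \<le> \<bar>real_of_int k - real_of_int (node n x0)\<bar>"
        using sep_ex[OF k(1) n(1) k(2)] by (simp add: g_def)
      moreover have "\<bar>2 ^ J n * x - 2 ^ J n * x0\<bar> \<le> g"
      proof -
        have "\<bar>2 ^ J n * x - 2 ^ J n * x0\<bar> = 2 ^ J n * \<bar>x - x0\<bar>"
          by (simp add: abs_mult right_diff_distrib[symmetric])
        also have "\<dots> \<le> 2 ^ J n * (2 powr (- b n) / 2)" using n(3) by simp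
        also have "\<dots> = g" by (simp add: g_def powr_J[symmetric] powr_diff powr_minus divide_simps)
        finally show ?thesis .
      qed
      ultimately have "g \<le> 1 + \<bar>2 ^ J n * x - real_of_int k\<bar>"
        using dist_node[of n x0] by linarith
      then show "R \<le> 1 + \<bar>2 ^ J n * x - real_of_int k\<bar>" by (simp add: R_def)
    qed (auto simp: R_def)
    also have "\<dots> \<le> C * (2 ^ J n) ^ i * 1 / (2 powr (H * J n) / 2 ^ M)"
    proof (intro frac_le mult_left_mono)
      show "2 powr (- (\<eta> * J n)) \<le> 1" using eta_pos powr_mono[of "- (\<eta> * J n)" 0 2] by simp
      have "H * J n \<le> (J n - b n) * M"
      proof -
        have "H * J n \<le> (M / 2) * J n" using M by (intro mult_right_mono) auto
        also have "\<dots> = (J n / 2) * M" by simp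
        also have "\<dots> \<le> (J n - b n) * M" using n(2) by (intro mult_right_mono) auto
        finally show ?thesis .
      qed
      then have "2 powr (H * J n) \<le> (2 powr (J n - b n)) powr M"
        by (simp add: powr_powr)
      then have "2 powr (H * J n) / 2 ^ M \<le> g ^ M"
        by (simp add: g_def power_divide powr_realpow divide_right_mono)
      also have "\<dots> \<le> R ^ M" by (intro power_mono) (auto simp: R_def g_def)
      finally show "2 powr (H * J n) / 2 ^ M \<le> R ^ M" .
    qed (use C(1) in auto)
    also have "\<dots> = (C * 2 ^ M) * (2 ^ J n) ^ i * 2 powr (- (H * J n))"
      by (simp add: powr_minus divide_simps)
    finally show ?thesis .
  qed
  then show ?thesis using that[of "C * 2 ^ M"] C(1) by auto
qed

text \<open>Nodes sharing the exponent of \<open>x0\<close> need no decay at all, the crude lattice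
  sum suffices; all others are covered by \<open>far_part\<close>.\<close>

lemma near_bound:
  fixes H :: real
  obtains C where "C > 0"
    "\<And>n x0 x. node n x0 \<in> Nd n \<Longrightarrow> b n \<le> J n / 2 \<Longrightarrow> \<bar>x - x0\<bar> \<le> 2 powr (- b n) / 2 \<Longrightarrow>
      \<bar>layer i n x\<bar> \<le> C * (2 ^ J n) ^ i * (2 powr (- (E n x0 * J n)) + 2 powr (- (H * J n)))"
proof -
  obtain C where C: "C > 0"
    "\<And>n x0 x. node n x0 \<in> Nd n \<Longrightarrow> b n \<le> J n / 2 \<Longrightarrow> \<bar>x - x0\<bar> \<le> 2 powr (- b n) / 2 \<Longrightarrow>
      \<bar>\<Sum>k\<in>{k \<in> Nd n. ex n k \<noteq> E n x0}. wterm i n x k\<bar> \<le> C * (2 ^ J n) ^ i * 2 powr (- (H * J n))"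
    using far_part[of i H] by blast
  obtain D where D: "D > 0"
    "\<And>n x A R e. A \<subseteq> Nd n \<Longrightarrow> 1 \<le> R \<Longrightarrow> (\<And>k. k \<in> A \<Longrightarrow> R \<le> 1 + \<bar>2 ^ J n * x - real_of_int k\<bar>) \<Longrightarrow>
       (\<And>k. k \<in> A \<Longrightarrow> e \<le> ex n k) \<Longrightarrow>
       \<bar>\<Sum>k\<in>A. wterm i n x k\<bar> \<le> D * (2 ^ J n) ^ i * 2 powr (- (e * J n)) / R ^ 0"
    using part_bound[of i 0] by blast
  have "\<bar>layer i n x\<bar> \<le> (C + D) * (2 ^ J n) ^ i * (2 powr (- (E n x0 * J n)) + 2 powr (- (H * J n)))"
    if n: "node n x0 \<in> Nd n" "b n \<le> J n / 2" "\<bar>x - x0\<bar> \<le> 2 powr (- b n) / 2" for n x0 x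
  proof -
    let ?A = "{k \<in> Nd n. ex n k = E n x0}"
    have "layer i n x = (\<Sum>k\<in>?A. wterm i n x k) + (\<Sum>k\<in>{k \<in> Nd n. ex n k \<noteq> E n x0}. wterm i n x k)"
      unfolding layer_def
      by (subst sum.union_disjoint[symmetric]) (auto simp: finite_Nd intro!: sum.cong)
    moreover have "\<bar>\<Sum>k\<in>?A. wterm i n x k\<bar> \<le> D * (2 ^ J n) ^ i * 2 powr (- (E n x0 * J n))"
      using D(2)[of ?A n 1 x "E n x0"] by auto
    moreover have "\<bar>\<Sum>k\<in>{k \<in> Nd n. ex n k \<noteq> E n x0}. wterm i n x k\<bar>
        \<le> C * (2 ^ J n) ^ i * 2 powr (- (H * J n))" by (rule C(2)[OF n])
    moreover have "0 \<le> C * (2 ^ J n) ^ i * 2 powr (- (E n x0 * J n))"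
      "0 \<le> D * (2 ^ J n) ^ i * 2 powr (- (H * J n))" using C(1) D(1) by auto
    ultimately show ?thesis by (simp add: algebra_simps)
  qed
  then show ?thesis using that[of "C + D"] C(1) D(1) by auto
qed

text \<open>Here \<open>sep\<close> enters. Within a bounded number \<rho> of wavelengths of
  \<open>x0\<close>, every other node with the same exponent is at distance at least n / 2, so one
  power of decay already makes its contribution O(1/n) relative to the wavelet at the node of
  \<open>x0\<close>.\<close>

lemma window_bound:
  fixes H \<rho> :: real
  obtains C where "C > 0"
    "\<And>n x0 x. node n x0 \<in> Nd n \<Longrightarrow> b n \<le> J n / 2 \<Longrightarrow> \<bar>x - x0\<bar> \<le> 2 powr (- b n) / 2 \<Longrightarrow>
      \<bar>2 ^ J n * x - 2 ^ J n * x0\<bar> \<le> \<rho> \<Longrightarrow> 2 * (\<rho> + 1) \<le> n \<Longrightarrow>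
      \<bar>layer 0 n x - 2 powr (- (E n x0 * J n)) * \<psi> (2 ^ J n * x - real_of_int (node n x0))\<bar>
        \<le> C * (2 powr (- (E n x0 * J n)) / n + 2 powr (- (H * J n)))"
proof -
  obtain C where C: "C > 0"
    "\<And>n x0 x. node n x0 \<in> Nd n \<Longrightarrow> b n \<le> J n / 2 \<Longrightarrow> \<bar>x - x0\<bar> \<le> 2 powr (- b n) / 2 \<Longrightarrow>
      \<bar>\<Sum>k\<in>{k \<in> Nd n. ex n k \<noteq> E n x0}. wterm 0 n x k\<bar> \<le> C * (2 ^ J n) ^ 0 * 2 powr (- (H * J n))"
    using far_part[of 0 H] by blast
  obtain D where D: "D > 0"
    "\<And>n x A R e. A \<subseteq> Nd n \<Longrightarrow> 1 \<le> R \<Longrightarrow> (\<And>k. k \<in> A \<Longrightarrow> R \<le> 1 + \<bar>2 ^ J n * x - real_of_int k\<bar>) \<Longrightarrow>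
       (\<And>k. k \<in> A \<Longrightarrow> e \<le> ex n k) \<Longrightarrow>
       \<bar>\<Sum>k\<in>A. wterm 0 n x k\<bar> \<le> D * (2 ^ J n) ^ 0 * 2 powr (- (e * J n)) / R ^ 1"
    using part_bound[of 0 1] by blast
  have "\<bar>layer 0 n x - 2 powr (- (E n x0 * J n)) * \<psi> (2 ^ J n * x - real_of_int (node n x0))\<bar>
        \<le> (C + 2 * D) * (2 powr (- (E n x0 * J n)) / n + 2 powr (- (H * J n)))"
    if n: "node n x0 \<in> Nd n" "b n \<le> J n / 2" "\<bar>x - x0\<bar> \<le> 2 powr (- b n) / 2"
      and \<rho>: "\<bar>2 ^ J n * x - 2 ^ J n * x0\<bar> \<le> \<rho>" "2 * (\<rho> + 1) \<le> n" for n x0 x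
  proof -
    let ?A = "{k \<in> Nd n. ex n k = E n x0} - {node n x0}"
    let ?B = "{k \<in> Nd n. ex n k \<noteq> E n x0}"
    have "0 \<le> \<rho>" using \<rho>(1) by linarith
    have "layer 0 n x = (\<Sum>k\<in>insert (node n x0) (?A \<union> ?B). wterm 0 n x k)"
      unfolding layer_def using n(1) by (intro sum.cong) (auto simp: E_def)
    also have "\<dots> = wterm 0 n x (node n x0) + (\<Sum>k\<in>?A \<union> ?B. wterm 0 n x k)"
      by (subst sum.insert) (auto simp: finite_Nd E_def)
    also have "(\<Sum>k\<in>?A \<union> ?B. wterm 0 n x k) = (\<Sum>k\<in>?A. wterm 0 n x k) + (\<Sum>k\<in>?B. wterm 0 n x k)"
      by (subst sum.union_disjoint) (auto simp: finite_Nd)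
    finally have "layer 0 n x - wterm 0 n x (node n x0) = (\<Sum>k\<in>?A. wterm 0 n x k) + (\<Sum>k\<in>?B. wterm 0 n x k)"
      by simp
    moreover have "wterm 0 n x (node n x0) = 2 powr (- (E n x0 * J n)) * \<psi> (2 ^ J n * x - real_of_int (node n x0))"
      by (simp add: wterm_def E_def)
    moreover have "\<bar>\<Sum>k\<in>?A. wterm 0 n x k\<bar> \<le> D * (2 ^ J n) ^ 0 * 2 powr (- (E n x0 * J n)) / (real n / 2) ^ 1"
    proof (rule D(2))
      show "1 \<le> real n / 2" using \<rho>(2) \<open>0 \<le> \<rho>\<close> by (simp add: field_simps)
      fix k assume "k \<in> ?A"
      then have "real n \<le> \<bar>real_of_int k - real_of_int (node n x0)\<bar>"
        by (intro sep n) auto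
      then show "real n / 2 \<le> 1 + \<bar>2 ^ J n * x - real_of_int k\<bar>"
        using dist_node[of n x0] \<rho> by (smt (verit) field_sum_of_halves)
    qed auto
    moreover have "\<bar>\<Sum>k\<in>?B. wterm 0 n x k\<bar> \<le> C * 2 powr (- (H * J n))"
      using C(2)[OF n] by simp
    ultimately have "\<bar>layer 0 n x - 2 powr (- (E n x0 * J n)) * \<psi> (2 ^ J n * x - real_of_int (node n x0))\<bar>
        \<le> D * 2 powr (- (E n x0 * J n)) / (real n / 2) + C * 2 powr (- (H * J n))" by simp
    also have "\<dots> = 2 * D * (2 powr (- (E n x0 * J n)) / n) + C * 2 powr (- (H * J n))" by simp
    also have "\<dots> \<le> (C + 2 * D) * (2 powr (- (E n x0 * J n)) / n) + (C + 2 * D) * 2 powr (- (H * J n))"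
      using C(1) D(1) by (intro add_mono mult_right_mono) auto
    finally show ?thesis by (simp add: ring_distribs)
  qed
  then show ?thesis using that[of "C + 2 * D"] C(1) D(1) by auto
qed

lemma layer_taylor:
  assumes "N > 0" "\<And>y. \<bar>y - x0\<bar> \<le> \<bar>x - x0\<bar> \<Longrightarrow> \<bar>layer N n y\<bar> \<le> B"
  shows "\<bar>layer 0 n x - (\<Sum>i<N. layer i n x0 / fact i * (x - x0) ^ i)\<bar> \<le> B * \<bar>x - x0\<bar> ^ N"
proof (cases "x = x0")
  case True
  have "(\<Sum>i<N. layer i n x0 / fact i * (x - x0) ^ i) = layer 0 n x"
    using True assms(1) by (cases N) (simp_all add: sum.lessThan_Suc_shift del: sum.lessThan_Suc)
  then show ?thesis using True assms by simp
next
  case False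
  have "\<exists>t. (if x < x0 then x < t \<and> t < x0 else x0 < t \<and> t < x) \<and>
     layer 0 n x = (\<Sum>i<N. (layer i n x0 / fact i) * (x - x0) ^ i) + (layer N n t / fact N) * (x - x0) ^ N"
    using False assms(1) layer_deriv
    by (intro Taylor[where diff = "\<lambda>i. layer i n" and a = "min x x0" and b = "max x x0"]) auto
  then obtain t where t: "if x < x0 then x < t \<and> t < x0 else x0 < t \<and> t < x"
    "layer 0 n x = (\<Sum>i<N. (layer i n x0 / fact i) * (x - x0) ^ i) + (layer N n t / fact N) * (x - x0) ^ N"
    by blast
  have B: "\<bar>layer N n t\<bar> \<le> B" using t(1) by (intro assms(2)) (auto split: if_splits)
  have "\<bar>layer N n t / fact N\<bar> \<le> \<bar>layer N n t\<bar>"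
    using fact_ge_1[of N, where 'a=real] by (simp add: abs_divide divide_le_eq mult_le_cancel_left1)
  then have "\<bar>(layer N n t / fact N) * (x - x0) ^ N\<bar> \<le> B * \<bar>x - x0\<bar> ^ N"
    unfolding abs_mult power_abs using B by (intro mult_right_mono) auto
  then show ?thesis using t(2) by simp
qed

section \<open>Pointwise exponents along a branch\<close>

lemma eventually_b_le:
  fixes \<epsilon> c :: real
  assumes "\<epsilon> > 0"
  shows "eventually (\<lambda>n. b n + c \<le> \<epsilon> * J n) sequentially"
proof -
  have "eventually (\<lambda>n. b n \<le> \<epsilon> / 2 * J n) sequentially" using assms by (intro b_small) auto
  moreover have "eventually (\<lambda>n. c \<le> \<epsilon> / 2 * real n) sequentially" using assms by real_asymp
  ultimately show ?thesis
  proof eventually_elim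
    case (elim n)
    have "\<epsilon> / 2 * real n \<le> \<epsilon> / 2 * J n" using J_ge[of n] assms by (intro mult_left_mono) auto
    then have "b n + c \<le> \<epsilon> / 2 * J n + \<epsilon> / 2 * J n" using elim by linarith
    then show ?case by simp
  qed
qed

text \<open>One constant serves all orders up to \<open>N\<close>. Choosing the free parameter of
  \<open>near_bound\<close> equal to the lower bound \<open>H\<close> of the exponent merges its two
  terms, whence the factor 2.\<close>

lemma near_bound_upto:
  fixes H :: real
  obtains M where "M > 0"
    "\<And>i n x0 x. i \<le> N \<Longrightarrow> node n x0 \<in> Nd n \<Longrightarrow> H \<le> E n x0 \<Longrightarrow> b n \<le> J n / 2 \<Longrightarrow>
      \<bar>x - x0\<bar> \<le> 2 powr (- b n) / 2 \<Longrightarrow> \<bar>layer i n x\<bar> \<le> M * (2 ^ J n) ^ i * 2 powr (- (H * J n))"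
proof -
  have "\<exists>C. C > 0 \<and> (\<forall>n x0 x. node n x0 \<in> Nd n \<longrightarrow> b n \<le> J n / 2 \<longrightarrow> \<bar>x - x0\<bar> \<le> 2 powr (- b n) / 2 \<longrightarrow>
      \<bar>layer i n x\<bar> \<le> C * (2 ^ J n) ^ i * (2 powr (- (E n x0 * J n)) + 2 powr (- (H * J n))))" for i
    using near_bound[of i H] by metis
  then obtain C where C: "\<And>i. C i > 0"
    "\<And>i n x0 x. node n x0 \<in> Nd n \<Longrightarrow> b n \<le> J n / 2 \<Longrightarrow> \<bar>x - x0\<bar> \<le> 2 powr (- b n) / 2 \<Longrightarrow>
      \<bar>layer i n x\<bar> \<le> C i * (2 ^ J n) ^ i * (2 powr (- (E n x0 * J n)) + 2 powr (- (H * J n)))"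
    by metis
  define M where "M = 2 * (\<Sum>i\<le>N. C i)"
  have "M > 0" unfolding M_def using C(1) by (auto intro!: sum_pos)
  moreover have "\<bar>layer i n x\<bar> \<le> M * (2 ^ J n) ^ i * 2 powr (- (H * J n))"
    if "i \<le> N" and n: "node n x0 \<in> Nd n" "H \<le> E n x0" "b n \<le> J n / 2" "\<bar>x - x0\<bar> \<le> 2 powr (- b n) / 2"
    for i n x0 x
  proof -
    have "C i \<le> (\<Sum>i\<le>N. C i)" using that(1) C(1) by (intro member_le_sum) (auto intro: less_imp_le)
    moreover have "2 powr (- (E n x0 * J n)) \<le> 2 powr (- (H * J n))"
      using n(2) by (auto intro: mult_right_mono)
    ultimately have "C i * (2 ^ J n) ^ i * (2 powr (- (E n x0 * J n)) + 2 powr (- (H * J n)))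
        \<le> (\<Sum>i\<le>N. C i) * (2 ^ J n) ^ i * (2 * 2 powr (- (H * J n)))"
      using C(1)[of i] by (intro mult_mono) auto
    also have "\<dots> = M * (2 ^ J n) ^ i * 2 powr (- (H * J n))" by (simp add: M_def)
    finally show ?thesis by (rule order_trans[OF C(2)[OF n(1,3,4), of i]])
  qed
  ultimately show ?thesis using that by blast
qed

text \<open>Every layer is compared with its own Taylor polynomial at \<open>x0\<close>, and the sum
  of these is the approximating polynomial. With r = |x - x0| there are three regimes. For r \<le>
  2^(-J n) the Taylor remainder is used. For larger r up to 2^(-b n) / 2 the layer and its Taylor
  polynomial are bounded separately by the local decay 2^(-H J n). Beyond that only 2^(-\<eta> J n)
  is available for the layer, but r^h \<ge> 2^(-h (b n + 1)) costs at most half of it, which is the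
  last condition in \<open>good\<close>. Each regime leaves a summable factor in front of
  r^h.\<close>

lemma exp_lower:
  assumes "x0 \<in> K" "0 \<le> h" "0 < \<delta>" "eventually (\<lambda>n. h + \<delta> \<le> E n x0) sequentially"
  shows "\<exists>P :: real poly. (\<lambda>x. F x - poly P (x - x0)) \<in> O[at x0](\<lambda>x. \<bar>x - x0\<bar> powr h)"
proof -
  have nd: "node n x0 \<in> Nd n" for n using assms(1) by (auto simp: K_def)
  \<comment> \<open>The least integer above h: the remainder has order N \<ge> h, which is right
    below the scale 2^(-J n), while all retained degrees are at most h. The latter gives the bound
    above that scale and the convergence of the series of derivatives.\<close>
  define N where "N = Suc (nat \<lfloor>h\<rfloor>)"
  define H where "H = h + \<delta>"
  have N: "N > 0" "h \<le> real N" "\<And>i. i < N \<Longrightarrow> real i \<le> h"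
    unfolding N_def using assms(2) by (auto simp: less_Suc_eq_le le_nat_iff le_floor_iff) linarith
  obtain M where M: "M > 0"
    "\<And>i n x0 x. i \<le> N \<Longrightarrow> node n x0 \<in> Nd n \<Longrightarrow> H \<le> E n x0 \<Longrightarrow> b n \<le> J n / 2 \<Longrightarrow>
      \<bar>x - x0\<bar> \<le> 2 powr (- b n) / 2 \<Longrightarrow> \<bar>layer i n x\<bar> \<le> M * (2 ^ J n) ^ i * 2 powr (- (H * J n))"
    using near_bound_upto[of N H] by blast
  obtain C0 where C0: "C0 > 0" "\<And>n x. \<bar>layer 0 n x\<bar> \<le> C0 * 2 powr (- (\<eta> * J n))"
    using layer0_bound by blast
  obtain CN where CN: "CN > 0" "\<And>n x. \<bar>layer N n x\<bar> \<le> CN * (2 ^ J n) ^ N * 2 powr (- (\<eta> * J n))"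
    using layer_bound by blast
  define T where "T n x = (\<Sum>i<N. layer i n x0 / fact i * (x - x0) ^ i)" for n x
  define good where "good n \<longleftrightarrow> H \<le> E n x0 \<and> b n \<le> J n / 2 \<and> b n + 1 \<le> J n \<and> h * (b n + 1) \<le> \<eta> / 2 * J n" for n
  have ev_good: "eventually good sequentially"
  proof -
    have "eventually (\<lambda>n. b n + 1 \<le> (\<eta> / (2 * (h + 1))) * J n) sequentially"
      using eta_pos assms(2) by (intro eventually_b_le) auto
    moreover have "eventually (\<lambda>n. b n + 1 \<le> (1 / 2) * J n) sequentially"
      by (intro eventually_b_le) auto
    moreover note assms(4)
    ultimately show ?thesis
    proof eventually_elim
      case (elim n)
      have "h * (b n + 1) \<le> (h + 1) * (b n + 1)" using b_nonneg[of n] by (intro mult_right_mono) auto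
      also have "\<dots> \<le> (h + 1) * ((\<eta> / (2 * (h + 1))) * J n)"
        using elim assms(2) by (intro mult_left_mono) auto
      also have "\<dots> = \<eta> / 2 * J n" using assms(2) by (simp add: field_simps)
      finally have "h * (b n + 1) \<le> \<eta> / 2 * J n" .
      moreover have "b n \<le> J n / 2" "b n + 1 \<le> J n" using elim(2) by auto
      ultimately show ?case using elim(3) unfolding good_def H_def by blast
    qed
  qed
  \<comment> \<open>For the finitely many levels that are not \<open>good\<close>, smoothness of the
    single layer suffices, with a constant depending on \<open>n\<close>.\<close>
  have step1: "\<exists>A. \<forall>x. x \<noteq> x0 \<and> \<bar>x - x0\<bar> \<le> 1 \<longrightarrow> \<bar>layer 0 n x - T n x\<bar> \<le> A * \<bar>x - x0\<bar> powr h" for n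
  proof (intro exI allI impI)
    fix x assume x: "x \<noteq> x0 \<and> \<bar>x - x0\<bar> \<le> 1"
    have "\<bar>layer 0 n x - T n x\<bar> \<le> (CN * (2 ^ J n) ^ N * 2 powr (- (\<eta> * J n))) * \<bar>x - x0\<bar> ^ N"
      unfolding T_def by (rule layer_taylor[OF N(1) CN(2)])
    also have "\<bar>x - x0\<bar> ^ N \<le> \<bar>x - x0\<bar> powr h"
      using powr_mono'[OF N(2), of "\<bar>x - x0\<bar>"] x by (simp add: powr_realpow)
    finally show "\<bar>layer 0 n x - T n x\<bar> \<le> (CN * (2 ^ J n) ^ N * 2 powr (- (\<eta> * J n))) * \<bar>x - x0\<bar> powr h"
      using CN(1) by (simp add: mult_left_mono)
  qed
  \<comment> \<open>The gain is \<delta> in the two near regimes and what remains of \<eta>, at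
    least \<eta> / 2, in the far one.\<close>
  define \<delta>' where "\<delta>' = min \<delta> (\<eta> / 2)"
  have \<delta>': "0 < \<delta>'" "\<delta>' \<le> \<delta>" "\<delta>' \<le> \<eta> / 2" using eta_pos assms(3) by (auto simp: \<delta>'_def)
  define A0 where "A0 = (N + 1) * M + C0"
  have A0: "A0 \<ge> M" "A0 \<ge> 0"
    using M(1) C0(1) by (auto simp: A0_def algebra_simps intro!: add_nonneg_nonneg)
  have near0: "\<bar>layer i n x\<bar> \<le> M * (2 ^ J n) ^ i * 2 powr (- (H * J n))"
    if "good n" "\<bar>x - x0\<bar> \<le> 2 powr (- b n) / 2" "i \<le> N" for n x i
    using M(2)[OF that(3) nd _ _ that(2)] that(1) unfolding good_def by blast
  have step2: "\<bar>layer 0 n x - T n x\<bar> \<le> A0 * 2 powr (- (\<delta>' * J n)) * \<bar>x - x0\<bar> powr h"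
    if g: "good n" and x: "x \<noteq> x0" for n x
  proof -
    define r where "r = \<bar>x - x0\<bar>"
    define s :: real where "s = 2 ^ J n"
    have r: "r > 0" using x by (simp add: r_def)
    have s: "s > 0" by (simp add: s_def)
    define Z where "Z = 2 powr (- (H * J n)) * (s * r) powr h"
    have Z: "Z \<ge> 0" by (simp add: Z_def)
    have Zeq: "Z = 2 powr (- (\<delta> * J n)) * r powr h"
      using r by (simp add: Z_def s_def powr_mult powr_J[symmetric] powr_powr powr_add[symmetric] H_def algebra_simps)
    have Zle: "Z \<le> 2 powr (- (\<delta>' * J n)) * r powr h"
      unfolding Zeq using \<delta>'(2) by (intro mult_right_mono) (auto intro: mult_right_mono)
    have "\<bar>layer 0 n x - T n x\<bar> \<le> A0 * (2 powr (- (\<delta>' * J n)) * r powr h)"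
    proof (cases "s * r \<le> 1")
      case True
      have "1 / s \<le> 2 powr (- b n) / 2"
      proof -
        have "2 powr (b n + 1) \<le> 2 powr (J n)" using g unfolding good_def by simp
        then have "2 powr (b n) * 2 \<le> s" by (simp add: powr_add powr_J s_def)
        then show ?thesis using s by (simp add: powr_minus field_simps)
      qed
      moreover have "r \<le> 1 / s" using True s by (simp add: field_simps)
      ultimately have rb: "r \<le> 2 powr (- b n) / 2" by linarith
      have "\<bar>layer 0 n x - T n x\<bar> \<le> (M * s ^ N * 2 powr (- (H * J n))) * r ^ N"
        unfolding T_def r_def s_def
        by (intro layer_taylor N near0[OF g]) (use rb r_def in auto)
      also have "\<dots> = M * (2 powr (- (H * J n)) * (s * r) ^ N)" by (simp add: power_mult_distrib)
      also have "\<dots> \<le> M * Z"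
        unfolding Z_def using powr_mono'[OF N(2), of "s * r"] True M(1) r s
        by (intro mult_left_mono) (auto simp: powr_realpow)
      also have "\<dots> \<le> A0 * (2 powr (- (\<delta>' * J n)) * r powr h)"
        using A0 Z by (intro mult_mono Zle) auto
      finally show ?thesis .
    next
      case False
      have pw: "(s * r) ^ i \<le> (s * r) powr h" if "i < N" for i
      proof -
        have "(s * r) powr real i \<le> (s * r) powr h" using False N(3)[OF that] by (intro powr_mono) auto
        then show ?thesis using r s by (simp add: powr_realpow)
      qed
      have "\<bar>T n x\<bar> \<le> (\<Sum>i<N. M * Z)"
        unfolding T_def
      proof (rule order_trans[OF sum_abs], rule sum_mono)
        fix i assume "i \<in> {..<N}"
        then have i: "i < N" by simp
        have "\<bar>layer i n x0 / fact i * (x - x0) ^ i\<bar> \<le> \<bar>layer i n x0\<bar> * r ^ i"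
          using frac_le[of "\<bar>layer i n x0\<bar> * r ^ i" "\<bar>layer i n x0\<bar> * r ^ i" 1 "fact i"] r
          by (simp add: abs_mult power_abs r_def)
        also have "\<dots> \<le> (M * s ^ i * 2 powr (- (H * J n))) * r ^ i"
          using near0[OF g, of x0 i] i r by (intro mult_right_mono) (auto simp: s_def)
        also have "\<dots> = M * (2 powr (- (H * J n)) * (s * r) ^ i)" by (simp add: power_mult_distrib)
        also have "\<dots> \<le> M * Z" unfolding Z_def using M(1) pw[OF i] by (intro mult_left_mono) auto
        finally show "\<bar>layer i n x0 / fact i * (x - x0) ^ i\<bar> \<le> M * Z" .
      qed
      then have Tle: "\<bar>T n x\<bar> \<le> (N * M) * (2 powr (- (\<delta>' * J n)) * r powr h)"
        using mult_left_mono[OF Zle, of "N * M"] M(1) by simp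
      have "\<bar>layer 0 n x\<bar> \<le> (M + C0) * (2 powr (- (\<delta>' * J n)) * r powr h)"
      proof (cases "r \<le> 2 powr (- b n) / 2")
        case True
        have "\<bar>layer 0 n x\<bar> \<le> M * (2 powr (- (H * J n)) * (s * r) ^ 0)"
          using near0[OF g, of x 0] True by (simp add: r_def)
        also have "\<dots> \<le> M * Z" unfolding Z_def using M(1) pw[OF N(1)] by (intro mult_left_mono) auto
        also have "\<dots> \<le> (M + C0) * (2 powr (- (\<delta>' * J n)) * r powr h)"
          using M(1) C0(1) Z by (intro mult_mono Zle) auto
        finally show ?thesis .
      next
        case False
        have "2 powr (- (\<eta> * J n)) \<le> 2 powr (- (\<delta>' * J n)) * r powr h"
        proof -
          have "\<delta>' * J n \<le> \<eta> / 2 * J n" using \<delta>'(3) by (intro mult_right_mono) auto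
          moreover have "h * (b n + 1) \<le> \<eta> / 2 * J n" using g unfolding good_def by blast
          ultimately have "- (\<eta> * J n) \<le> - (\<delta>' * J n) + (- (b n + 1) * h)" by (simp add: algebra_simps)
          then have "2 powr (- (\<eta> * J n)) \<le> 2 powr (- (\<delta>' * J n) + (- (b n + 1) * h))" by simp
          also have "\<dots> = 2 powr (- (\<delta>' * J n)) * (2 powr (- (b n + 1))) powr h"
            by (simp only: powr_add powr_powr)
          also have "\<dots> \<le> 2 powr (- (\<delta>' * J n)) * r powr h"
          proof (intro mult_left_mono powr_mono2 assms)
            show "2 powr - (b n + 1) \<le> r" using False by (simp add: powr_diff)
          qed auto
          finally show ?thesis .
        qed
        then have "\<bar>layer 0 n x\<bar> \<le> C0 * (2 powr (- (\<delta>' * J n)) * r powr h)"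
          using C0 by (meson mult_left_mono order_trans less_imp_le)
        also have "\<dots> \<le> (M + C0) * (2 powr (- (\<delta>' * J n)) * r powr h)"
          using M(1) by (intro mult_right_mono) auto
        finally show ?thesis .
      qed
      then show ?thesis using Tle by (simp add: A0_def algebra_simps)
    qed
    then show ?thesis by (simp add: r_def mult_ac)
  qed
  from step1 obtain A where A: "\<And>n x. x \<noteq> x0 \<Longrightarrow> \<bar>x - x0\<bar> \<le> 1 \<Longrightarrow>
    \<bar>layer 0 n x - T n x\<bar> \<le> A n * \<bar>x - x0\<bar> powr h" by metis
  define B where "B n = (if good n then A0 * 2 powr (- (\<delta>' * J n)) else A n)" for n
  have Bsum: "summable B"
  proof -
    have "eventually (\<lambda>n. B n = A0 * 2 powr (- (\<delta>' * J n))) sequentially"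
      using ev_good by eventually_elim (simp add: B_def)
    then have "summable B \<longleftrightarrow> summable (\<lambda>n. A0 * 2 powr (- (\<delta>' * J n)))" by (rule summable_cong)
    then show ?thesis using summable_mult[OF summable_powr_neg_J[OF \<delta>'(1)]] by simp
  qed
  have le: "\<bar>layer 0 n x - T n x\<bar> \<le> B n * \<bar>x - x0\<bar> powr h" if "x \<noteq> x0" "\<bar>x - x0\<bar> \<le> 1" for n x
    using A[OF that, of n] step2[OF _ that(1), of n] by (simp add: B_def)
  have csum: "summable (\<lambda>n. layer i n x0 / fact i * y)" if "i < N" for i y
  proof -
    have "summable (\<lambda>n. layer i n x0)"
    proof (rule summable_comparison_test_ev)
      show "eventually (\<lambda>n. norm (layer i n x0) \<le> M * 2 powr (- (\<delta> * J n))) sequentially"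
        using ev_good
      proof eventually_elim
        case (elim n)
        have "norm (layer i n x0) \<le> M * ((2 ^ J n) ^ i * 2 powr (- (H * J n)))"
          using near0[OF elim, of x0 i] that by simp
        also have "(2 ^ J n) ^ i * 2 powr (- (H * J n)) = 2 powr (J n * i - H * J n)"
          by (simp add: powr_J[symmetric] powr_realpow[symmetric] powr_powr powr_add[symmetric])
        also have "M * 2 powr (J n * i - H * J n) \<le> M * 2 powr (- (\<delta> * J n))"
        proof (intro mult_left_mono)
          have "J n * real i \<le> J n * h" using N(3)[OF that] by (intro mult_left_mono) auto
          then show "2 powr (J n * i - H * J n) \<le> 2 powr (- (\<delta> * J n))"
            by (simp add: H_def algebra_simps)
        qed (use M in auto)
        finally show ?case .
      qed
      show "summable (\<lambda>n. M * 2 powr (- (\<delta> * J n)))"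
        using assms(3) by (intro summable_mult summable_powr_neg_J) auto
    qed
    then show ?thesis using summable_divide summable_mult2 by blast
  qed
  define P :: "real poly" where "P = (\<Sum>i<N. monom (\<Sum>n. layer i n x0 / fact i) i)"
  have polyP: "poly P (x - x0) = (\<Sum>n. T n x)" and Tsum: "summable (\<lambda>n. T n x)" for x
  proof -
    have "poly P (x - x0) = (\<Sum>i<N. (\<Sum>n. layer i n x0 / fact i) * (x - x0) ^ i)"
      by (simp add: P_def poly_sum poly_monom)
    also have "\<dots> = (\<Sum>i<N. (\<Sum>n. layer i n x0 / fact i * (x - x0) ^ i))"
      using csum[where y = 1] by (intro sum.cong refl suminf_mult2) auto
    also have "\<dots> = (\<Sum>n. T n x)"
      unfolding T_def using csum by (intro suminf_sum[symmetric]) auto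
    finally show "poly P (x - x0) = (\<Sum>n. T n x)" .
    show "summable (\<lambda>n. T n x)" unfolding T_def using csum by (intro summable_sum) auto
  qed
  have "\<bar>F x - poly P (x - x0)\<bar> \<le> suminf B * \<bar>x - x0\<bar> powr h" if x: "x \<noteq> x0" "\<bar>x - x0\<bar> \<le> 1" for x
  proof -
    have s: "summable (\<lambda>n. B n * \<bar>x - x0\<bar> powr h)" by (intro summable_mult2 Bsum)
    have s': "summable (\<lambda>n. \<bar>layer 0 n x - T n x\<bar>)"
      by (rule summable_comparison_test'[OF s, of 0]) (use le[OF x] in auto)
    have "F x - poly P (x - x0) = (\<Sum>n. layer 0 n x - T n x)"
      unfolding F_def polyP by (rule suminf_diff[OF summable_layer Tsum])
    also have "\<bar>\<dots>\<bar> \<le> (\<Sum>n. B n * \<bar>x - x0\<bar> powr h)"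
      by (rule order_trans[OF summable_rabs[OF s']]) (intro suminf_le le x s s')
    also have "\<dots> = suminf B * \<bar>x - x0\<bar> powr h" by (rule suminf_mult2[symmetric, OF Bsum])
    finally show ?thesis .
  qed
  then have "(\<lambda>x. F x - poly P (x - x0)) \<in> O[at x0](\<lambda>x. \<bar>x - x0\<bar> powr h)"
    by (intro bigoI[where c = "suminf B"]) (auto simp: eventually_at dist_real_def intro!: exI[of _ 1])
  then show ?thesis by blast
qed

text \<open>At distance \<rho> 2^(-J n) the Taylor remainder of order N of layer m is of size (2^(J
  m - J n))^N, and J m \<le> J n / 2 with N \<ge> 2 H turns this into 2^(-H J n). Using \<rho> + 1
  in the constant keeps it positive when \<rho> = 0.\<close>

lemma coarse_layer_remainder:
  fixes H \<rho> :: real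
  assumes "N > 0" "2 * H \<le> N" "0 \<le> H" "0 \<le> \<rho>"
  obtains C where "C > 0"
    "\<And>n m x x0. 2 * J m \<le> J n \<Longrightarrow> \<bar>2 ^ J n * x - 2 ^ J n * x0\<bar> \<le> \<rho> \<Longrightarrow>
      \<bar>layer 0 m x - (\<Sum>i<N. layer i m x0 / fact i * (x - x0) ^ i)\<bar> \<le> C * 2 powr (- (H * J n))"
proof -
  obtain CN where CN: "CN > 0" "\<And>n x. \<bar>layer N n x\<bar> \<le> CN * (2 ^ J n) ^ N * 2 powr (- (\<eta> * J n))"
    using layer_bound by blast
  have CN': "\<bar>layer N n x\<bar> \<le> CN * (2 ^ J n) ^ N" for n x
  proof -
    have "2 powr (- (\<eta> * J n)) \<le> 1" using eta_pos powr_mono[of "- (\<eta> * J n)" 0 2] by simp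
    then have "CN * (2 ^ J n) ^ N * 2 powr (- (\<eta> * J n)) \<le> CN * (2 ^ J n) ^ N * 1"
      using CN(1) by (intro mult_left_mono) auto
    then show ?thesis using CN(2)[of n x] by simp
  qed
  have "\<bar>layer 0 m x - (\<Sum>i<N. layer i m x0 / fact i * (x - x0) ^ i)\<bar>
      \<le> (CN * (\<rho> + 1) ^ N) * 2 powr (- (H * J n))"
    if m: "2 * J m \<le> J n" and x: "\<bar>2 ^ J n * x - 2 ^ J n * x0\<bar> \<le> \<rho>" for n m x x0
  proof -
    have "2 ^ J n * \<bar>x - x0\<bar> \<le> \<rho>" using x by (simp add: abs_mult right_diff_distrib[symmetric])
    then have r: "\<bar>x - x0\<bar> \<le> \<rho> / 2 ^ J n" by (simp add: field_simps)
    have "\<bar>layer 0 m x - (\<Sum>i<N. layer i m x0 / fact i * (x - x0) ^ i)\<bar> \<le> (CN * (2 ^ J m) ^ N) * \<bar>x - x0\<bar> ^ N"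
      by (rule layer_taylor[OF assms(1) CN'])
    also have "\<dots> \<le> (CN * (2 ^ J m) ^ N) * (\<rho> / 2 ^ J n) ^ N"
      using CN(1) r by (intro mult_left_mono power_mono) auto
    also have "\<dots> = (CN * \<rho> ^ N) * (2 ^ J m / 2 ^ J n) ^ N" by (simp add: power_divide)
    also have "\<dots> \<le> (CN * (\<rho> + 1) ^ N) * 2 powr (- (H * J n))"
    proof (intro mult_mono)
      have "(2 ^ J m / 2 ^ J n :: real) ^ N = 2 powr ((real (J m) - J n) * N)"
        by (simp add: powr_J[symmetric] powr_realpow[symmetric] powr_powr powr_diff[symmetric])
      also have "\<dots> \<le> 2 powr (- (H * J n))"
      proof -
        have "real (2 * J m) \<le> real (J n)" using m by (simp only: of_nat_le_iff)
        then have "real (J m) - J n \<le> - (J n / 2)" by simp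
        then have "(real (J m) - J n) * N \<le> - (J n / 2) * N" by (intro mult_right_mono) auto
        moreover have "(2 * H) * J n \<le> real N * real (J n)" using assms(2) by (intro mult_right_mono) auto
        ultimately show ?thesis by (simp add: algebra_simps)
      qed
      finally show "(2 ^ J m / 2 ^ J n :: real) ^ N \<le> 2 powr (- (H * J n))" .
    qed (use CN(1) assms in \<open>auto intro!: power_mono\<close>)
    finally show ?thesis .
  qed
  then show ?thesis using that[of "CN * (\<rho> + 1) ^ N"] CN(1) assms by auto
qed

text \<open>Strict monotonicity of the integer sequence \<open>J\<close> yields J (m + n + 1) \<ge>
  J (n + 1) + m, so the tail is dominated by a geometric series with ratio 2^(-\<eta>).\<close>

lemma fine_layers_sum:
  obtains C where "C > 0"
    "\<And>n x. \<bar>\<Sum>m. layer 0 (m + Suc n) x\<bar> \<le> C * 2 powr (- (\<eta> * J (Suc n)))"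
proof -
  obtain C0 where C0: "C0 > 0" "\<And>n x. \<bar>layer 0 n x\<bar> \<le> C0 * 2 powr (- (\<eta> * J n))"
    using layer0_bound by blast
  define S where "S = (\<Sum>m. (2 powr (- \<eta>)) ^ m)"
  have sg: "summable (\<lambda>m. (2 powr (- \<eta>)) ^ m)"
    using eta_pos by (intro summable_geometric) (simp add: powr_less_one)
  have "S > 0" unfolding S_def by (intro suminf_pos sg) auto
  have "\<bar>\<Sum>m. layer 0 (m + Suc n) x\<bar> \<le> (C0 * S) * 2 powr (- (\<eta> * J (Suc n)))" for n x
  proof -
    have each: "\<bar>layer 0 (m + Suc n) x\<bar> \<le> (C0 * 2 powr (- (\<eta> * J (Suc n)))) * (2 powr (- \<eta>)) ^ m" for m
    proof -
      have "J (Suc n) + m \<le> J (m + Suc n)"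
      proof (induction m)
        case (Suc m)
        then show ?case using strict_monoD[OF J, of "m + Suc n" "Suc m + Suc n"] by simp
      qed simp
      then have "real (J (Suc n)) + real m \<le> real (J (m + Suc n))" by (metis of_nat_add of_nat_le_iff)
      then have "\<eta> * (real (J (Suc n)) + real m) \<le> \<eta> * real (J (m + Suc n))"
        using eta_pos by (intro mult_left_mono) auto
      then have "2 powr (- (\<eta> * J (m + Suc n))) \<le> 2 powr (- (\<eta> * J (Suc n)) + (- \<eta>) * m)"
        by (simp add: algebra_simps)
      also have "\<dots> = 2 powr (- (\<eta> * J (Suc n))) * (2 powr (- \<eta>)) ^ m"
        by (simp only: powr_add powr_powr[symmetric]) (simp add: powr_realpow)
      finally have "C0 * 2 powr (- (\<eta> * J (m + Suc n)))
          \<le> C0 * (2 powr (- (\<eta> * J (Suc n))) * (2 powr (- \<eta>)) ^ m)"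
        using C0(1) by (intro mult_left_mono) auto
      then show ?thesis using C0(2)[of "m + Suc n" x] by simp
    qed
    have s: "summable (\<lambda>m. (C0 * 2 powr (- (\<eta> * J (Suc n)))) * (2 powr (- \<eta>)) ^ m)"
      by (intro summable_mult sg)
    have s': "summable (\<lambda>m. \<bar>layer 0 (m + Suc n) x\<bar>)"
      by (rule summable_comparison_test'[OF s, of 0]) (use each in auto)
    have "\<bar>\<Sum>m. layer 0 (m + Suc n) x\<bar> \<le> (\<Sum>m. (C0 * 2 powr (- (\<eta> * J (Suc n)))) * (2 powr (- \<eta>)) ^ m)"
      by (rule order_trans[OF summable_rabs[OF s']]) (intro suminf_le each s s')
    also have "\<dots> = (C0 * S) * 2 powr (- (\<eta> * J (Suc n)))"
      unfolding S_def by (subst suminf_mult[OF sg]) simp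
    finally show ?thesis .
  qed
  then show ?thesis using that[of "C0 * S"] C0(1) \<open>S > 0\<close> by auto
qed

text \<open>The filter \<open>at x0\<close> omits \<open>x0\<close>, but a sample point of the
  finite difference may hit it. Continuity of \<open>F\<close> forces the polynomial to take the
  value \<open>F x0\<close> there, which extends the bound to the centre.\<close>

lemma bigo_at_imp_cball_bound:
  fixes P :: "real poly"
  assumes "(\<lambda>x. F x - poly P (x - x0)) \<in> O[at x0](\<lambda>x. \<bar>x - x0\<bar> powr h)" "0 < h"
  obtains c d where "c > 0" "d > 0"
    "\<And>x. \<bar>x - x0\<bar> < d \<Longrightarrow> \<bar>F x - poly P (x - x0)\<bar> \<le> c * \<bar>x - x0\<bar> powr h"
proof -
  from landau_o.bigE[OF assms(1)] obtain c where c: "c > 0"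
    "eventually (\<lambda>x. norm (F x - poly P (x - x0)) \<le> c * norm (\<bar>x - x0\<bar> powr h)) (at x0)" by blast
  then obtain d where d: "d > 0"
    "\<And>x. x \<noteq> x0 \<Longrightarrow> \<bar>x - x0\<bar> < d \<Longrightarrow> \<bar>F x - poly P (x - x0)\<bar> \<le> c * \<bar>x - x0\<bar> powr h"
    unfolding eventually_at by (auto simp: dist_real_def)
  have "F x0 - poly P 0 = 0"
  proof -
    have "((\<lambda>x. c * \<bar>x - x0\<bar> powr h) \<longlongrightarrow> c * \<bar>x0 - x0\<bar> powr h) (at x0)"
      by (rule tendsto_intros tendsto_powr' | use assms(2) in simp)+
    then have "((\<lambda>x. c * norm (\<bar>x - x0\<bar> powr h)) \<longlongrightarrow> 0) (at x0)" by simp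
    then have "((\<lambda>x. F x - poly P (x - x0)) \<longlongrightarrow> 0) (at x0)"
      by (rule Lim_null_comparison[OF c(2)])
    moreover have "((\<lambda>x. F x - poly P (x - x0)) \<longlongrightarrow> F x0 - poly P (x0 - x0)) (at x0)"
      using F_continuous by (intro tendsto_intros) (auto simp: continuous_on_def)
    ultimately show ?thesis using LIM_unique by fastforce
  qed
  then have "\<bar>F x - poly P (x - x0)\<bar> \<le> c * \<bar>x - x0\<bar> powr h" if "\<bar>x - x0\<bar> < d" for x
    using d(2)[OF _ that] c(1) by (cases "x = x0") auto
  then show ?thesis using that c(1) d(1) by blast
qed

text \<open>At a scale where the exponent is too small, a high order finite difference of \<open>F\<close> with
  step of the order of that scale cancels the polynomial and the coarser layers, while
  the finer layers are negligible; what remains is a fixed nonzero difference of the wavelet.\<close>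
lemma exp_upper:
  fixes P :: "real poly"
  assumes x0: "x0 \<in> K" and u: "\<psi> u \<noteq> 0"
    and O: "(\<lambda>x. F x - poly P (x - x0)) \<in> O[at x0](\<lambda>x. \<bar>x - x0\<bar> powr h)"
    and h: "0 < h" "h' < h" "0 \<le> h'"
    and freq: "frequently (\<lambda>n. E n x0 \<le> h') sequentially"
  shows False
proof -
  have nd: "node n x0 \<in> Nd n" for n using x0 by (auto simp: K_def)
  \<comment> \<open>One more than h', so that errors 2^(-H J n) are smaller than the main
    coefficient 2^(-E J n) by a factor 2^(-J n) \<le> 2^(-n) whenever E \<le> h'.\<close>
  define H where "H = h' + 1"
  define N where "N = max (Suc (degree P)) (nat \<lceil>2 * H\<rceil>)"
  have N: "N > 0" "degree P < N" "2 * H \<le> N" unfolding N_def by (auto simp: max_def) linarith+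
  obtain t where t: "t > 0" "(\<Sum>i\<le>N. (-1) ^ i * real (N choose i) * \<psi> (u + t * real i)) \<noteq> 0"
    using schwartz_finite_difference_nonzero[OF schwartz u] by blast
  define \<Lambda> where "\<Lambda> = (\<Sum>i\<le>N. (-1) ^ i * real (N choose i) * \<psi> (u + t * real i))"
  \<comment> \<open>Bounds, in units of 2^(-J n), the distance from \<open>x0\<close> to every
    sample point: |u| + t N for the progression and 1 for rounding \<open>x0\<close> to its
    node.\<close>
  define \<rho> where "\<rho> = \<bar>u\<bar> + t * N + 1"
  have \<rho>: "\<rho> > 0" using t(1) by (auto simp: \<rho>_def intro!: add_nonneg_pos)
  obtain C1 where C1: "C1 > 0"
    "\<And>n m x x0. 2 * J m \<le> J n \<Longrightarrow> \<bar>2 ^ J n * x - 2 ^ J n * x0\<bar> \<le> \<rho> \<Longrightarrow>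
      \<bar>layer 0 m x - (\<Sum>i<N. layer i m x0 / fact i * (x - x0) ^ i)\<bar> \<le> C1 * 2 powr (- (H * J n))"
    using coarse_layer_remainder[OF N(1,3), of \<rho>] h \<rho> by (auto simp: H_def)
  obtain C2 where C2: "C2 > 0"
    "\<And>n x0 x. node n x0 \<in> Nd n \<Longrightarrow> b n \<le> J n / 2 \<Longrightarrow> \<bar>x - x0\<bar> \<le> 2 powr (- b n) / 2 \<Longrightarrow>
      \<bar>2 ^ J n * x - 2 ^ J n * x0\<bar> \<le> \<rho> \<Longrightarrow> 2 * (\<rho> + 1) \<le> n \<Longrightarrow>
      \<bar>layer 0 n x - 2 powr (- (E n x0 * J n)) * \<psi> (2 ^ J n * x - real_of_int (node n x0))\<bar>
        \<le> C2 * (2 powr (- (E n x0 * J n)) / n + 2 powr (- (H * J n)))"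
    using window_bound[of \<rho> H] by blast
  obtain C3 where C3: "C3 > 0"
    "\<And>n x. \<bar>\<Sum>m. layer 0 (m + Suc n) x\<bar> \<le> C3 * 2 powr (- (\<eta> * J (Suc n)))"
    using fine_layers_sum by blast
  obtain c d where cd: "c > 0" "d > 0"
    "\<And>x. \<bar>x - x0\<bar> < d \<Longrightarrow> \<bar>F x - poly P (x - x0)\<bar> \<le> c * \<bar>x - x0\<bar> powr h"
    using bigo_at_imp_cball_bound[OF O h(1)] by blast
  define good where "good n \<longleftrightarrow> b n \<le> J n / 2 \<and> \<rho> / 2 ^ J n \<le> 2 powr (- b n) / 2 \<and> 2 * (\<rho> + 1) \<le> n
    \<and> (\<forall>m<n. 2 * J m \<le> J n) \<and> H * J n \<le> \<eta> * J (Suc n) \<and> \<rho> / 2 ^ J n < d" for n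
  have ev_good: "eventually good sequentially"
  proof -
    have 1: "eventually (\<lambda>n. b n + 0 \<le> (1/2) * J n) sequentially" by (rule eventually_b_le) simp
    obtain l where l: "\<rho> < 2 ^ l" using real_arch_pow[of 2 \<rho>] by auto
    have 2: "eventually (\<lambda>n. b n + real (l + 1) \<le> 1 * real (J n)) sequentially"
      by (rule eventually_b_le) simp
    have 3: "eventually (\<lambda>n. 2 * (\<rho> + 1) \<le> real n) sequentially" by real_asymp
    have 4: "eventually (\<lambda>n. \<forall>m<n. 2 * J m \<le> J n) sequentially"
    proof -
      have "eventually (\<lambda>n. 2 * J n \<le> J (Suc n)) sequentially"
        using lacunary[of 2] by eventually_elim linarith
      then have "eventually (\<lambda>n. \<forall>m<Suc n. 2 * J m \<le> J (Suc n)) sequentially"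
      proof eventually_elim
        case (elim n)
        show ?case
        proof (intro allI impI)
          fix m assume "m < Suc n"
          then have "J m \<le> J n" using strict_mono_less_eq[OF J, of m n] by simp
          then show "2 * J m \<le> J (Suc n)" using elim by simp
        qed
      qed
      then show ?thesis by (simp add: eventually_sequentially_Suc[of "\<lambda>n. \<forall>m<n. 2 * J m \<le> J n"])
    qed
    have 5: "eventually (\<lambda>n. (H / \<eta>) * J n \<le> J (Suc n)) sequentially" by (rule lacunary)
    have 6: "eventually (\<lambda>n. \<rho> / 2 ^ n < d) sequentially" using cd(2) by real_asymp
    from 1 2 3 4 5 6 show ?thesis
    proof eventually_elim
      case (elim n)
      have "\<rho> / 2 ^ J n \<le> 2 powr (- b n) / 2"
      proof -
        have "2 powr (b n + real (l + 1)) \<le> 2 powr (J n)" using elim(2) by simp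
        then have "2 powr (b n) * (2 ^ l * 2) \<le> 2 ^ J n" by (simp add: powr_add powr_J powr_realpow)
        then have "2 ^ l / 2 ^ J n \<le> 2 powr (- b n) / 2" by (simp add: powr_minus field_simps)
        moreover have "\<rho> / 2 ^ J n \<le> 2 ^ l / 2 ^ J n" using l by (intro divide_right_mono) auto
        ultimately show ?thesis by linarith
      qed
      moreover have "H * J n \<le> \<eta> * J (Suc n)"
        using mult_left_mono[OF elim(5), of \<eta>] eta_pos by simp
      moreover have "\<rho> / 2 ^ J n < d"
      proof -
        have "(2::real) ^ n \<le> 2 ^ J n" using J_ge by (intro power_increasing) auto
        then have "\<rho> / 2 ^ J n \<le> \<rho> / 2 ^ n" using \<rho> by (intro divide_left_mono) auto
        then show ?thesis using elim(6) by linarith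
      qed
      ultimately show ?case using elim(1,3,4) unfolding good_def by simp
    qed
  qed
  define \<tau> where "\<tau> n = 2 ^ N * (real n * C1 * 2 powr (- real n) + C2 * (1 / n + 2 powr (- real n))
      + C3 * 2 powr (- real n) + c * \<rho> powr h * 2 powr (- ((h - h') * n)))" for n
  have bound: "\<bar>\<Lambda>\<bar> \<le> \<tau> n" if g: "good n" and En: "E n x0 \<le> h'" for n
  proof -
    define k where "k = real_of_int (node n x0)"
    define s :: real where "s = 2 ^ J n"
    have s: "s > 0" by (simp add: s_def)
    define e where "e = 2 powr (- (E n x0 * J n))"
    have e: "e > 0" by (simp add: e_def)
    define q where "q = 2 powr (- (H * J n))"
    \<comment> \<open>Chosen so that the wavelet of the node of \<open>x0\<close> takes the value
      \<psi>(u + t i) at \<open>z i\<close>. The polynomial \<open>Q\<close> below collects the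
      Taylor polynomials of all coarser layers and is annihilated together with
      \<open>P\<close>.\<close>
    define z where "z i = (k + u + t * real i) / s" for i :: nat
    define Q :: "real poly" where "Q = (\<Sum>i<N. monom (\<Sum>m<n. layer i m x0 / fact i) i)"
    have Q: "poly Q y = (\<Sum>m<n. \<Sum>i<N. layer i m x0 / fact i * y ^ i)" for y
      by (subst sum.swap) (simp add: Q_def poly_sum poly_monom sum_distrib_right)
    have degQ: "degree Q < N" unfolding Q_def
      using N(1) by (intro degree_sum_less) (auto intro: le_less_trans[OF degree_monom_le])
    have W: "\<bar>e * \<psi> (u + t * real i) - poly (P - Q) (z i - x0)\<bar>
        \<le> n * (C1 * q) + C2 * (e / n + q) + C3 * q + c * (\<rho> powr h * 2 powr (- (h * J n)))" (is "_ \<le> ?W")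
      if i: "i \<le> N" for i
    proof -
      have sz: "2 ^ J n * z i = k + u + t * real i" using s by (simp add: z_def s_def)
      have win: "\<bar>2 ^ J n * z i - 2 ^ J n * x0\<bar> \<le> \<rho>"
      proof -
        have "t * real i \<le> t * N" "0 \<le> t * real i" using t(1) i by auto
        then show ?thesis unfolding sz \<rho>_def using dist_node[of n x0] by (simp add: k_def)
      qed
      have "s * \<bar>z i - x0\<bar> = \<bar>2 ^ J n * z i - 2 ^ J n * x0\<bar>"
        unfolding s_def by (simp add: abs_mult right_diff_distrib[symmetric])
      then have r: "\<bar>z i - x0\<bar> \<le> \<rho> / s" using win s by (simp add: field_simps)
      have r1: "\<bar>z i - x0\<bar> \<le> 2 powr (- b n) / 2" using r g unfolding good_def s_def by linarith
      have r2: "\<bar>z i - x0\<bar> < d" using r g unfolding good_def s_def by linarith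
      have "F (z i) = (\<Sum>m. layer 0 (m + Suc n) (z i)) + (\<Sum>m<Suc n. layer 0 m (z i))"
        unfolding F_def by (rule suminf_split_initial_segment[OF summable_layer])
      then have Feq: "F (z i) = (\<Sum>m. layer 0 (m + Suc n) (z i)) + (\<Sum>m<n. layer 0 m (z i)) + layer 0 n (z i)"
        by simp
      have a1: "\<bar>(\<Sum>m<n. layer 0 m (z i)) - poly Q (z i - x0)\<bar> \<le> n * (C1 * q)"
      proof -
        have "\<bar>(\<Sum>m<n. layer 0 m (z i)) - poly Q (z i - x0)\<bar>
          = \<bar>\<Sum>m<n. layer 0 m (z i) - (\<Sum>i'<N. layer i' m x0 / fact i' * (z i - x0) ^ i')\<bar>"
          unfolding Q by (simp add: sum_subtractf)
        also have "\<dots> \<le> (\<Sum>m<n. C1 * q)"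
          unfolding q_def
          by (rule order_trans[OF sum_abs], rule sum_mono, rule C1(2))
             (use g win in \<open>auto simp: good_def\<close>)
        finally show ?thesis by simp
      qed
      have a2: "\<bar>layer 0 n (z i) - e * \<psi> (u + t * real i)\<bar> \<le> C2 * (e / n + q)"
      proof -
        have "2 ^ J n * z i - real_of_int (node n x0) = u + t * real i"
          unfolding sz k_def by simp
        then show ?thesis using C2(2)[OF nd _ r1 win] g unfolding good_def e_def q_def by simp
      qed
      have a3: "\<bar>\<Sum>m. layer 0 (m + Suc n) (z i)\<bar> \<le> C3 * q"
      proof -
        have "2 powr (- (\<eta> * J (Suc n))) \<le> q" unfolding q_def using g by (simp add: good_def)
        then show ?thesis using C3 by (meson mult_left_mono order_trans less_imp_le)
      qed
      have a4: "\<bar>F (z i) - poly P (z i - x0)\<bar> \<le> c * (\<rho> powr h * 2 powr (- (h * J n)))"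
      proof -
        have "\<bar>F (z i) - poly P (z i - x0)\<bar> \<le> c * \<bar>z i - x0\<bar> powr h" by (rule cd(3)[OF r2])
        also have "\<dots> \<le> c * (\<rho> / s) powr h" using cd(1) r h(1) by (intro mult_left_mono powr_mono2) auto
        also have "(\<rho> / s) powr h = \<rho> powr h * 2 powr (- (h * J n))"
          using \<rho> by (simp add: powr_divide s_def powr_J[symmetric] powr_powr powr_minus divide_simps mult_ac)
        finally show ?thesis .
      qed
      have "poly (P - Q) (z i - x0) = poly P (z i - x0) - poly Q (z i - x0)" by simp
      then show ?thesis using a1 a2 a3 a4 Feq by linarith
    qed
    have poly0: "(\<Sum>i\<le>N. (-1) ^ i * real (N choose i) * poly (P - Q) (z i - x0)) = 0"
    proof -
      have "degree (P - Q) < N" using N(2) degQ by (intro degree_diff_less) auto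
      from alternating_binomial_poly_affine_eq_0[OF this, of "(k + u) / s - x0" "t / s"]
      show ?thesis by (simp add: z_def add_divide_distrib algebra_simps)
    qed
    have "e * \<Lambda> = (\<Sum>i\<le>N. (-1) ^ i * real (N choose i) * (e * \<psi> (u + t * real i) - poly (P - Q) (z i - x0)))"
      unfolding right_diff_distrib sum_subtractf poly0 by (simp add: \<Lambda>_def sum_distrib_left mult_ac)
    also have "\<bar>\<dots>\<bar> \<le> 2 ^ N * ?W"
      by (rule alternating_binomial_abs_le[OF W])
    finally have "e * \<bar>\<Lambda>\<bar> \<le> 2 ^ N * ?W" using e by (simp add: abs_mult)
    also have "\<dots> \<le> e * \<tau> n"
    proof -
      have Jn: "real n \<le> J n" using J_ge by simp
      have "2 powr (- real n) * e \<ge> q"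
      proof -
        have "E n x0 * J n \<le> h' * J n" using En by (intro mult_right_mono) auto
        then have "- (H * J n) \<le> - real n + - (E n x0 * J n)"
          using Jn by (simp add: H_def algebra_simps)
        then show ?thesis unfolding q_def e_def powr_add[symmetric] by simp
      qed
      moreover have "2 powr (- ((h - h') * n)) * e \<ge> 2 powr (- (h * J n))"
      proof -
        have "E n x0 * J n \<le> h' * J n" using En by (intro mult_right_mono) auto
        moreover have "(h - h') * n \<le> (h - h') * J n" using Jn h(2) by (intro mult_left_mono) auto
        ultimately have "- (h * J n) \<le> - ((h - h') * n) + - (E n x0 * J n)"
          by (simp add: algebra_simps)
        then show ?thesis unfolding e_def powr_add[symmetric] by simp
      qed
      ultimately have "?W \<le> n * (C1 * (2 powr (- real n) * e)) + C2 * (e / n + 2 powr (- real n) * e)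
          + C3 * (2 powr (- real n) * e) + c * (\<rho> powr h * (2 powr (- ((h - h') * n)) * e))"
        using C1(1) C2(1) C3(1) cd(1) by (intro add_mono mult_left_mono) auto
      also have "2 ^ N * \<dots> = e * \<tau> n" by (simp add: \<tau>_def algebra_simps)
      finally show ?thesis by simp
    qed
    finally show ?thesis using e by simp
  qed
  have "\<tau> \<longlonglongrightarrow> 0"
  proof -
    define g where "g = h - h'"
    have g: "g > 0" using h(2) by (simp add: g_def)
    have 1: "(\<lambda>n. real n * 2 powr (- real n)) \<longlonglongrightarrow> 0" by real_asymp
    have 2: "(\<lambda>n. 1 / real n) \<longlonglongrightarrow> 0" by real_asymp
    have 3: "(\<lambda>n. 2 powr (- real n)) \<longlonglongrightarrow> 0" by real_asymp
    have 4: "(\<lambda>n. 2 powr (- (g * real n))) \<longlonglongrightarrow> 0" using g by real_asymp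
    have "(\<lambda>n. 2 ^ N * (C1 * (real n * 2 powr (- real n)) + C2 * (1 / n + 2 powr (- real n))
        + C3 * 2 powr (- real n) + (c * \<rho> powr h) * 2 powr (- (g * real n))))
        \<longlonglongrightarrow> 2 ^ N * (C1 * 0 + C2 * (0 + 0) + C3 * 0 + (c * \<rho> powr h) * 0)"
      by (intro tendsto_intros 1 2 3 4)
    then show ?thesis unfolding \<tau>_def g_def by (simp add: mult_ac)
  qed
  moreover have "\<bar>\<Lambda>\<bar> > 0" using t(2) by (simp add: \<Lambda>_def)
  ultimately have "eventually (\<lambda>n. \<tau> n < \<bar>\<Lambda>\<bar>) sequentially" by (rule order_tendstoD)
  with ev_good have "eventually (\<lambda>n. \<not> E n x0 \<le> h') sequentially"
    by eventually_elim (use bound in force)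
  with freq show False by (simp add: frequently_def)
qed

lemma E_ge: "x \<in> K \<Longrightarrow> \<eta> \<le> E n x"
  by (auto simp: K_def E_def intro: ex_ge)

theorem hoelder_exp_eq:
  assumes "x \<in> K" "\<psi> u \<noteq> 0"
  shows "hoelder_exp F x = liminf (\<lambda>n. ereal (E n x))"
proof (rule antisym)
  have eta_le: "ereal \<eta> \<le> liminf (\<lambda>n. ereal (E n x))"
    using E_ge[OF assms(1)] by (intro Liminf_bounded) auto
  show "hoelder_exp F x \<le> liminf (\<lambda>n. ereal (E n x))"
    unfolding hoelder_exp_def
  proof (rule Sup_least, clarify)
    fix h and P :: "real poly"
    assume h: "0 \<le> h" "(\<lambda>y. F y - poly P (y - x)) \<in> O[at x](\<lambda>y. \<bar>y - x\<bar> powr h)"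
    show "ereal h \<le> liminf (\<lambda>n. ereal (E n x))"
    proof (rule ccontr)
      assume "\<not> ereal h \<le> liminf (\<lambda>n. ereal (E n x))"
      then have lt: "liminf (\<lambda>n. ereal (E n x)) < ereal h" by simp
      obtain h' where h': "liminf (\<lambda>n. ereal (E n x)) < ereal h'" "ereal h' < ereal h"
        using ereal_dense2[OF lt] by blast
      have "0 < h'" using le_less_trans[OF eta_le h'(1)] eta_pos by simp
      moreover have "frequently (\<lambda>n. E n x \<le> h') sequentially"
      proof (rule ccontr)
        assume "\<not> frequently (\<lambda>n. E n x \<le> h') sequentially"
        then have "eventually (\<lambda>n. ereal h' \<le> ereal (E n x)) sequentially"
          unfolding not_frequently by eventually_elim simp
        then have "ereal h' \<le> liminf (\<lambda>n. ereal (E n x))" by (rule Liminf_bounded)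
        then show False using h'(1) by simp
      qed
      ultimately show False
        using exp_upper[OF assms h(2), of h'] h' by simp
    qed
  qed
  show "liminf (\<lambda>n. ereal (E n x)) \<le> hoelder_exp F x"
  proof (rule dense_le)
    fix y assume y: "y < liminf (\<lambda>n. ereal (E n x))"
    \<comment> \<open>\<open>y\<close> may be negative or minus infinity, whereas
      \<open>hoelder_exp\<close> ranges over nonnegative real orders.\<close>
    define w where "w = max y 0"
    have w: "0 \<le> w" "w < liminf (\<lambda>n. ereal (E n x))"
      using y less_le_trans[OF _ eta_le, of 0] eta_pos by (auto simp: w_def)
    then obtain h where h: "w = ereal h" "0 \<le> h" by (cases w) auto
    obtain z where z: "ereal h < ereal z" "ereal z < liminf (\<lambda>n. ereal (E n x))"
      using ereal_dense2[of w] w(2) h(1) by blast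
    have "eventually (\<lambda>n. ereal z < ereal (E n x)) sequentially" by (rule less_LiminfD[OF z(2)])
    then have "eventually (\<lambda>n. h + (z - h) \<le> E n x) sequentially" by eventually_elim simp
    from exp_lower[OF assms(1) h(2) _ this] z(1)
    have "ereal h \<le> hoelder_exp F x"
      unfolding hoelder_exp_def using h(2) by (intro Sup_upper) auto
    then show "y \<le> hoelder_exp F x" using h(1) by (auto simp: w_def max_def split: if_splits)
  qed
qed

end

section \<open>Wavelet coefficients and support\<close>

lemma schwartz_borel [measurable]: "schwartz \<psi> \<Longrightarrow> \<psi> \<in> borel_measurable borel"
proof (intro borel_measurable_continuous_onI continuous_at_imp_continuous_on ballI differentiable_imp_continuous_within)
  fix x assume "schwartz \<psi>"
  then have "(deriv ^^ 0) \<psi> differentiable (at x)" unfolding schwartz_def by blast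
  then show "\<psi> differentiable (at x)" by simp
qed

lemma schwartz_integrable:
  assumes "schwartz \<psi>"
  shows "integrable lborel \<psi>"
proof -
  obtain C where C: "C > 0" "\<And>u. \<bar>\<psi> u\<bar> \<le> C / (1 + \<bar>u\<bar>) ^ 2"
    using schwartz_decay[OF assms, of 0 2] by auto
  have "integrable lborel (\<lambda>x::real. inverse (1 + x\<^sup>2))"
    using integrable_inverse_1_plus_square by (simp add: set_integrable_def einterval_def)
  then have "integrable lborel (\<lambda>x::real. C * inverse (1 + x\<^sup>2))" by simp
  then show ?thesis
  proof (rule Bochner_Integration.integrable_bound)
    show "\<psi> \<in> borel_measurable lborel" using schwartz_borel[OF assms] by simp
    show "AE x in lborel. norm (\<psi> x) \<le> norm (C * inverse (1 + x\<^sup>2))"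
    proof (rule AE_I2)
      fix x :: real
      have "C / (1 + \<bar>x\<bar>) ^ 2 \<le> C / (1 + x\<^sup>2)"
        using C(1) by (intro divide_left_mono) (auto simp: power2_sum intro!: mult_pos_pos zero_less_power add_pos_nonneg)
      then show "norm (\<psi> x) \<le> norm (C * inverse (1 + x\<^sup>2))"
        using order_trans[OF C(2)[of x]] C(1) by (simp add: divide_inverse abs_mult add_nonneg_nonneg)
    qed
  qed
qed

lemma dyadic_int_floor_subset:
  fixes x :: real
  assumes "n \<le> m"
  shows "dyadic_int (int m) \<lfloor>2 ^ m * x\<rfloor> \<subseteq> dyadic_int (int n) \<lfloor>2 ^ n * x\<rfloor>"
proof -
  define i where "i = \<lfloor>2 ^ n * x\<rfloor>"
  define k where "k = \<lfloor>2 ^ m * x\<rfloor>"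
  define w :: int where "w = 2 ^ (m - n)"
  have w: "real_of_int w * 2 ^ n = 2 ^ m" "real_of_int w > 0"
    using assms by (simp_all add: w_def power_add[symmetric])
  have i: "real_of_int i \<le> 2 ^ n * x" "2 ^ n * x < real_of_int i + 1" unfolding i_def by linarith+
  have "real_of_int (w * i) \<le> w * (2 ^ n * x)" using i(1) w(2) by simp
  also have "\<dots> = 2 ^ m * x" using w(1) by (simp flip: mult.assoc)
  finally have 1: "w * i \<le> k" unfolding k_def by (simp add: le_floor_iff)
  have "2 ^ m * x = w * (2 ^ n * x)" using w(1) by (simp flip: mult.assoc)
  also have "\<dots> < w * (real_of_int i + 1)" using i(2) w(2) by (intro mult_strict_left_mono)
  also have "\<dots> = real_of_int (w * (i + 1))" by simp
  finally have 2: "k + 1 \<le> w * (i + 1)" unfolding k_def by (simp add: floor_less_iff add1_zle_eq)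
  have p: "2 powr - real_of_int (int n) = real_of_int w * 2 powr - real_of_int (int m)"
    using w by (simp add: powr_minus powr_realpow field_simps)
  have "real_of_int i * (real_of_int w * 2 powr - real_of_int (int m)) \<le> real_of_int k * 2 powr - real_of_int (int m)"
  proof -
    have "real_of_int (w * i) * 2 powr - real_of_int (int m) \<le> real_of_int k * 2 powr - real_of_int (int m)"
      using 1 by (intro mult_right_mono) (simp_all del: of_int_mult)
    then show ?thesis by (simp add: mult_ac)
  qed
  moreover have "real_of_int (k + 1) * 2 powr - real_of_int (int m)
      \<le> real_of_int (i + 1) * (real_of_int w * 2 powr - real_of_int (int m))"
  proof -
    have "real_of_int (k + 1) * 2 powr - real_of_int (int m) \<le> real_of_int (w * (i + 1)) * 2 powr - real_of_int (int m)"
      using 2 by (intro mult_right_mono) (simp_all del: of_int_mult of_int_add)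
    then show ?thesis by (simp add: mult_ac)
  qed
  ultimately show ?thesis
    unfolding dyadic_int_def i_def[symmetric] k_def[symmetric] p by (auto simp del: of_int_add)
qed

text \<open>Leaders also look at the two neighbouring intervals, so a point just outside a node
  could see coefficients of its descendants at every scale. \<open>nested\<close> prevents this by
  keeping descendants away from both ends of the node: by the relative margin \<open>\<mu> n\<close>
  on the left and by 1/2 on the right. The left margin may shrink with n, since only its positivity
  at each level matters.\<close>

locale wavelet_tree = wavelet_series +
  fixes \<mu> :: "nat \<Rightarrow> real"
  assumes wavelet: "orthonormal_wavelet \<psi>"
    and root: "J 0 = 0" "Nd 0 = {0}"
    and mu_pos: "0 < \<mu> n"
    and nested: "k \<in> Nd (Suc n) \<Longrightarrow> \<exists>\<kappa>\<in>Nd n.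
      (real_of_int \<kappa> + \<mu> n) / 2 ^ J n \<le> real_of_int k / 2 ^ J (Suc n) \<and>
      (real_of_int k + 1) / 2 ^ J (Suc n) \<le> (real_of_int \<kappa> + 1 / 2) / 2 ^ J n"
begin

lemma shifted_integrable: "integrable lborel (\<lambda>x. \<psi> (2 powr real_of_int j * x - real_of_int k))"
  using lborel_integrable_real_affine[OF schwartz_integrable[OF schwartz],
      of "2 powr real_of_int j" "- real_of_int k"] by simp

lemma psi_bounded: obtains C where "\<And>u. \<bar>\<psi> u\<bar> \<le> C"
proof -
  obtain C where "\<And>u. \<bar>\<psi> u\<bar> \<le> C / (1 + \<bar>u\<bar>) ^ 0"
    using schwartz_decay[OF schwartz, of 0 0] by auto
  then show ?thesis using that[of C] by simp
qed

lemma bounded_mult_shifted_integrable: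
  assumes "g \<in> borel_measurable borel" "\<And>x. \<bar>g x\<bar> \<le> C"
  shows "integrable lborel (\<lambda>x. g x * \<psi> (2 powr real_of_int j * x - real_of_int k))"
proof (rule Bochner_Integration.integrable_bound)
  show "integrable lborel (\<lambda>x. C * \<psi> (2 powr real_of_int j * x - real_of_int k))"
    using shifted_integrable by simp
  show "(\<lambda>x. g x * \<psi> (2 powr real_of_int j * x - real_of_int k)) \<in> borel_measurable lborel"
    using assms(1) schwartz_borel[OF schwartz] by simp
  have "0 \<le> C" using assms(2)[of 0] by linarith
  then show "AE x in lborel. norm (g x * \<psi> (2 powr real_of_int j * x - real_of_int k))
      \<le> norm (C * \<psi> (2 powr real_of_int j * x - real_of_int k))"
    using assms(2) by (intro AE_I2) (auto simp: abs_mult intro!: mult_right_mono)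
qed

lemma layer_borel [measurable]: "layer i n \<in> borel_measurable borel"
  by (intro borel_measurable_continuous_onI layer_continuous)

text \<open>Orthonormality concerns the wavelets normalised in the mean-square norm. For equal
  scales their two factors 2^(j/2) multiply to exactly the factor 2^j in \<open>wcoef\<close>, so
  the coefficients of the expansion are recovered unchanged.\<close>

lemma wcoef_layer: "wcoef \<psi> (layer 0 n) j k = (if j = int (J n) \<and> k \<in> Nd n then 2 powr (- (ex n k * J n)) else 0)"
proof -
  have ortho: "(LINT x|lborel. \<psi> (2 ^ J n * x - real_of_int k') * \<psi> (2 powr real_of_int j * x - real_of_int k))
    = (if int (J n) = j \<and> k' = k then 2 powr (- real_of_int j) else 0)" for k'
  proof -
    have "(LINT x|lborel. 2 powr (real_of_int (int (J n)) / 2) * \<psi> (2 powr real_of_int (int (J n)) * x - real_of_int k')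
        * (2 powr (real_of_int j / 2) * \<psi> (2 powr real_of_int j * x - real_of_int k)))
        = (if int (J n) = j \<and> k' = k then 1 else 0)"
      using wavelet unfolding orthonormal_wavelet_def by blast
    also have "(LINT x|lborel. 2 powr (real_of_int (int (J n)) / 2) * \<psi> (2 powr real_of_int (int (J n)) * x - real_of_int k')
        * (2 powr (real_of_int j / 2) * \<psi> (2 powr real_of_int j * x - real_of_int k)))
        = (LINT x|lborel. (2 powr (real (J n) / 2) * 2 powr (real_of_int j / 2)) *
          (\<psi> (2 ^ J n * x - real_of_int k') * \<psi> (2 powr real_of_int j * x - real_of_int k)))"
      by (intro Bochner_Integration.integral_cong) (auto simp: powr_J mult_ac)
    also have "\<dots> = (2 powr (real (J n) / 2) * 2 powr (real_of_int j / 2)) *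
        (LINT x|lborel. \<psi> (2 ^ J n * x - real_of_int k') * \<psi> (2 powr real_of_int j * x - real_of_int k))"
      by simp
    finally have *: "(2 powr (real (J n) / 2) * 2 powr (real_of_int j / 2)) *
        (LINT x|lborel. \<psi> (2 ^ J n * x - real_of_int k') * \<psi> (2 powr real_of_int j * x - real_of_int k))
        = (if int (J n) = j \<and> k' = k then 1 else 0)" .
    have "2 powr (real (J n) / 2) * 2 powr (real_of_int j / 2) = 2 powr real_of_int j" if "int (J n) = j"
      using that by (auto simp: powr_add[symmetric])
    then show ?thesis using * by (auto simp: powr_minus_divide eq_divide_eq mult.commute split: if_splits)
  qed
  obtain C where C: "\<And>u. \<bar>\<psi> u\<bar> \<le> C" using psi_bounded by blast
  have "wcoef \<psi> (layer 0 n) j k = 2 powr real_of_int j *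
      (LINT x|lborel. (\<Sum>k'\<in>Nd n. 2 powr (- (ex n k' * J n)) *
        (\<psi> (2 ^ J n * x - real_of_int k') * \<psi> (2 powr real_of_int j * x - real_of_int k))))"
    unfolding wcoef_def layer_def wterm_def sum_distrib_right by (simp add: mult.assoc)
  also have "\<dots> = 2 powr real_of_int j * (\<Sum>k'\<in>Nd n. 2 powr (- (ex n k' * J n)) *
        (if int (J n) = j \<and> k' = k then 2 powr (- real_of_int j) else 0))"
  proof (subst Bochner_Integration.integral_sum)
    fix k' assume "k' \<in> Nd n"
    have "integrable lborel (\<lambda>x. \<psi> (2 ^ J n * x - real_of_int k') * \<psi> (2 powr real_of_int j * x - real_of_int k))"
      using schwartz_borel[OF schwartz] C by (intro bounded_mult_shifted_integrable[where C = C]) auto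
    then show "integrable lborel (\<lambda>x. 2 powr (- (ex n k' * J n)) *
        (\<psi> (2 ^ J n * x - real_of_int k') * \<psi> (2 powr real_of_int j * x - real_of_int k)))"
      by simp
  qed (simp add: ortho)
  also have "(\<Sum>k'\<in>Nd n. 2 powr (- (ex n k' * J n)) *
        (if int (J n) = j \<and> k' = k then 2 powr (- real_of_int j) else 0))
      = (\<Sum>k'\<in>Nd n. if k' = k then (if int (J n) = j then 2 powr (- (ex n k * J n)) * 2 powr (- real_of_int j) else 0) else 0)"
    by (intro sum.cong) auto
  also have "2 powr real_of_int j * \<dots> = (if j = int (J n) \<and> k \<in> Nd n then 2 powr (- (ex n k * J n)) else 0)"
    using finite_Nd by (auto simp: powr_minus)
  finally show ?thesis .
qed

text \<open>Sum and integral commute because the sup norms of the layers are summable and each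
  wavelet is integrable.\<close>

lemma wcoef_sum: "wcoef \<psi> F j k = (\<Sum>n. wcoef \<psi> (layer 0 n) j k)"
proof -
  let ?\<psi> = "\<lambda>x. \<psi> (2 powr real_of_int j * x - real_of_int k)"
  obtain C where C: "C > 0" "\<And>n x. \<bar>layer 0 n x\<bar> \<le> C * 2 powr (- (\<eta> * J n))"
    using layer0_bound by blast
  have int: "integrable lborel (\<lambda>x. layer 0 n x * ?\<psi> x)" for n
    by (rule bounded_mult_shifted_integrable[OF layer_borel C(2)])
  have sC: "summable (\<lambda>n. C * 2 powr (- (\<eta> * J n)))"
    by (intro summable_mult summable_powr_neg_J eta_pos)
  have s1: "summable (\<lambda>n. norm (layer 0 n x * ?\<psi> x))" for x
    by (rule summable_comparison_test'[OF summable_mult2[OF sC, of "\<bar>?\<psi> x\<bar>"], of 0])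
       (auto simp: abs_mult intro!: mult_right_mono C)
  have s2: "summable (\<lambda>n. LINT x|lborel. norm (layer 0 n x * ?\<psi> x))"
  proof (rule summable_comparison_test'[OF summable_mult2[OF sC, of "LINT x|lborel. \<bar>?\<psi> x\<bar>"], of 0])
    fix n
    have "(LINT x|lborel. norm (layer 0 n x * ?\<psi> x)) \<le> (LINT x|lborel. (C * 2 powr (- (\<eta> * J n))) * \<bar>?\<psi> x\<bar>)"
    proof (rule integral_mono)
      show "integrable lborel (\<lambda>x. norm (layer 0 n x * ?\<psi> x))" using int by (rule integrable_norm)
      show "integrable lborel (\<lambda>x. (C * 2 powr (- (\<eta> * J n))) * \<bar>?\<psi> x\<bar>)"
        using shifted_integrable by simp
    qed (auto simp: abs_mult intro!: mult_right_mono C)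
    then show "norm (LINT x|lborel. norm (layer 0 n x * ?\<psi> x))
        \<le> C * 2 powr (- (\<eta> * J n)) * (LINT x|lborel. \<bar>?\<psi> x\<bar>)" by simp
  qed
  have "(LINT x|lborel. F x * ?\<psi> x) = (LINT x|lborel. (\<Sum>n. layer 0 n x * ?\<psi> x))"
    unfolding F_def by (intro Bochner_Integration.integral_cong suminf_mult2 summable_layer refl)
  also have "\<dots> = (\<Sum>n. LINT x|lborel. layer 0 n x * ?\<psi> x)"
    by (rule integral_suminf[OF int _ s2]) (use s1 in auto)
  finally have eq: "(LINT x|lborel. F x * ?\<psi> x) = (\<Sum>n. LINT x|lborel. layer 0 n x * ?\<psi> x)" .
  have "summable (\<lambda>n. LINT x|lborel. layer 0 n x * ?\<psi> x)"
    by (rule summable_comparison_test'[OF s2, of 0]) (rule integral_norm_bound)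
  then show ?thesis unfolding wcoef_def eq by (rule suminf_mult[symmetric])
qed

lemma wcoef_node: "k \<in> Nd n \<Longrightarrow> wcoef \<psi> F (int (J n)) k = 2 powr (- (ex n k * J n))"
proof -
  assume k: "k \<in> Nd n"
  have "wcoef \<psi> (layer 0 m) (int (J n)) k = 0" if "m \<notin> {n}" for m
    using that strict_mono_eq[OF J, of n m] by (simp add: wcoef_layer)
  then have "wcoef \<psi> F (int (J n)) k = (\<Sum>m\<in>{n}. wcoef \<psi> (layer 0 m) (int (J n)) k)"
    unfolding wcoef_sum by (intro suminf_finite) auto
  then show ?thesis using k by (simp add: wcoef_layer)
qed

lemma wcoef_nonzeroD:
  assumes "wcoef \<psi> F j k \<noteq> 0"
  shows "\<exists>n. j = int (J n) \<and> k \<in> Nd n"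
proof (rule ccontr)
  assume "\<nexists>n. j = int (J n) \<and> k \<in> Nd n"
  then have "wcoef \<psi> (layer 0 n) j k = 0" for n by (auto simp: wcoef_layer)
  then show False using assms by (simp add: wcoef_sum)
qed

section \<open>Identification of the support\<close>

lemma nested_iter:
  assumes "k \<in> Nd (Suc (n + m))"
  shows "\<exists>\<kappa>\<in>Nd n. (real_of_int \<kappa> + \<mu> n) / 2 ^ J n \<le> real_of_int k / 2 ^ J (Suc (n + m)) \<and>
      (real_of_int k + 1) / 2 ^ J (Suc (n + m)) \<le> (real_of_int \<kappa> + 1 / 2) / 2 ^ J n"
  using assms
proof (induction m arbitrary: k)
  case 0
  then show ?case using nested[of k n] by simp
next
  case (Suc m)
  from Suc.prems obtain k' where k': "k' \<in> Nd (Suc (n + m))"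
    "(real_of_int k' + \<mu> (Suc (n + m))) / 2 ^ J (Suc (n + m)) \<le> real_of_int k / 2 ^ J (Suc (Suc (n + m)))"
    "(real_of_int k + 1) / 2 ^ J (Suc (Suc (n + m))) \<le> (real_of_int k' + 1 / 2) / 2 ^ J (Suc (n + m))"
    using nested[of k "Suc (n + m)"] by auto
  have "real_of_int k' / 2 ^ J (Suc (n + m)) \<le> (real_of_int k' + \<mu> (Suc (n + m))) / 2 ^ J (Suc (n + m))"
    using mu_pos[of "Suc (n + m)"] by (intro divide_right_mono) auto
  moreover have "(real_of_int k' + 1 / 2) / 2 ^ J (Suc (n + m)) \<le> (real_of_int k' + 1) / 2 ^ J (Suc (n + m))"
    by (intro divide_right_mono) auto
  ultimately show ?case unfolding add_Suc_right using Suc.IH[OF k'(1)] k'(2,3) by (meson order_trans)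
qed

lemma K_subset: "K \<subseteq> {0..<1}"
proof
  fix x assume "x \<in> K"
  then have "node 0 x \<in> Nd 0" unfolding K_def by blast
  then have "\<lfloor>x\<rfloor> = 0" by (simp add: node_def root)
  then show "x \<in> {0..<1}" by (simp add: floor_eq_iff)
qed

lemma K_subset_wsupp: "K \<subseteq> wsupp \<psi> F"
proof
  fix x assume x: "x \<in> K"
  have "0 < wleader \<psi> F (int n) \<lfloor>2 ^ n * x\<rfloor>" for n
  proof -
    have nd: "node n x \<in> Nd n" using x by (simp add: K_def)
    have "dyadic_int (int (J n)) (node n x) \<subseteq> dyadic_int (int n) \<lfloor>2 ^ n * x\<rfloor>"
      unfolding node_def using J_ge by (rule dyadic_int_floor_subset)
    then have "(int (J n), node n x) \<in> {(j', k').
        \<exists>i \<in> {\<lfloor>2 ^ n * x\<rfloor> - 1, \<lfloor>2 ^ n * x\<rfloor>, \<lfloor>2 ^ n * x\<rfloor> + 1}. dyadic_int j' k' \<subseteq> dyadic_int (int n) i}"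
      by auto
    moreover have "0 < ereal \<bar>wcoef \<psi> F (fst (int (J n), node n x)) (snd (int (J n), node n x))\<bar>"
      using wcoef_node[OF nd] by simp
    ultimately show ?thesis unfolding wleader_def less_SUP_iff by blast
  qed
  then show "x \<in> wsupp \<psi> F" using K_subset x unfolding wsupp_def by auto
qed

text \<open>Fix a level n and a dyadic generation N beyond \<open>J n\<close> with 2 / 2^N below the
  margin \<open>m\<close> of the nodes of that level. A positive leader at generation N yields a
  node of scale at least N whose left end is within 2 / 2^N of x. It is a proper descendant of some
  node of level n, and the margin of the latter keeps x inside it.\<close>

lemma wsupp_subset_K: "wsupp \<psi> F \<subseteq> K"
proof
  fix x assume x: "x \<in> wsupp \<psi> F"
  have "node n x \<in> Nd n" for n
  proof -
    define m where "m = min (\<mu> n) (1 / 2) / 2 ^ J n"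
    have m: "m > 0" using mu_pos[of n] by (simp add: m_def)
    have "eventually (\<lambda>N. 2 / 2 ^ N < m) sequentially" using m by real_asymp
    moreover have "eventually (\<lambda>N. Suc (J n) \<le> N) sequentially" by (rule eventually_ge_at_top)
    ultimately obtain N where N: "2 / 2 ^ N < m" "Suc (J n) \<le> N"
      using eventually_happens'[OF sequentially_bot eventually_conj] by blast
    define l where "l = \<lfloor>2 ^ N * x\<rfloor>"
    have "0 < wleader \<psi> F (int N) l" using x N(2) unfolding wsupp_def l_def by auto
    then obtain j k i where jk: "i \<in> {l - 1, l, l + 1}" "dyadic_int j k \<subseteq> dyadic_int (int N) i"
      "0 < ereal \<bar>wcoef \<psi> F j k\<bar>"
      unfolding wleader_def less_SUP_iff by auto
    then obtain n' where n': "j = int (J n')" "k \<in> Nd n'" using wcoef_nonzeroD[of j k] by auto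
    define y where "y = real_of_int k / 2 ^ J n'"
    have sub: "{y ..< (real_of_int k + 1) / 2 ^ J n'} \<subseteq> {real_of_int i / 2 ^ N ..< (real_of_int i + 1) / 2 ^ N}"
      using jk(2) unfolding dyadic_int_def n'(1) y_def
      by (simp add: powr_minus powr_realpow divide_inverse)
    have ylt: "y < (real_of_int k + 1) / 2 ^ J n'"
      unfolding y_def by (intro divide_strict_right_mono) auto
    have y: "real_of_int i / 2 ^ N \<le> y" "(real_of_int k + 1) / 2 ^ J n' \<le> (real_of_int i + 1) / 2 ^ N"
      using sub ylt by (auto simp: atLeastLessThan_subset_iff)
    have "1 / 2 ^ J n' \<le> (1::real) / 2 ^ N"
      using y unfolding y_def by (simp add: add_divide_distrib)
    then have "(2::real) ^ N \<le> 2 ^ J n'" by (simp add: field_simps)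
    then have "N \<le> J n'" by simp
    then have "J n < J n'" using N(2) by simp
    then have "n < n'" using strict_mono_less[OF J] by blast
    then obtain p where p: "n' = Suc (n + p)" using less_iff_Suc_add by auto
    obtain \<kappa> where \<kappa>: "\<kappa> \<in> Nd n" "(real_of_int \<kappa> + \<mu> n) / 2 ^ J n \<le> y"
      "(real_of_int k + 1) / 2 ^ J n' \<le> (real_of_int \<kappa> + 1 / 2) / 2 ^ J n"
      using nested_iter[of k n p] n'(2) unfolding p y_def by blast
    have dist: "\<bar>y - x\<bar> < m"
    proof -
      have "real_of_int l / 2 ^ N \<le> x" "x < (real_of_int l + 1) / 2 ^ N"
        unfolding l_def by (simp_all add: pos_divide_le_eq pos_less_divide_eq mult.commute)
      moreover have "y < (real_of_int i + 1) / 2 ^ N" using ylt y(2) by linarith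
      moreover have "real_of_int l - 1 \<le> real_of_int i" "real_of_int i \<le> real_of_int l + 1" using jk(1) by auto
      then have "(real_of_int l - 1) / 2 ^ N \<le> real_of_int i / 2 ^ N"
        "(real_of_int i + 1) / 2 ^ N \<le> (real_of_int l + 2) / 2 ^ N"
        by (intro divide_right_mono; simp)+
      ultimately have "\<bar>y - x\<bar> < 2 / 2 ^ N"
        using y(1) by (simp add: add_divide_distrib diff_divide_distrib abs_less_iff)
      then show ?thesis using N(1) by linarith
    qed
    have "m * 2 ^ J n \<le> \<mu> n" "m * 2 ^ J n \<le> 1 / 2" by (simp_all add: m_def)
    then have "m \<le> \<mu> n / 2 ^ J n" "m \<le> (1 / 2) / 2 ^ J n" by (simp_all add: pos_le_divide_eq)
    moreover have "y < (real_of_int \<kappa> + 1 / 2) / 2 ^ J n" using ylt \<kappa>(3) by linarith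
    ultimately have "real_of_int \<kappa> / 2 ^ J n < x" "x < (real_of_int \<kappa> + 1) / 2 ^ J n"
      using dist \<kappa>(2) by (simp_all add: add_divide_distrib abs_less_iff)
    then have "real_of_int \<kappa> < 2 ^ J n * x" "2 ^ J n * x < real_of_int \<kappa> + 1"
      by (simp_all add: field_simps)
    then have "node n x = \<kappa>" unfolding node_def by linarith
    then show ?thesis using \<kappa>(1) by simp
  qed
  then show "x \<in> K" by (simp add: K_def)
qed

lemma wsupp_eq: "wsupp \<psi> F = K"
  using K_subset_wsupp wsupp_subset_K by blast

lemma psi_nonzero: "\<exists>u. \<psi> u \<noteq> 0"
proof (rule ccontr)
  assume "\<nexists>u. \<psi> u \<noteq> 0"
  then have "\<psi> = (\<lambda>x. 0)" by auto
  moreover have "(LINT x|lborel. 2 powr (real_of_int 0 / 2) * \<psi> (2 powr real_of_int 0 * x - real_of_int 0)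
      * (2 powr (real_of_int 0 / 2) * \<psi> (2 powr real_of_int 0 * x - real_of_int 0)))
      = (if (0::int) = 0 \<and> (0::int) = 0 then 1 else 0)"
    using wavelet unfolding orthonormal_wavelet_def by blast
  ultimately show False by simp
qed

lemma hoelder_exp_eq_liminf: "x \<in> K \<Longrightarrow> hoelder_exp F x = liminf (\<lambda>n. ereal (E n x))"
  using psi_nonzero hoelder_exp_eq by blast

end

section \<open>Hausdorff dimension\<close>

text \<open>The Borel-Cantelli argument for coverings: every tail of the sequence of families covers
  \<open>A\<close>, and the tails of the summable series of s-th powers of lengths tend to
  0.\<close>

lemma hausdorff_measure_limsup_eq_0:
  fixes T :: "nat \<Rightarrow> int set" and j :: "nat \<Rightarrow> nat" and s :: real
  assumes s: "0 < s" and fin: "\<And>n. finite (T n)" and j: "\<And>n. n \<le> j n"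
    and sm: "summable (\<lambda>n. real (card (T n)) * 2 powr (- (s * j n)))"
    and A: "A \<subseteq> {x. frequently (\<lambda>n. \<lfloor>2 ^ j n * x\<rfloor> \<in> T n) sequentially}"
  shows "hausdorff_measure s A = 0"
proof -
  have "hausdorff_pre s \<delta> A \<le> 0 + ennreal \<epsilon>" if \<delta>: "\<delta> > 0" and \<epsilon>: "\<epsilon> > 0" for \<delta> \<epsilon>
  proof -
    define a where "a n = real (card (T n)) * 2 powr (- (s * j n))" for n
    have a: "a n \<ge> 0" for n by (simp add: a_def)
    obtain M where M: "\<And>N. N \<ge> M \<Longrightarrow> norm (\<Sum>n. a (n + N)) < \<epsilon>"
      using suminf_exist_split[OF \<epsilon> sm] unfolding a_def by blast
    have "eventually (\<lambda>N. 1 / 2 ^ N < \<delta>) sequentially" using \<delta> by real_asymp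
    then obtain M' where M': "\<And>N. N \<ge> M' \<Longrightarrow> 1 / 2 ^ N < \<delta>" unfolding eventually_sequentially by blast
    define N where "N = max M M'"
    have N: "(\<Sum>n. a (n + N)) < \<epsilon>" "1 / 2 ^ N < \<delta>"
      using M[of N] M'[of N] by (auto simp: N_def)
    have "\<exists>e. bij_betw e {..<card (T n)} (T n)" for n
      using ex_bij_betw_nat_finite[OF fin[of n]] by (simp add: atLeast0LessThan)
    then obtain e where e: "\<And>n. bij_betw (e n) {..<card (T n)} (T n)" by metis
    define I where "I n k = {real_of_int k / 2 ^ j n .. (real_of_int k + 1) / 2 ^ j n}" for n k
    have diam: "diameter (I n k) = 1 / 2 ^ j n" for n k
      unfolding I_def by (subst diameter_closed_interval) (simp add: add_divide_distrib)
    have ne: "I n k \<noteq> {}" for n k by (auto simp: I_def divide_right_mono)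
    \<comment> \<open>The doubly indexed cover is padded with empty sets, which
      \<open>diam_pow\<close> counts as 0, so that it can be flattened into one sequence by
      \<open>prod_decode\<close>.\<close>
    define V where "V = (\<lambda>(n, l). if l < card (T (n + N)) then I (n + N) (e (n + N) l) else {})"
    have pw: "diam_pow s (I n k) = 2 powr (- (s * j n))" for n k
      using s ne by (simp add: diam_pow_def diam powr_divide powr_realpow[symmetric] powr_powr powr_minus
          divide_simps mult.commute)
    have "(\<Sum>i. ennreal (diam_pow s (V (prod_decode i)))) = (\<Sum>n. ennreal (a (n + N)))"
    proof (rule suminf_ennreal_2dimen)
      fix n
      have "(\<Sum>l. ennreal (diam_pow s (V (n, l)))) = (\<Sum>l\<in>{..<card (T (n + N))}. ennreal (diam_pow s (V (n, l))))"
        by (rule suminf_finite) (auto simp: V_def diam_pow_def)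
      also have "\<dots> = (\<Sum>l\<in>{..<card (T (n + N))}. ennreal (2 powr (- (s * j (n + N)))))"
        by (intro sum.cong) (auto simp: V_def pw)
      also have "\<dots> = ennreal (a (n + N))"
        by (simp add: a_def ennreal_mult ennreal_of_nat_eq_real_of_nat)
      finally show "ennreal (a (n + N)) = (\<Sum>l. ennreal (diam_pow s (V (n, l))))" by simp
    qed
    also have "\<dots> = ennreal (\<Sum>n. a (n + N))"
      using sm a unfolding a_def[symmetric] by (intro suminf_ennreal2) (auto simp: summable_iff_shift)
    also have "\<dots> \<le> ennreal \<epsilon>" using N(1) by (intro ennreal_leI) auto
    finally have "(\<Sum>i. ennreal (diam_pow s (V (prod_decode i)))) \<le> ennreal \<epsilon>" .
    moreover have "hausdorff_pre s \<delta> A \<le> (\<Sum>i. ennreal (diam_pow s (V (prod_decode i))))"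
      unfolding hausdorff_pre_def
    proof (rule INF_lower, rule CollectI, intro conjI allI)
      show "A \<subseteq> (\<Union>i. V (prod_decode i))"
      proof
        fix x assume "x \<in> A"
        then have "frequently (\<lambda>n. \<lfloor>2 ^ j n * x\<rfloor> \<in> T n) sequentially" using A by auto
        then obtain n where n: "n \<ge> N" "\<lfloor>2 ^ j n * x\<rfloor> \<in> T n"
          by (auto simp: frequently_sequentially)
        obtain l where l: "l < card (T n)" "e n l = \<lfloor>2 ^ j n * x\<rfloor>"
          using e[of n] n(2) unfolding bij_betw_def by (metis imageE lessThan_iff)
        have "x \<in> I n \<lfloor>2 ^ j n * x\<rfloor>"
          unfolding I_def by (auto simp: field_simps) linarith
        then have "x \<in> V (n - N, l)" using n l by (simp add: V_def)
        then show "x \<in> (\<Union>i. V (prod_decode i))"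
          by (intro UN_I[of "prod_encode (n - N, l)"]) auto
      qed
      fix i
      obtain n l where nl: "prod_decode i = (n, l)" by fastforce
      show "bounded (V (prod_decode i))" by (auto simp: nl V_def I_def)
      have "1 / 2 ^ j (n + N) \<le> (1::real) / 2 ^ N"
        using j[of "n + N"] by (intro divide_left_mono power_increasing) auto
      then show "diameter (V (prod_decode i)) \<le> \<delta>" using \<delta> N(2) by (auto simp: nl V_def diam)
    qed
    ultimately show ?thesis by simp
  qed
  then have "hausdorff_pre s \<delta> A = 0" if "\<delta> > 0" for \<delta>
    using that by (metis ennreal_le_epsilon le_zero_eq)
  then show ?thesis unfolding hausdorff_measure_def by (simp add: SUP_constant)
qed

lemma dim_H_le:
  assumes "0 \<le> t" "\<And>s. t < s \<Longrightarrow> hausdorff_measure s A = 0"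
  shows "dim_H A \<le> ereal t"
proof (cases "A = {}")
  case False
  have "Inf {ereal s | s. s \<ge> 0 \<and> hausdorff_measure s A = 0} \<le> ereal t"
  proof (rule dense_ge)
    fix y assume "ereal t < y"
    then obtain s where "ereal t < ereal s" "ereal s < y" using ereal_dense2 by blast
    moreover have "Inf {ereal s | s. s \<ge> 0 \<and> hausdorff_measure s A = 0} \<le> ereal s"
      using assms calculation by (intro Inf_lower) auto
    ultimately show "Inf {ereal s | s. s \<ge> 0 \<and> hausdorff_measure s A = 0} \<le> y" by order
  qed
  then show ?thesis using False by (simp add: dim_H_def)
qed (simp add: dim_H_def)

text \<open>The hypothesis says that \<open>x\<close> has an s-Hoelder inverse. A cover of
  \<open>A\<close> therefore pulls back to a cover of the unit interval of total length at most 2 C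
  times the sum of the s-th powers of the diameters, and Lebesgue measure bounds that from below. It
  replaces the construction of a measure on \<open>A\<close>.\<close>

lemma hausdorff_measure_nonzero:
  fixes x :: "real \<Rightarrow> real" and C s :: real
  assumes C: "0 < C" and in_A: "\<And>y. y \<in> {0..<1} \<Longrightarrow> x y \<in> A"
    and le: "\<And>y y'. y \<in> {0..<1} \<Longrightarrow> y' \<in> {0..<1} \<Longrightarrow>
      \<bar>y - y'\<bar> \<le> C * (if s = 0 then 1 else \<bar>x y - x y'\<bar> powr s)"
    and s: "0 \<le> s"
  shows "hausdorff_measure s A \<noteq> 0"
proof
  assume "hausdorff_measure s A = 0"
  moreover have "hausdorff_pre s 1 A \<le> hausdorff_measure s A"
    unfolding hausdorff_measure_def by (rule SUP_upper) simp
  ultimately have "hausdorff_pre s 1 A < ennreal (1 / (2 * C))" using C by simp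
  then obtain U where U: "A \<subseteq> (\<Union>i. U i)" "\<And>i. bounded (U i)"
    "(\<Sum>i. ennreal (diam_pow s (U i))) < ennreal (1 / (2 * C))"
    unfolding hausdorff_pre_def INF_less_iff by auto
  define Y where "Y i = {y \<in> {0..<1}. x y \<in> U i}" for i
  \<comment> \<open>The sets \<open>Y i\<close> need not be measurable; each is enclosed in an
    interval centred at one of its own points.\<close>
  define V where "V i = (if Y i = {} then {} else
    {(SOME y. y \<in> Y i) - C * diam_pow s (U i) .. (SOME y. y \<in> Y i) + C * diam_pow s (U i)})" for i
  have dp: "diam_pow s (U i) \<ge> 0" for i by (simp add: diam_pow_def)
  have YV: "Y i \<subseteq> V i" for i
  proof
    fix y assume y: "y \<in> Y i"
    define z where "z = (SOME y. y \<in> Y i)"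
    have z: "z \<in> Y i" unfolding z_def using y by (rule someI)
    have "\<bar>y - z\<bar> \<le> C * (if s = 0 then 1 else \<bar>x y - x z\<bar> powr s)"
      using le y z by (auto simp: Y_def)
    also have "\<dots> \<le> C * diam_pow s (U i)"
    proof (rule mult_left_mono)
      have "\<bar>x y - x z\<bar> \<le> diameter (U i)"
        using diameter_bounded_bound[OF U(2), of "x y" i "x z"] y z by (auto simp: Y_def dist_real_def)
      then show "(if s = 0 then 1 else \<bar>x y - x z\<bar> powr s) \<le> diam_pow s (U i)"
        using y s by (auto simp: diam_pow_def Y_def intro: powr_mono2)
    qed (use C in auto)
    finally have "\<bar>y - z\<bar> \<le> C * diam_pow s (U i)" .
    then show "y \<in> V i" using y by (auto simp: V_def z_def[symmetric])
  qed
  have "{0..<1} \<subseteq> (\<Union>i. V i)"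
  proof
    fix y :: real assume y: "y \<in> {0..<1}"
    then obtain i where "x y \<in> U i" using in_A U(1) by blast
    then have "y \<in> Y i" using y by (simp add: Y_def)
    then show "y \<in> (\<Union>i. V i)" using YV by blast
  qed
  then have "emeasure lborel {0..<1::real} \<le> emeasure lborel (\<Union>i. V i)"
    by (intro emeasure_mono) (auto simp: V_def)
  also have "\<dots> \<le> (\<Sum>i. emeasure lborel (V i))"
    by (intro emeasure_subadditive_countably) (auto simp: V_def)
  also have "\<dots> \<le> (\<Sum>i. ennreal (2 * C) * ennreal (diam_pow s (U i)))"
  proof (intro suminf_le)
    fix i
    show "emeasure lborel (V i) \<le> ennreal (2 * C) * ennreal (diam_pow s (U i))"
      using C dp[of i] by (auto simp: V_def ennreal_mult[symmetric] intro!: ennreal_leI)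
  qed auto
  also have "\<dots> = ennreal (2 * C) * (\<Sum>i. ennreal (diam_pow s (U i)))" by (rule ennreal_suminf_cmult)
  also have "\<dots> < 1"
  proof -
    have "ennreal (2 * C) * (\<Sum>i. ennreal (diam_pow s (U i))) < ennreal (2 * C) * ennreal (1 / (2 * C))"
      using U(3) C by (intro ennreal_mult_strict_left_mono) auto
    also have "\<dots> = 1" using C by (subst ennreal_mult[symmetric]) auto
    finally show ?thesis .
  qed
  finally show False by simp
qed

text \<open>The infimum defining \<open>dim_H\<close> also runs over s = 0, where the hypothesis is
  silent. There a constant map into \<open>A\<close> satisfies the assumptions of
  \<open>hausdorff_measure_nonzero\<close>, because points of the unit interval are at distance at
  most 1.\<close>

lemma le_dim_H:
  assumes "A \<noteq> {}" "\<And>s. 0 < s \<Longrightarrow> s < t \<Longrightarrow> hausdorff_measure s A \<noteq> 0"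
  shows "ereal t \<le> dim_H A"
proof -
  obtain a where "a \<in> A" using assms(1) by blast
  then have "hausdorff_measure 0 A \<noteq> 0"
    by (intro hausdorff_measure_nonzero[where C = 1 and x = "\<lambda>_. a"]) auto
  then have "t \<le> s" if "s \<ge> 0" "hausdorff_measure s A = 0" for s
    using assms(2)[of s] that by (cases "s = 0") force+
  then show ?thesis unfolding dim_H_def using assms(1) by (auto intro!: Inf_greatest)
qed

text \<open>The digits of a point \<open>y\<close> of the unit interval in mixed radix \<open>N\<close> select a branch \<open>kap y\<close> of nested
  dyadic intervals at the scales \<open>D i\<close>.\<close>
locale mixed_radix_cantor =
  fixes D N :: "nat \<Rightarrow> nat" and off S :: "nat \<Rightarrow> int" and k0 :: int
  assumes D: "strict_mono D" and N: "1 \<le> N i" and S: "2 \<le> S i" and off: "0 \<le> off i"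
    and fits: "2 * (off i + int (N i) * S i) \<le> 2 ^ (D (Suc i) - D i)"
begin

definition Q :: "nat \<Rightarrow> nat" where "Q i = (\<Prod>l<i. N l)"

text \<open>The first \<open>i\<close> digits of y packed into one integer. Two points share their
  branch up to generation \<open>i\<close> as soon as these integers agree up to
  \<open>i\<close>.\<close>

definition t :: "nat \<Rightarrow> real \<Rightarrow> int" where "t i y = \<lfloor>y * Q i\<rfloor>"

definition digit :: "nat \<Rightarrow> real \<Rightarrow> int" where
  "digit i y = t (Suc i) y - int (N i) * t i y"

primrec kap :: "real \<Rightarrow> nat \<Rightarrow> int" where
  "kap y 0 = k0"
| "kap y (Suc i) = kap y i * 2 ^ (D (Suc i) - D i) + off i + digit i y * S i"

definition pt :: "real \<Rightarrow> real" where
  "pt y = (SUP i. kap y i / 2 ^ D i)"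

lemma Q_pos: "Q i > 0"
  unfolding Q_def by (rule prod_pos) (use N in \<open>auto intro: less_le_trans[OF zero_less_one]\<close>)

lemma digit_bounds: "0 \<le> digit i y" "digit i y < int (N i)"
proof -
  have l: "real_of_int (t i y) \<le> y * Q i" "y * Q i < real_of_int (t i y) + 1"
    unfolding t_def by linarith+
  have N0: "real (N i) > 0" using N[of i] by simp
  have QS: "y * Q (Suc i) = (y * Q i) * N i" by (simp add: Q_def)
  have "real_of_int (int (N i) * t i y) \<le> y * Q (Suc i)"
    unfolding QS using l(1) N0 by (simp add: mult.commute)
  then show "0 \<le> digit i y" unfolding digit_def t_def[of "Suc i"] by (simp add: le_floor_iff)
  have "y * Q (Suc i) < (real_of_int (t i y) + 1) * N i"
    unfolding QS using l(2) N0 by (intro mult_strict_right_mono)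
  then have "y * Q (Suc i) < real_of_int (int (N i) * t i y + int (N i))"
    by (simp add: algebra_simps)
  then have "t (Suc i) y < int (N i) * t i y + int (N i)" unfolding t_def[of "Suc i"] floor_less_iff .
  then show "digit i y < int (N i)" by (simp add: digit_def)
qed

lemma pow_D: "(2::real) ^ D (Suc i) = 2 ^ D i * 2 ^ (D (Suc i) - D i)"
  using strict_monoD[OF D, of i "Suc i"] by (simp add: power_add[symmetric])

lemma kap_step:
  "real_of_int (kap y i) / 2 ^ D i \<le> real_of_int (kap y (Suc i)) / 2 ^ D (Suc i)"
  "(real_of_int (kap y (Suc i)) + 1) / 2 ^ D (Suc i) \<le> (real_of_int (kap y i) + 1 / 2) / 2 ^ D i"
proof -
  define W :: int where "W = 2 ^ (D (Suc i) - D i)"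
  have Wr: "real_of_int W = 2 ^ (D (Suc i) - D i)" by (simp add: W_def)
  have W: "real_of_int W > 0" by (simp add: Wr)
  have lo: "kap y i * W \<le> kap y (Suc i)"
    using off[of i] digit_bounds(1)[of i y] S[of i] by (simp add: W_def)
  have "(digit i y + 1) * S i \<le> int (N i) * S i"
    using digit_bounds(2)[of i y] S[of i] by (intro mult_right_mono) auto
  then have hi: "2 * (kap y (Suc i) + 1) \<le> (2 * kap y i + 1) * W"
    using fits[of i] S[of i] by (simp add: W_def algebra_simps)
  have "real_of_int (kap y i * W) \<le> real_of_int (kap y (Suc i))" using lo by (simp only: of_int_le_iff)
  then show "real_of_int (kap y i) / 2 ^ D i \<le> real_of_int (kap y (Suc i)) / 2 ^ D (Suc i)"
    unfolding pow_D Wr[symmetric] using W by (simp add: divide_simps mult_ac)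
  have "real_of_int (2 * (kap y (Suc i) + 1)) \<le> real_of_int ((2 * kap y i + 1) * W)"
    using hi by (simp only: of_int_le_iff)
  then have "real_of_int (kap y (Suc i)) + 1 \<le> (real_of_int (kap y i) + 1 / 2) * real_of_int W"
    by (simp add: algebra_simps)
  then show "(real_of_int (kap y (Suc i)) + 1) / 2 ^ D (Suc i) \<le> (real_of_int (kap y i) + 1 / 2) / 2 ^ D i"
    unfolding pow_D Wr[symmetric] using W by (simp add: divide_simps mult_ac)
qed

lemma kap_mono: "i \<le> l \<Longrightarrow> real_of_int (kap y i) / 2 ^ D i \<le> real_of_int (kap y l) / 2 ^ D l"
  by (rule lift_Suc_mono_le[where f = "\<lambda>i. real_of_int (kap y i) / 2 ^ D i"]) (rule kap_step)

lemma kap_right_antimono: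
  "i \<le> l \<Longrightarrow> (real_of_int (kap y l) + 1) / 2 ^ D l \<le> (real_of_int (kap y i) + 1) / 2 ^ D i"
proof (rule lift_Suc_antimono_le[where f = "\<lambda>i. (real_of_int (kap y i) + 1) / 2 ^ D i"])
  fix i
  have "(real_of_int (kap y i) + 1 / 2) / 2 ^ D i \<le> (real_of_int (kap y i) + 1) / 2 ^ D i"
    by (intro divide_right_mono) auto
  then show "(real_of_int (kap y (Suc i)) + 1) / 2 ^ D (Suc i) \<le> (real_of_int (kap y i) + 1) / 2 ^ D i"
    using kap_step(2) by (rule order_trans[rotated])
qed

lemma kap_le: "real_of_int (kap y l) / 2 ^ D l \<le> (real_of_int (kap y i) + 1 / 2) / 2 ^ D i"
proof (cases "l \<le> i")
  case True
  have "real_of_int (kap y i) / 2 ^ D i \<le> (real_of_int (kap y i) + 1 / 2) / 2 ^ D i"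
    by (intro divide_right_mono) auto
  then show ?thesis using kap_mono[OF True] by (rule order_trans[rotated])
next
  case False
  have "real_of_int (kap y l) / 2 ^ D l \<le> (real_of_int (kap y l) + 1) / 2 ^ D l"
    by (intro divide_right_mono) auto
  also have "\<dots> \<le> (real_of_int (kap y (Suc i)) + 1) / 2 ^ D (Suc i)"
    using False by (intro kap_right_antimono) auto
  also have "\<dots> \<le> (real_of_int (kap y i) + 1 / 2) / 2 ^ D i" by (rule kap_step)
  finally show ?thesis .
qed

lemma pt_bounds: "real_of_int (kap y i) / 2 ^ D i \<le> pt y" "pt y \<le> (real_of_int (kap y i) + 1 / 2) / 2 ^ D i"
proof -
  have "bdd_above (range (\<lambda>i. real_of_int (kap y i) / 2 ^ D i))"
    using kap_le[of y _ 0] by (intro bdd_aboveI2)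
  then show "real_of_int (kap y i) / 2 ^ D i \<le> pt y"
    unfolding pt_def by (rule cSUP_upper2[OF _ UNIV_I order_refl])
  show "pt y \<le> (real_of_int (kap y i) + 1 / 2) / 2 ^ D i"
    unfolding pt_def by (rule cSUP_least) (use kap_le in auto)
qed

text \<open>By \<open>fits\<close> all descendants lie in the left half of a branch interval, so the
  supremum of the left end points cannot reach the excluded right end point.\<close>

lemma floor_pt: "\<lfloor>2 ^ D i * pt y\<rfloor> = kap y i"
proof -
  have "real_of_int (kap y i) \<le> 2 ^ D i * pt y" "2 ^ D i * pt y \<le> real_of_int (kap y i) + 1 / 2"
    using pt_bounds[of y i] by (simp_all add: field_simps)
  then show ?thesis by linarith
qed

lemma kap_cong:
  assumes "\<And>l. l \<le> i \<Longrightarrow> t l y = t l y'"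
  shows "kap y i = kap y' i"
  using assms by (induction i) (auto simp: digit_def)

text \<open>Let the branches of y and y' separate between generations i and i + 1, with digits
  differing by \<Delta>. Then |y - y'| \<le> 2 \<Delta> / (Q i * N i), while equal spacing and
  \<open>size\<close> put the image points at distance at least (\<Delta> / N i) / (2^(D i) * w i).
  Since \<Delta> \<le> N i and s \<le> 1, taking the power s does not decrease the ratio \<Delta> /
  N i, and \<open>mass\<close> compares the remaining factors. The weight \<open>w i\<close>
  measures how small a part of its parent interval a block may occupy.\<close>

lemma pt_inverse_hoelder:
  fixes w :: "nat \<Rightarrow> real" and C s :: real
  assumes s: "0 < s" "s \<le> 1" and w: "\<And>i. 1 \<le> w i"
    and size: "\<And>i. 2 * 2 ^ D (Suc i) \<le> real (N i) * S i * (2 ^ D i * w i)"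
    and mass: "\<And>i. 2 * (2 ^ D i * w i) powr s \<le> C * Q i"
    and y: "y \<in> {0..<1}" "y' \<in> {0..<1}"
  shows "\<bar>y - y'\<bar> \<le> C * \<bar>pt y - pt y'\<bar> powr s"
proof (cases "y = y'")
  case True
  then show ?thesis using s by simp
next
  case False
  have Dge: "i \<le> D i" for i using D by (rule strict_mono_imp_increasing)
  have Qr: "real (Q i) > 0" for i using Q_pos by simp
  have near: "\<bar>y - y'\<bar> * Q i \<le> \<bar>real_of_int (t i y - t i y')\<bar> + 1" for i
  proof -
    have "\<bar>y - y'\<bar> * Q i = \<bar>y * Q i - y' * Q i\<bar>"
      using Qr[of i] by (simp add: abs_mult left_diff_distrib[symmetric])
    also have "\<dots> \<le> \<bar>real_of_int (t i y - t i y')\<bar> + 1" unfolding t_def by (simp, linarith)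
    finally show ?thesis .
  qed
  have Cpos: "C > 0"
  proof -
    have "0 < 2 * (2 ^ D 0 * w 0) powr s" using w[of 0] by simp
    then have "0 < C * Q 0" using mass[of 0] by linarith
    then show ?thesis using Qr[of 0] by (simp add: zero_less_mult_iff)
  qed
  \<comment> \<open>Agreement at every generation would give |y - y'| * Q i \<le> 1 for all i, but
    \<open>mass\<close> forces \<open>Q i\<close> to grow at least geometrically.\<close>
  have "\<exists>i. t i y \<noteq> t i y'"
  proof (rule ccontr)
    assume "\<nexists>i. t i y \<noteq> t i y'"
    then have "\<bar>y - y'\<bar> * Q i \<le> 1" for i using near[of i] by simp
    moreover have "(2 powr s) ^ i \<le> C * Q i" for i
    proof -
      have "(2::real) ^ i * 1 \<le> 2 ^ D i * w i" using Dge[of i] w[of i] by (intro mult_mono power_increasing) auto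
      then have "(2 ^ i) powr s \<le> (2 ^ D i * w i) powr s" using s by (intro powr_mono2) auto
      then have "(2 powr s) ^ i \<le> (2 ^ D i * w i) powr s"
        by (simp add: powr_realpow[symmetric] powr_powr mult.commute)
      then show ?thesis using mass[of i] powr_ge_zero[of "2 ^ D i * w i" s] by linarith
    qed
    ultimately have b: "\<bar>y - y'\<bar> * (2 powr s) ^ i \<le> C" for i
    proof -
      have "\<bar>y - y'\<bar> * (2 powr s) ^ i \<le> \<bar>y - y'\<bar> * (C * Q i)"
        using \<open>\<And>i. (2 powr s) ^ i \<le> C * Q i\<close> by (intro mult_left_mono) auto
      also have "\<dots> = C * (\<bar>y - y'\<bar> * Q i)" by simp
      also have "\<dots> \<le> C * 1" using \<open>\<And>i. \<bar>y - y'\<bar> * Q i \<le> 1\<close> Cpos by (intro mult_left_mono) auto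
      finally show ?thesis by simp
    qed
    obtain i where "C / \<bar>y - y'\<bar> < (2 powr s) ^ i"
      using real_arch_pow[of "2 powr s"] s by auto
    then show False using b[of i] False by (simp add: field_simps)
  qed
  then obtain i0 where i0: "t i0 y \<noteq> t i0 y'" "\<And>l. l < i0 \<Longrightarrow> t l y = t l y'"
    using exists_least_iff[of "\<lambda>i. t i y \<noteq> t i y'"] by blast
  have "t 0 y = 0" "t 0 y' = 0" using y by (simp_all add: t_def Q_def floor_eq_iff)
  then have "t 0 y = t 0 y'" by simp
  then obtain i where i: "i0 = Suc i" using i0(1) by (cases i0) auto
  have teq: "t l y = t l y'" if "l \<le> i" for l using i0(2) i that by simp
  have kap_eq: "kap y i = kap y' i" using teq by (rule kap_cong)
  define \<Delta> where "\<Delta> = \<bar>real_of_int (t (Suc i) y - t (Suc i) y')\<bar>"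
  have D1: "\<Delta> \<ge> 1" using i0(1) unfolding i \<Delta>_def by linarith
  have tdig: "t (Suc i) y - t (Suc i) y' = digit i y - digit i y'"
    unfolding digit_def using teq[of i] by simp
  have DN: "\<Delta> \<le> N i"
    unfolding \<Delta>_def tdig using digit_bounds[of i y] digit_bounds[of i y'] by linarith
  have Sr: "real_of_int (S i) \<ge> 2" using S[of i] by linarith
  have N0: "real (N i) > 0" using N[of i] by simp
  have w0: "w i > 0" using w[of i] by linarith
  have "real_of_int (kap y (Suc i)) - real_of_int (kap y' (Suc i)) = real_of_int (t (Suc i) y - t (Suc i) y') * S i"
    unfolding tdig using kap_eq by (simp add: left_diff_distrib)
  then have kd: "\<bar>real_of_int (kap y (Suc i)) - real_of_int (kap y' (Suc i))\<bar> = \<Delta> * S i"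
    unfolding \<Delta>_def using Sr by (simp add: abs_mult)
  have "\<Delta> * S i / 2 \<le> 2 ^ D (Suc i) * \<bar>pt y - pt y'\<bar>"
  proof -
    have "\<bar>real_of_int (kap y (Suc i)) - real_of_int (kap y' (Suc i))\<bar> - 1 \<le> \<bar>2 ^ D (Suc i) * pt y - 2 ^ D (Suc i) * pt y'\<bar>"
      using floor_pt[of "Suc i" y, symmetric] floor_pt[of "Suc i" y', symmetric] by linarith
    also have "\<dots> = 2 ^ D (Suc i) * \<bar>pt y - pt y'\<bar>" by (simp add: abs_mult right_diff_distrib[symmetric])
    finally have "\<Delta> * S i - 1 \<le> 2 ^ D (Suc i) * \<bar>pt y - pt y'\<bar>" unfolding kd .
    moreover have "1 * 2 \<le> \<Delta> * S i" using D1 Sr by (intro mult_mono) auto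
    ultimately show ?thesis by linarith
  qed
  then have "\<Delta> * S i / (2 * 2 ^ D (Suc i)) \<le> \<bar>pt y - pt y'\<bar>" by (simp add: field_simps)
  moreover have "(\<Delta> / N i) / (2 ^ D i * w i) \<le> \<Delta> * S i / (2 * 2 ^ D (Suc i))"
  proof -
    have "(\<Delta> / N i) / (2 ^ D i * w i) = \<Delta> * S i / (real (N i) * S i * (2 ^ D i * w i))"
      using Sr by (simp add: field_simps)
    also have "\<dots> \<le> \<Delta> * S i / (2 * 2 ^ D (Suc i))"
      using size[of i] Sr D1 N0 w0 by (intro divide_left_mono mult_nonneg_nonneg mult_pos_pos) auto
    finally show ?thesis .
  qed
  ultimately have "(\<Delta> / N i) / (2 ^ D i * w i) \<le> \<bar>pt y - pt y'\<bar>" by linarith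
  then have "((\<Delta> / N i) / (2 ^ D i * w i)) powr s \<le> \<bar>pt y - pt y'\<bar> powr s"
    using s D1 N0 w0 by (intro powr_mono2) auto
  moreover have "(\<Delta> / N i) / (2 ^ D i * w i) powr s \<le> ((\<Delta> / N i) / (2 ^ D i * w i)) powr s"
  proof -
    have "(\<Delta> / N i) powr 1 \<le> (\<Delta> / N i) powr s" using DN D1 N0 s by (intro powr_mono') auto
    then have "(\<Delta> / N i) / (2 ^ D i * w i) powr s \<le> (\<Delta> / N i) powr s / (2 ^ D i * w i) powr s"
      using D1 N0 by (intro divide_right_mono) auto
    also have "\<dots> = ((\<Delta> / N i) / (2 ^ D i * w i)) powr s"
      by (rule powr_divide[symmetric])
    finally show ?thesis .
  qed
  ultimately have "C * ((\<Delta> / N i) / (2 ^ D i * w i) powr s) \<le> C * \<bar>pt y - pt y'\<bar> powr s"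
    using Cpos by (intro mult_left_mono) auto
  moreover have "\<bar>y - y'\<bar> \<le> C * ((\<Delta> / N i) / (2 ^ D i * w i) powr s)"
  proof -
    define p where "p = (2 ^ D i * w i) powr s"
    have p: "p > 0" using w0 by (simp add: p_def)
    have QS: "real (Q (Suc i)) = Q i * N i" by (simp add: Q_def)
    have "\<bar>y - y'\<bar> * (Q i * N i) \<le> 2 * \<Delta>"
      using near[of "Suc i"] D1 unfolding QS \<Delta>_def[symmetric] by linarith
    then have "(\<bar>y - y'\<bar> * (Q i * N i)) * p \<le> (2 * \<Delta>) * p" using p by (intro mult_right_mono) auto
    also have "\<dots> = \<Delta> * (2 * p)" by simp
    also have "\<dots> \<le> \<Delta> * (C * Q i)" using mass[of i] D1 unfolding p_def by (intro mult_left_mono) auto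
    finally have "\<bar>y - y'\<bar> * N i * p * Q i \<le> C * \<Delta> * Q i" by (simp add: mult_ac)
    then have "\<bar>y - y'\<bar> * N i * p \<le> C * \<Delta>" using Qr[of i] by (simp only: mult_le_cancel_right_pos)
    then show ?thesis using p N0 unfolding p_def[symmetric] by (simp add: field_simps)
  qed
  ultimately show ?thesis by linarith
qed

end

section \<open>Prescribing the spectrum\<close>

text \<open>With X = \<open>scale n + n + 4\<close>, the next scale consists of n + 4 copies of X.
  At most n + 2 copies go into the exponent of branching. The other two pay exactly for the previous
  scale, the n + 3 binary digits locating a half block, and a spacing of at least
  2^(\<open>scale n + n + 5\<close>). As (n + 2) / (n + 4) tends to 1, nothing is lost in
  dimension.\<close>

primrec scale :: "nat \<Rightarrow> nat" where
  "scale 0 = 0"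
| "scale (Suc n) = (n + 4) * (scale n + n + 4)"

declare scale.simps(2) [simp del]

definition gap :: "nat \<Rightarrow> nat" where
  "gap n = scale (Suc n) - scale n"

text \<open>A node is cut into 2^(n + 3) half blocks. Label m occupies the one with index 2 (m + 1),
  counted from 0, and the next one stays empty to separate different labels. The labels 0 to n thus
  use only the left half of the node, and the first two half blocks form its left margin.\<close>

definition half_block :: "nat \<Rightarrow> int" where
  "half_block n = 2 ^ (gap n - (n + 3))"

lemma scale_lt: "scale n + n + 4 < scale (Suc n)"
proof -
  have "(n + 4) * (scale n + n + 4) = (scale n + n + 4) + (n + 3) * (scale n + n + 4)" by (simp add: algebra_simps)
  then show ?thesis by (simp add: scale.simps)
qed

lemma strict_mono_scale: "strict_mono scale"
  unfolding strict_mono_Suc_iff using scale_lt by (meson add_lessD1)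

lemma scale_Suc: "scale (Suc n) = scale n + gap n"
  using scale_lt[of n] by (simp add: gap_def)

lemma gap_ge: "n + 3 \<le> gap n"
  using scale_lt[of n] by (simp add: gap_def)

lemma pow_gap: "(2::int) ^ gap n = 2 ^ (n + 3) * half_block n"
  unfolding half_block_def power_add[symmetric] using gap_ge[of n] by simp

lemma half_block_pos: "half_block n > 0"
  by (simp add: half_block_def)

text \<open>Since \<open>q\<close> is at least 1, finitely many exceptional indices are absorbed
  into the constant.\<close>

lemma eventually_le_imp_bounded_ratio:
  fixes a :: "nat \<Rightarrow> real" and q :: "nat \<Rightarrow> nat"
  assumes "eventually (\<lambda>i. a i \<le> real (q i)) sequentially" "\<And>i. 0 < q i"
  obtains C where "\<And>i. a i \<le> C * real (q i)"
proof -
  obtain i0 where i0: "\<And>i. i \<ge> i0 \<Longrightarrow> a i \<le> real (q i)" using assms(1) unfolding eventually_sequentially by blast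
  have "a i \<le> (1 + (\<Sum>i<i0. \<bar>a i\<bar>)) * real (q i)" for i
  proof -
    have q: "1 \<le> real (q i)" using assms(2)[of i] by simp
    have S: "0 \<le> (\<Sum>i<i0. \<bar>a i\<bar>)" by (simp add: sum_nonneg)
    show ?thesis
    proof (cases "i < i0")
      case True
      then have "\<bar>a i\<bar> \<le> (\<Sum>i<i0. \<bar>a i\<bar>)" by (intro member_le_sum) auto
      then have "a i \<le> (1 + (\<Sum>i<i0. \<bar>a i\<bar>)) * 1" using abs_ge_self[of "a i"] by simp
      also have "\<dots> \<le> (1 + (\<Sum>i<i0. \<bar>a i\<bar>)) * real (q i)" using q S by (intro mult_left_mono) auto
      finally show ?thesis .
    next
      case False
      then have "a i \<le> 1 * real (q i)" using i0 by simp
      also have "\<dots> \<le> (1 + (\<Sum>i<i0. \<bar>a i\<bar>)) * real (q i)" using S by (intro mult_right_mono) auto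
      finally show ?thesis .
    qed
  qed
  then show ?thesis using that by blast
qed

text \<open>A node of level \<open>n\<close> has, for every label \<open>m \<le> n\<close>, a block of \<open>2 ^ branching n m\<close> equally spaced
  children; a child with label \<open>m\<close> carries the exponent \<open>h m\<close>, truncated at \<open>\<eta> + n\<close> to be finite.
  Since the scales grow superexponentially, the dimension is governed by the last level only.\<close>
locale prescribed_spectrum =
  fixes \<psi> :: "real \<Rightarrow> real" and h :: "nat \<Rightarrow> ereal" and s :: "nat \<Rightarrow> real" and \<eta> :: real
  assumes ortho: "orthonormal_wavelet \<psi>" and eta: "0 < \<eta>" and h_ge: "ereal \<eta> \<le> h m"
    and s: "0 \<le> s m" "s m \<le> 1"
begin

definition branching :: "nat \<Rightarrow> nat \<Rightarrow> nat" where
  "branching n m = nat \<lfloor>s m * real ((n + 2) * (scale n + n + 4))\<rfloor>"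

definition spacing :: "nat \<Rightarrow> nat \<Rightarrow> int" where
  "spacing n m = 2 ^ (gap n - (n + 3) - branching n m)"

definition slot :: "nat \<Rightarrow> nat \<Rightarrow> nat \<Rightarrow> int" where
  "slot n m a = 2 * (int m + 1) * half_block n + int a * spacing n m"

primrec nodes :: "nat \<Rightarrow> int set" where
  "nodes 0 = {0}"
| "nodes (Suc n) = (\<Union>k\<in>nodes n. \<Union>m\<in>{..n}. (\<lambda>a. k * 2 ^ gap n + slot n m a) ` {..<2 ^ branching n m})"

text \<open>Decodes the label from the position inside the parent: block m lies in the pair of half
  blocks numbered m + 1, hence the subtraction. The value at the root is a dummy, which no lower
  limit sees.\<close>

primrec label :: "nat \<Rightarrow> int \<Rightarrow> nat" where
  "label 0 k = 0"
| "label (Suc n) k = nat ((k mod 2 ^ gap n) div (2 * half_block n) - 1)"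

definition expo :: "nat \<Rightarrow> int \<Rightarrow> real" where
  "expo n k = real_of_ereal (min (h (label n k)) (ereal (\<eta> + real n)))"

text \<open>At level n + 1, a half block of the level-n parents has true length
  2^(-(\<open>scale n + n + 3\<close>)); this is the distance guaranteed between different
  exponents. The recursion for \<open>scale\<close> makes the exponent negligible against
  \<open>scale (Suc n)\<close>.\<close>

definition coarseness :: "nat \<Rightarrow> real" where
  "coarseness n = (case n of 0 \<Rightarrow> 0 | Suc n \<Rightarrow> real (scale n + n + 3))"

section \<open>Geometry of the blocks\<close>

lemma branching_le: "real (branching n m) \<le> s m * real ((n + 2) * (scale n + n + 4))"
  unfolding branching_def using s(1)[of m] by (simp add: of_nat_nat)

lemma branching_ge: "s m * real ((n + 2) * (scale n + n + 4)) - 1 \<le> real (branching n m)"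
  unfolding branching_def by linarith

lemma branching_room: "branching n m + (scale n + n + 5) \<le> gap n - (n + 3)"
proof -
  have "real (branching n m) \<le> 1 * real ((n + 2) * (scale n + n + 4))"
    by (rule order_trans[OF branching_le]) (intro mult_right_mono s, simp)
  then have "branching n m \<le> (n + 2) * (scale n + n + 4)" by linarith
  then have "branching n m + (scale n + n + 5) + (n + 3) + scale n \<le> (n + 2) * (scale n + n + 4) + 2 * (scale n + n + 4)"
    by simp
  also have "\<dots> = scale (Suc n)" by (simp add: scale.simps algebra_simps)
  finally show ?thesis unfolding gap_def by linarith
qed

lemma spacing_pos: "spacing n m > 0"
  by (simp add: spacing_def)

lemma spacing_ge: "int (n + 1) \<le> spacing n m" "2 \<le> spacing n m"
proof -
  have e: "n + 5 \<le> gap n - (n + 3) - branching n m" using branching_room[of n m] by linarith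
  have "(2::int) ^ (n + 5) \<le> spacing n m" unfolding spacing_def using e by (intro power_increasing) auto
  moreover have "int (n + 5) < 2 ^ (n + 5)" using of_nat_less_two_power .
  ultimately show "int (n + 1) \<le> spacing n m" "2 \<le> spacing n m" by linarith+
qed

lemma spacing_branching: "2 ^ branching n m * spacing n m = half_block n"
proof -
  have "branching n m + (gap n - (n + 3) - branching n m) = gap n - (n + 3)"
    using branching_room[of n m] by linarith
  then show ?thesis by (simp add: spacing_def half_block_def power_add[symmetric])
qed

lemma slot_bounds:
  assumes "a < 2 ^ branching n m"
  shows "2 * (int m + 1) * half_block n \<le> slot n m a"
    "slot n m a + spacing n m \<le> 2 * (int m + 1) * half_block n + half_block n"
proof -
  show "2 * (int m + 1) * half_block n \<le> slot n m a" using spacing_pos[of n m] by (simp add: slot_def)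
  have "int a + 1 \<le> 2 ^ branching n m"
    using assms by (metis add.commute of_nat_Suc of_nat_le_iff of_nat_numeral of_nat_power Suc_leI)
  then have "(int a + 1) * spacing n m \<le> 2 ^ branching n m * spacing n m"
    using spacing_pos[of n m] by (intro mult_right_mono) auto
  then have "(int a + 1) * spacing n m \<le> half_block n" unfolding spacing_branching .
  then show "slot n m a + spacing n m \<le> 2 * (int m + 1) * half_block n + half_block n"
    by (simp add: slot_def algebra_simps)
qed

lemma block_in_half:
  assumes "m \<le> n"
  shows "2 * (2 * (int m + 1) * half_block n + half_block n) \<le> 2 ^ gap n"
proof -
  have "2 * (2 * n + 3) \<le> 2 ^ (n + 3)"
  proof (induction n)
    case (Suc n)
    have "2 * (2 * Suc n + 3) \<le> 2 * (2 * (2 * n + 3))" by simp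
    also have "\<dots> \<le> 2 * 2 ^ (n + 3)" using Suc by simp
    also have "\<dots> = 2 ^ (Suc n + 3)" by (simp only: power_Suc add_Suc)
    finally show ?case .
  qed simp
  then have "int (2 * (2 * n + 3)) \<le> int (2 ^ (n + 3))" by (simp only: of_nat_le_iff)
  moreover have "2 * (2 * (int m + 1) + 1) \<le> int (2 * (2 * n + 3))" using assms by simp
  ultimately have "2 * (2 * (int m + 1) + 1) \<le> 2 ^ (n + 3)" by simp
  then have "2 * (2 * (int m + 1) + 1) * half_block n \<le> 2 ^ (n + 3) * half_block n"
    using half_block_pos[of n] by (intro mult_right_mono) auto
  then show ?thesis by (simp add: pow_gap algebra_simps)
qed

lemma slot_half:
  assumes "m \<le> n" "a < 2 ^ branching n m"
  shows "0 \<le> slot n m a" "2 * (slot n m a + 1) \<le> 2 ^ gap n"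
proof -
  have "0 \<le> 2 * (int m + 1) * half_block n" using half_block_pos[of n] by simp
  then show "0 \<le> slot n m a" using slot_bounds(1)[OF assms(2)] by linarith
  have "2 * (slot n m a + spacing n m) \<le> 2 ^ gap n"
    by (rule order_trans[OF mult_left_mono[OF slot_bounds(2)[OF assms(2)]] block_in_half[OF assms(1)]]) simp
  then show "2 * (slot n m a + 1) \<le> 2 ^ gap n" using spacing_ge(2)[of n m] by simp
qed

lemma slot_lt: "m \<le> n \<Longrightarrow> a < 2 ^ branching n m \<Longrightarrow> slot n m a < 2 ^ gap n"
  using slot_half(1)[of m n a] slot_half(2)[of m n a] by simp

lemma label_child:
  assumes "m \<le> n" "a < 2 ^ branching n m"
  shows "label (Suc n) (k * 2 ^ gap n + slot n m a) = m"
proof -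
  have "(k * 2 ^ gap n + slot n m a) mod 2 ^ gap n = slot n m a"
    using slot_half(1)[OF assms] slot_lt[OF assms] by simp
  moreover have "slot n m a div (2 * half_block n) = int m + 1"
  proof (rule int_div_pos_eq)
    show "slot n m a = 2 * half_block n * (int m + 1) + int a * spacing n m" by (simp add: slot_def)
    show "0 \<le> int a * spacing n m" using spacing_pos[of n m] by simp
    show "int a * spacing n m < 2 * half_block n"
      using slot_bounds(2)[OF assms(2)] spacing_pos[of n m] half_block_pos[of n] by (simp add: slot_def)
  qed
  ultimately show ?thesis by simp
qed

lemma nodes_SucE:
  assumes "k \<in> nodes (Suc n)"
  obtains \<kappa> m a where "\<kappa> \<in> nodes n" "m \<le> n" "a < 2 ^ branching n m"
    "k = \<kappa> * 2 ^ gap n + slot n m a" "label (Suc n) k = m" "k div 2 ^ gap n = \<kappa>"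
proof -
  from assms obtain \<kappa> m a where k: "\<kappa> \<in> nodes n" "m \<le> n" "a < 2 ^ branching n m"
    "k = \<kappa> * 2 ^ gap n + slot n m a" by auto
  moreover have "k div 2 ^ gap n = \<kappa>"
    using slot_half(1)[OF k(2,3)] slot_lt[OF k(2,3)] k(4) by simp
  ultimately show ?thesis using that label_child[OF k(2,3)] by blast
qed

text \<open>Three cases. Children of different parents are separated by the empty right half of a
  parent, different blocks of one parent by an empty half block, and children in one block by
  \<open>spacing\<close>. Only the last case is finer than a half block, and there the labels
  agree.\<close>

lemma separation:
  assumes "k \<in> nodes (Suc n)" "k' \<in> nodes (Suc n)" "k \<noteq> k'"
  shows "int (n + 1) \<le> \<bar>k - k'\<bar>"
    and "label (Suc n) k \<noteq> label (Suc n) k' \<Longrightarrow> half_block n \<le> \<bar>k - k'\<bar>"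
proof -
  obtain \<kappa> m a where k: "\<kappa> \<in> nodes n" "m \<le> n" "a < 2 ^ branching n m"
    "k = \<kappa> * 2 ^ gap n + slot n m a" "label (Suc n) k = m"
    using nodes_SucE[OF assms(1)] by metis
  obtain \<kappa>' m' a' where k': "\<kappa>' \<in> nodes n" "m' \<le> n" "a' < 2 ^ branching n m'"
    "k' = \<kappa>' * 2 ^ gap n + slot n m' a'" "label (Suc n) k' = m'"
    using nodes_SucE[OF assms(2)] by metis
  have hb: "int (n + 1) \<le> half_block n"
  proof -
    have "1 * spacing n m \<le> 2 ^ branching n m * spacing n m"
      using spacing_pos[of n m] by (intro mult_right_mono) auto
    then show ?thesis using spacing_ge(1)[of n m] spacing_branching[of n m] by linarith
  qed
  have gap_le: "2 * half_block n \<le> 2 ^ gap n"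
  proof -
    have "(2::int) ^ 1 \<le> 2 ^ (n + 3)" by (rule power_increasing) auto
    then show ?thesis unfolding pow_gap using half_block_pos[of n] by (intro mult_right_mono) auto
  qed
  have diff_parent: "half_block n \<le> \<bar>k - k'\<bar>" if "\<kappa> \<noteq> \<kappa>'"
  proof -
    have "2 ^ gap n * 1 \<le> 2 ^ gap n * \<bar>\<kappa> - \<kappa>'\<bar>" using that by (intro mult_left_mono) auto
    also have "\<dots> = \<bar>\<kappa> * 2 ^ gap n - \<kappa>' * 2 ^ gap n\<bar>"
      by (simp add: abs_mult left_diff_distrib[symmetric] mult.commute)
    finally have parent: "2 ^ gap n \<le> \<bar>\<kappa> * 2 ^ gap n - \<kappa>' * 2 ^ gap n\<bar>" by simp
    have "H \<le> \<bar>p + x - (p' + x')\<bar>"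
      if "W \<le> \<bar>p - p'\<bar>" "0 \<le> x" "2 * (x + 1) \<le> W" "0 \<le> x'" "2 * (x' + 1) \<le> W" "2 * H \<le> W"
      for p p' x x' W H :: int using that by presburger
    from this[OF parent slot_half[OF k(2,3)] slot_half[OF k'(2,3)] gap_le]
    show ?thesis unfolding k(4) k'(4) .
  qed
  have diff_block: "half_block n \<le> \<bar>k - k'\<bar>" if "m \<noteq> m'"
  proof (cases "\<kappa> = \<kappa>'")
    case True
    have lt: "half_block n \<le> slot n q c - slot n p b"
      if "p < q" "b < 2 ^ branching n p" "c < 2 ^ branching n q" for p q b c
    proof -
      have "2 * (int p + 1 + 1) * half_block n \<le> 2 * (int q + 1) * half_block n"
        using that(1) half_block_pos[of n] by (intro mult_right_mono) auto
      then show ?thesis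
        using slot_bounds(2)[OF that(2)] slot_bounds(1)[OF that(3)] spacing_pos[of n p]
        by (simp add: algebra_simps)
    qed
    from that have "m < m' \<or> m' < m" by linarith
    then show ?thesis using lt[OF _ k(3) k'(3)] lt[OF _ k'(3) k(3)] True unfolding k(4) k'(4) by auto
  qed (use diff_parent in auto)
  show "label (Suc n) k \<noteq> label (Suc n) k' \<Longrightarrow> half_block n \<le> \<bar>k - k'\<bar>"
    using diff_block k(5) k'(5) by simp
  show "int (n + 1) \<le> \<bar>k - k'\<bar>"
  proof (cases "\<kappa> = \<kappa>' \<and> m = m'")
    case True
    then have "a \<noteq> a'" using assms(3) k(4) k'(4) by auto
    have "spacing n m * 1 \<le> spacing n m * \<bar>int a - int a'\<bar>"
      using \<open>a \<noteq> a'\<close> spacing_pos[of n m] by (intro mult_left_mono) auto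
    also have "\<dots> = \<bar>k - k'\<bar>"
      using True spacing_pos[of n m] unfolding k(4) k'(4)
      by (simp add: slot_def abs_mult left_diff_distrib[symmetric] mult.commute)
    finally show ?thesis using spacing_ge(1)[of n m] by linarith
  next
    case False
    then show ?thesis using diff_parent diff_block hb by force
  qed
qed

lemma ereal_expo: "ereal (expo n k) = min (h (label n k)) (ereal (\<eta> + real n))"
proof -
  have "ereal \<eta> \<le> min (h (label n k)) (ereal (\<eta> + real n))" using h_ge by simp
  moreover have "min (h (label n k)) (ereal (\<eta> + real n)) \<le> ereal (\<eta> + real n)" by simp
  ultimately have "\<bar>min (h (label n k)) (ereal (\<eta> + real n))\<bar> \<noteq> \<infinity>"
    by (cases "min (h (label n k)) (ereal (\<eta> + real n))") auto
  then show ?thesis unfolding expo_def by (simp add: ereal_real')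
qed

lemma finite_nodes: "finite (nodes n)"
  by (induction n) auto

text \<open>The left margin 1 / 2^(n + 2) is the relative length of the two half blocks in front of
  label 0.\<close>

sublocale wavelet_tree \<psi> scale nodes expo \<eta> coarseness "\<lambda>n. 1 / 2 ^ (n + 2)"
proof
  show "Defs.schwartz \<psi>" using ortho unfolding orthonormal_wavelet_def by blast
  show "strict_mono scale" by (rule strict_mono_scale)
  show "eventually (\<lambda>n. A * real (scale n) \<le> real (scale (Suc n))) sequentially" for A :: real
  proof -
    have "eventually (\<lambda>n. A \<le> real n) sequentially" by real_asymp
    then show ?thesis
    proof eventually_elim
      case (elim n)
      have "A * real (scale n) \<le> real (n + 4) * real (scale n + n + 4)"
        using elim by (intro mult_mono) auto
      then show ?case by (simp only: scale.simps of_nat_mult)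
    qed
  qed
  show "finite (nodes n)" for n by (rule finite_nodes)
  show "0 < \<eta>" by (rule eta)
  show "\<eta> \<le> expo n k" for n k
  proof -
    have "ereal \<eta> \<le> ereal (expo n k)" unfolding ereal_expo using h_ge by simp
    then show ?thesis by simp
  qed
  show "real n \<le> \<bar>real_of_int k - real_of_int k'\<bar>" if "k \<in> nodes n" "k' \<in> nodes n" "k \<noteq> k'" for k n k'
  proof (cases n)
    case (Suc n')
    have "int n \<le> \<bar>k - k'\<bar>" using separation(1)[of k n' k'] that unfolding Suc by simp
    then have "real_of_int (int n) \<le> real_of_int \<bar>k - k'\<bar>" by (simp only: of_int_le_iff)
    then show ?thesis by simp
  qed (use that in auto)
  show "2 powr (real (scale n) - coarseness n) \<le> \<bar>real_of_int k - real_of_int k'\<bar>"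
    if "k \<in> nodes n" "k' \<in> nodes n" "expo n k \<noteq> expo n k'" for k n k'
  proof (cases n)
    case (Suc n')
    have "label n k \<noteq> label n k'" using that(3) by (auto simp: expo_def)
    moreover have "k \<noteq> k'" using that(3) by auto
    ultimately have "half_block n' \<le> \<bar>k - k'\<bar>" using that(1,2) unfolding Suc by (intro separation(2))
    then have "real_of_int (half_block n') \<le> real_of_int \<bar>k - k'\<bar>" by (simp only: of_int_le_iff)
    moreover have "real (scale n) - coarseness n = real (gap n' - (n' + 3))"
      using gap_ge[of n'] unfolding Suc coarseness_def scale_Suc by (simp add: of_nat_diff)
    ultimately show ?thesis by (simp add: powr_realpow half_block_def del: of_nat_diff)
  qed (use that in auto)
  show "0 \<le> coarseness n" for n by (simp add: coarseness_def split: nat.splits)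
  show "eventually (\<lambda>n. coarseness n \<le> \<epsilon> * real (scale n)) sequentially" if "\<epsilon> > 0" for \<epsilon>
  proof (subst eventually_sequentially_Suc[symmetric])
    have "eventually (\<lambda>n. 1 \<le> \<epsilon> * real (n + 4)) sequentially" using that by real_asymp
    then show "eventually (\<lambda>n. coarseness (Suc n) \<le> \<epsilon> * real (scale (Suc n))) sequentially"
    proof eventually_elim
      case (elim n)
      have "1 * real (scale n + n + 4) \<le> (\<epsilon> * real (n + 4)) * real (scale n + n + 4)"
        using elim by (intro mult_right_mono) auto
      also have "\<dots> = \<epsilon> * real (scale (Suc n))" by (simp only: scale.simps of_nat_mult mult.assoc)
      finally show ?case by (simp add: coarseness_def)
    qed
  qed
  show "orthonormal_wavelet \<psi>" by (rule ortho)
  show "scale 0 = 0" "nodes 0 = {0}" by simp_all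
  show "0 < 1 / (2::real) ^ (n + 2)" for n by simp
  show "\<exists>\<kappa>\<in>nodes n. (real_of_int \<kappa> + 1 / 2 ^ (n + 2)) / 2 ^ scale n \<le> real_of_int k / 2 ^ scale (Suc n) \<and>
      (real_of_int k + 1) / 2 ^ scale (Suc n) \<le> (real_of_int \<kappa> + 1 / 2) / 2 ^ scale n"
    if kn: "k \<in> nodes (Suc n)" for k n
  proof -
    obtain \<kappa> m a where k: "\<kappa> \<in> nodes n" "m \<le> n" "a < 2 ^ branching n m"
      "k = \<kappa> * 2 ^ gap n + slot n m a"
      using nodes_SucE[OF kn] by metis
    define W :: real where "W = 2 ^ gap n"
    have W: "W > 0" by (simp add: W_def)
    have WJ: "(2::real) ^ scale (Suc n) = 2 ^ scale n * W" unfolding scale_Suc W_def power_add ..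
    have Wh: "W = 2 ^ (n + 3) * real_of_int (half_block n)"
      unfolding W_def using arg_cong[OF pow_gap, of real_of_int n] by simp
    have kr: "real_of_int k = real_of_int \<kappa> * W + real_of_int (slot n m a)"
      unfolding k(4) W_def by simp
    have "2 * half_block n \<le> 2 * (int m + 1) * half_block n"
      using half_block_pos[of n] by (intro mult_right_mono) auto
    then have "2 * half_block n \<le> slot n m a" using slot_bounds(1)[OF k(3)] by (rule order_trans)
    then have "real_of_int (2 * half_block n) \<le> real_of_int (slot n m a)" by (simp only: of_int_le_iff)
    moreover have "real_of_int (2 * half_block n) = W / 2 ^ (n + 2)" by (simp add: Wh power_add)
    ultimately have 1: "(real_of_int \<kappa> + 1 / 2 ^ (n + 2)) * W \<le> real_of_int k"
      unfolding kr by (simp add: algebra_simps)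
    have "real_of_int (2 * (slot n m a + 1)) \<le> real_of_int (2 ^ gap n)"
      using slot_half(2)[OF k(2,3)] by (simp only: of_int_le_iff)
    then have 2: "real_of_int k + 1 \<le> (real_of_int \<kappa> + 1 / 2) * W"
      unfolding kr W_def by (simp add: algebra_simps)
    have "(real_of_int \<kappa> + 1 / 2 ^ (n + 2)) / 2 ^ scale n = ((real_of_int \<kappa> + 1 / 2 ^ (n + 2)) * W) / 2 ^ scale (Suc n)"
      unfolding WJ using W by simp
    moreover have "(real_of_int \<kappa> + 1 / 2) / 2 ^ scale n = ((real_of_int \<kappa> + 1 / 2) * W) / 2 ^ scale (Suc n)"
      unfolding WJ using W by simp
    ultimately show ?thesis using k(1) 1 2 by (auto intro!: bexI[of _ \<kappa>] divide_right_mono)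
  qed
qed

section \<open>Exponents and counting along the branches\<close>

lemma node_parent: "node n z = node (Suc n) z div 2 ^ gap n"
proof -
  have "2 ^ scale (Suc n) * z = 2 ^ gap n * (2 ^ scale n * z)" by (simp add: scale_Suc power_add)
  then have "node (Suc n) z div 2 ^ gap n = \<lfloor>2 ^ gap n * (2 ^ scale n * z)\<rfloor> div 2 ^ gap n"
    unfolding node_def by (simp only:)
  also have "\<dots> = \<lfloor>(2 ^ gap n * (2 ^ scale n * z)) / real_of_int (2 ^ gap n)\<rfloor>"
    by (rule floor_divide_real_eq_div[symmetric]) simp
  finally show ?thesis by (simp add: node_def)
qed

lemma node_ancestor:
  assumes "node (n + i) z \<in> nodes (n + i)"
  shows "node n z \<in> nodes n"
  using assms
proof (induction i)
  case (Suc i)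
  then have "node (Suc (n + i)) z \<in> nodes (Suc (n + i))" by simp
  then have "node (n + i) z \<in> nodes (n + i)"
    unfolding node_parent[of "n + i" z] by (elim nodes_SucE) simp
  then show ?case by (rule Suc.IH)
qed simp

text \<open>The truncation level tends to infinity, so it is invisible to the lower limit, even when
  that is infinite.\<close>

lemma liminf_expo:
  fixes L :: "nat \<Rightarrow> ereal"
  shows "liminf (\<lambda>n. min (L n) (ereal (\<eta> + real n))) = liminf L"
proof (rule antisym)
  show "liminf (\<lambda>n. min (L n) (ereal (\<eta> + real n))) \<le> liminf L"
    by (intro Liminf_mono always_eventually) auto
  show "liminf L \<le> liminf (\<lambda>n. min (L n) (ereal (\<eta> + real n)))"
  proof (subst le_Liminf_iff, intro allI impI)
    fix y assume y: "y < liminf L"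
    have "eventually (\<lambda>n. y < ereal (\<eta> + real n)) sequentially"
    proof -
      have "y \<noteq> \<infinity>" using y by auto
      then obtain r where r: "y \<le> ereal r" by (cases y) auto
      have "eventually (\<lambda>n. r < \<eta> + real n) sequentially" by real_asymp
      then show ?thesis by eventually_elim (use r in \<open>auto intro: le_less_trans\<close>)
    qed
    with less_LiminfD[OF y] show "eventually (\<lambda>n. y < min (L n) (ereal (\<eta> + real n))) sequentially"
      by eventually_elim simp
  qed
qed

lemma hoelder_exp_label: "x \<in> K \<Longrightarrow> hoelder_exp F x = liminf (\<lambda>n. h (label n (node n x)))"
  unfolding hoelder_exp_eq_liminf E_def ereal_expo liminf_expo ..

lemma nodes_subset: "nodes n \<subseteq> {0..<2 ^ scale n}"
proof (induction n)
  case (Suc n)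
  show ?case
  proof
    fix k assume "k \<in> nodes (Suc n)"
    then obtain \<kappa> m a where k: "\<kappa> \<in> nodes n" "m \<le> n" "a < 2 ^ branching n m"
      "k = \<kappa> * 2 ^ gap n + slot n m a"
      using nodes_SucE by metis
    have \<kappa>: "0 \<le> \<kappa>" "\<kappa> + 1 \<le> 2 ^ scale n" using Suc.IH k(1) by auto
    have "(\<kappa> + 1) * 2 ^ gap n \<le> 2 ^ scale n * 2 ^ gap n" using \<kappa>(2) by (intro mult_right_mono) auto
    then show "k \<in> {0..<2 ^ scale (Suc n)}"
      using slot_half(1)[OF k(2,3)] slot_lt[OF k(2,3)] \<kappa>(1) unfolding k(4) scale_Suc
      by (simp add: power_add algebra_simps)
  qed
qed simp

text \<open>Only the last label is restricted. The ancestors are counted crudely by all integers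
  below 2^(\<open>scale n\<close>), whatever their labels; this costs little because the next scale
  is so much larger.\<close>

lemma card_low_nodes:
  "card {k \<in> nodes (Suc n). s (label (Suc n) k) < \<sigma>} \<le> 2 ^ scale n * (real (n + 1) * 2 powr (\<sigma> * real ((n + 2) * (scale n + n + 4))))"
proof -
  let ?I = "{m. m \<le> n \<and> s m < \<sigma>}"
  let ?f = "\<lambda>k m a. k * 2 ^ gap n + slot n m a"
  have "{k \<in> nodes (Suc n). s (label (Suc n) k) < \<sigma>}
      \<subseteq> (\<Union>k\<in>nodes n. \<Union>m\<in>?I. ?f k m ` {..<2 ^ branching n m})"
  proof
    fix k assume "k \<in> {k \<in> nodes (Suc n). s (label (Suc n) k) < \<sigma>}"
    then have k: "k \<in> nodes (Suc n)" "s (label (Suc n) k) < \<sigma>" by blast+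
    obtain \<kappa> m a where \<kappa>: "\<kappa> \<in> nodes n" "m \<le> n" "a < 2 ^ branching n m"
      "k = \<kappa> * 2 ^ gap n + slot n m a" "label (Suc n) k = m"
      using k(1) by (rule nodes_SucE)
    show "k \<in> (\<Union>k\<in>nodes n. \<Union>m\<in>?I. ?f k m ` {..<2 ^ branching n m})"
    proof (intro UN_I)
      show "m \<in> ?I" using \<kappa>(2,5) k(2) by simp
      show "k \<in> ?f \<kappa> m ` {..<2 ^ branching n m}" using \<kappa>(3,4) by simp
    qed (rule \<kappa>(1))
  qed
  then have "card {k \<in> nodes (Suc n). s (label (Suc n) k) < \<sigma>}
      \<le> card (\<Union>k\<in>nodes n. \<Union>m\<in>?I. ?f k m ` {..<2 ^ branching n m})"
    by (intro card_mono finite_UN_I finite_nodes) auto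
  also have "\<dots> \<le> (\<Sum>k\<in>nodes n. card (\<Union>m\<in>?I. ?f k m ` {..<2 ^ branching n m}))"
    by (rule card_UN_le) (rule finite_nodes)
  also have "\<dots> \<le> (\<Sum>k\<in>nodes n. \<Sum>m\<in>?I. card (?f k m ` {..<2 ^ branching n m}))"
    by (intro sum_mono card_UN_le) auto
  also have "\<dots> \<le> (\<Sum>k\<in>nodes n. \<Sum>m\<in>?I. 2 ^ branching n m)"
  proof (intro sum_mono)
    fix k m
    have "card (?f k m ` {..<2 ^ branching n m}) \<le> card {..<(2::nat) ^ branching n m}" by (rule card_image_le) simp
    then show "card (?f k m ` {..<2 ^ branching n m}) \<le> 2 ^ branching n m" by simp
  qed
  finally have "real (card {k \<in> nodes (Suc n). s (label (Suc n) k) < \<sigma>})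
      \<le> real (\<Sum>k\<in>nodes n. \<Sum>m\<in>?I. 2 ^ branching n m)" by (simp only: of_nat_le_iff)
  also have "\<dots> = real (card (nodes n)) * (\<Sum>m\<in>?I. 2 ^ branching n m)" by simp
  also have "\<dots> \<le> 2 ^ scale n * (real (n + 1) * 2 powr (\<sigma> * real ((n + 2) * (scale n + n + 4))))"
  proof (intro mult_mono)
    have "card (nodes n) \<le> card {0..<(2::int) ^ scale n}" using nodes_subset by (intro card_mono) auto
    then have "card (nodes n) \<le> 2 ^ scale n" by (simp add: nat_power_eq)
    then show "real (card (nodes n)) \<le> 2 ^ scale n" by (metis of_nat_le_iff of_nat_numeral of_nat_power)
    have "(\<Sum>m\<in>?I. 2 ^ branching n m) \<le> (\<Sum>m\<in>?I. 2 powr (\<sigma> * real ((n + 2) * (scale n + n + 4))))"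
    proof (intro sum_mono)
      fix m assume m: "m \<in> ?I"
      have "real (branching n m) \<le> \<sigma> * real ((n + 2) * (scale n + n + 4))"
        by (rule order_trans[OF branching_le]) (use m in \<open>intro mult_right_mono, auto\<close>)
      then have "2 powr real (branching n m) \<le> 2 powr (\<sigma> * real ((n + 2) * (scale n + n + 4)))" by simp
      then show "2 ^ branching n m \<le> 2 powr (\<sigma> * real ((n + 2) * (scale n + n + 4)))"
        by (simp add: powr_realpow)
    qed
    also have "\<dots> = real (card ?I) * 2 powr (\<sigma> * real ((n + 2) * (scale n + n + 4)))" by simp
    also have "\<dots> \<le> real (n + 1) * 2 powr (\<sigma> * real ((n + 2) * (scale n + n + 4)))"
    proof (intro mult_right_mono)
      have "card ?I \<le> card {..n}" by (intro card_mono) auto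
      then show "real (card ?I) \<le> real (n + 1)" by simp
    qed simp
    finally show "(\<Sum>m\<in>?I. 2 ^ branching n m) \<le> real (n + 1) * 2 powr (\<sigma> * real ((n + 2) * (scale n + n + 4)))" .
  qed (auto intro: sum_nonneg)
  finally show ?thesis .
qed

text \<open>Since one generation with a small last label already gives an economical cover,
  smallness of \<open>s\<close> along infinitely many levels suffices; it need not hold
  eventually.\<close>

lemma dim_upper:
  assumes v: "0 \<le> v" and A: "A \<subseteq> K"
    and freq: "\<And>x \<sigma>. x \<in> A \<Longrightarrow> v < \<sigma> \<Longrightarrow> frequently (\<lambda>n. s (label n (node n x)) < \<sigma>) sequentially"
  shows "dim_H A \<le> ereal v"
proof (rule dim_H_le[OF v])
  fix t assume t: "v < t"
  define \<sigma> where "\<sigma> = (v + t) / 2"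
  have \<sigma>: "v < \<sigma>" "\<sigma> < t" "0 < \<sigma>" using t v by (auto simp: \<sigma>_def)
  define T where "T n = {k \<in> nodes n. s (label n k) < \<sigma>}" for n
  show "hausdorff_measure t A = 0"
  proof (rule hausdorff_measure_limsup_eq_0)
    show "0 < t" using t v by simp
    show "finite (T n)" for n by (simp add: T_def finite_nodes)
    show "n \<le> scale n" for n by (rule J_ge)
    show "A \<subseteq> {x. frequently (\<lambda>n. \<lfloor>2 ^ scale n * x\<rfloor> \<in> T n) sequentially}"
    proof
      fix x assume x: "x \<in> A"
      have "frequently (\<lambda>n. node n x \<in> T n) sequentially"
        using freq[OF x \<sigma>(1)] by (rule frequently_elim1) (use x A in \<open>auto simp: T_def K_def\<close>)
      then show "x \<in> {x. frequently (\<lambda>n. \<lfloor>2 ^ scale n * x\<rfloor> \<in> T n) sequentially}" by (simp add: node_def)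
    qed
    show "summable (\<lambda>n. real (card (T n)) * 2 powr (- (t * real (scale n))))"
    proof (subst summable_Suc_iff[symmetric], rule summable_comparison_test_ev)
      \<comment> \<open>With X = \<open>scale n + n + 4\<close>, the excess of t over \<sigma> then
        gains 2 X in the exponent, against a loss of X + n from ancestors and number of labels. As X
        \<ge> 2 n, a factor 2^(-n) remains.\<close>
      have "eventually (\<lambda>n. 2 \<le> (t - \<sigma>) * real (n + 4)) sequentially" using \<sigma> by real_asymp
      then show "eventually (\<lambda>n. norm (real (card (T (Suc n))) * 2 powr (- (t * real (scale (Suc n))))) \<le> (1/2) ^ n) sequentially"
      proof eventually_elim
        case (elim n)
        let ?X = "real (scale n + n + 4)"
        have "real (card (T (Suc n))) * 2 powr (- (t * real (scale (Suc n))))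
            \<le> (2 ^ scale n * (real (n + 1) * 2 powr (\<sigma> * real ((n + 2) * (scale n + n + 4))))) * 2 powr (- (t * real (scale (Suc n))))"
          unfolding T_def by (intro mult_right_mono card_low_nodes) auto
        also have "\<dots> \<le> (2 powr ?X * (2 powr real n * 2 powr (\<sigma> * (real (n + 4) * ?X)))) * 2 powr (- (t * (real (n + 4) * ?X)))"
        proof (intro mult_mono)
          show "(2::real) ^ scale n \<le> 2 powr ?X" by (simp add: powr_realpow[symmetric])
          have "n + 1 \<le> 2 ^ n" unfolding Suc_eq_plus1[symmetric] by (rule Suc_leI) (rule less_exp)
          then have "real (n + 1) \<le> 2 ^ n" by (metis of_nat_le_iff of_nat_numeral of_nat_power)
          then show "real (n + 1) \<le> 2 powr real n" by (simp add: powr_realpow)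
          show "2 powr (\<sigma> * real ((n + 2) * (scale n + n + 4))) \<le> 2 powr (\<sigma> * (real (n + 4) * ?X))"
            using \<sigma>(3) unfolding of_nat_mult by (intro powr_mono mult_left_mono mult_right_mono) auto
          show "2 powr - (t * real (scale (Suc n))) \<le> 2 powr - (t * (real (n + 4) * ?X))"
            by (simp only: scale.simps of_nat_mult order_refl)
        qed auto
        also have "\<dots> = 2 powr (?X + real n - ((t - \<sigma>) * real (n + 4)) * ?X)"
          by (simp add: powr_add[symmetric] powr_diff[symmetric] algebra_simps)
        also have "\<dots> \<le> 2 powr (- real n)"
        proof (rule powr_mono)
          have "2 * ?X \<le> ((t - \<sigma>) * real (n + 4)) * ?X" using elim by (intro mult_right_mono) auto
          moreover have "2 * real n \<le> ?X + real n" by simp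
          moreover have "scale n \<ge> n" by (rule J_ge)
          ultimately show "?X + real n - ((t - \<sigma>) * real (n + 4)) * ?X \<le> - real n" by simp
        qed simp
        also have "\<dots> = (1/2) ^ n" by (simp add: powr_minus powr_realpow power_divide inverse_eq_divide)
        finally show ?case by simp
      qed
      show "summable (\<lambda>n. (1/2::real) ^ n)" by (rule summable_geometric) simp
    qed
  qed
qed

text \<open>Below \<open>k0\<close> the whole block with label \<open>m n\<close> is kept at each
  level n, and the resulting points are parametrised by \<open>mixed_radix_cantor\<close>. Any set
  \<open>Z\<close> containing them is allowed, so that level sets intersected with balls can be
  inserted directly.\<close>

lemma dim_lower:
  assumes k0: "k0 \<in> nodes n0" and m: "\<And>n. m n \<le> n" and lim: "(\<lambda>n. s (m n)) \<longlonglongrightarrow> v"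
    and Z: "\<And>z. z \<in> K \<Longrightarrow> node n0 z = k0 \<Longrightarrow> (\<And>n. n0 \<le> n \<Longrightarrow> label (Suc n) (node (Suc n) z) = m n) \<Longrightarrow> z \<in> Z"
  shows "Z \<noteq> {}" "ereal v \<le> dim_H Z"
proof -
  define N :: "nat \<Rightarrow> nat" where "N i = 2 ^ branching (n0 + i) (m (n0 + i))" for i
  define off where "off i = 2 * (int (m (n0 + i)) + 1) * half_block (n0 + i)" for i
  define S where "S i = spacing (n0 + i) (m (n0 + i))" for i
  interpret C: mixed_radix_cantor "\<lambda>i. scale (n0 + i)" N off S k0
  proof
    show "strict_mono (\<lambda>i. scale (n0 + i))"
      using strict_mono_scale by (simp add: strict_mono_def)
    show "1 \<le> N i" for i by (simp add: N_def)
    show "2 \<le> S i" for i unfolding S_def by (rule spacing_ge)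
    show "0 \<le> off i" for i using half_block_pos[of "n0 + i"] by (simp add: off_def)
    show "2 * (off i + int (N i) * S i) \<le> 2 ^ (scale (n0 + Suc i) - scale (n0 + i))" for i
      using block_in_half[OF m[of "n0 + i"]] spacing_branching[of "n0 + i" "m (n0 + i)"]
      by (simp add: off_def N_def S_def gap_def)
  qed
  have kap_Suc: "\<exists>a < 2 ^ branching (n0 + i) (m (n0 + i)).
      C.kap y (Suc i) = C.kap y i * 2 ^ gap (n0 + i) + slot (n0 + i) (m (n0 + i)) a" for y i
  proof (intro exI conjI)
    show "nat (C.digit i y) < 2 ^ branching (n0 + i) (m (n0 + i))"
      using C.digit_bounds[of i y] by (simp add: N_def nat_less_iff)
    show "C.kap y (Suc i) = C.kap y i * 2 ^ gap (n0 + i) + slot (n0 + i) (m (n0 + i)) (nat (C.digit i y))"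
      using C.digit_bounds(1)[of i y] by (simp add: slot_def off_def S_def gap_def)
  qed
  have kap_node: "C.kap y i \<in> nodes (n0 + i)" for y i
  proof (induction i)
    case 0
    then show ?case using k0 by simp
  next
    case (Suc i)
    obtain a where a: "a < 2 ^ branching (n0 + i) (m (n0 + i))"
      "C.kap y (Suc i) = C.kap y i * 2 ^ gap (n0 + i) + slot (n0 + i) (m (n0 + i)) a"
      using kap_Suc by blast
    show ?case unfolding add_Suc_right nodes.simps a(2)
      using Suc m[of "n0 + i"] a(1) by (intro UN_I[of "C.kap y i"] UN_I[of "m (n0 + i)"]) auto
  qed
  have node_pt: "node (n0 + i) (C.pt y) = C.kap y i" for y i
    unfolding node_def by (rule C.floor_pt)
  have pt_Z: "C.pt y \<in> Z" for y
  proof (rule Z)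
    show "C.pt y \<in> K"
      unfolding K_def
    proof (intro CollectI allI)
      fix n
      have "node (n0 + n) (C.pt y) \<in> nodes (n0 + n)" unfolding node_pt by (rule kap_node)
      then show "node n (C.pt y) \<in> nodes n" using node_ancestor[of n n0] by (simp add: add.commute)
    qed
    show "node n0 (C.pt y) = k0" using node_pt[of 0 y] by simp
    fix n assume "n0 \<le> n"
    then obtain i where i: "n = n0 + i" using le_Suc_ex by blast
    obtain a where a: "a < 2 ^ branching (n0 + i) (m (n0 + i))"
      "C.kap y (Suc i) = C.kap y i * 2 ^ gap (n0 + i) + slot (n0 + i) (m (n0 + i)) a"
      using kap_Suc by blast
    have "node (Suc n) (C.pt y) = C.kap y (Suc i)" using node_pt[of "Suc i" y] by (simp add: i)
    then show "label (Suc n) (node (Suc n) (C.pt y)) = m n"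
      unfolding a(2) i using label_child[OF m a(1)] by simp
  qed
  then show ne: "Z \<noteq> {}" by blast
  show "ereal v \<le> dim_H Z"
  proof (rule le_dim_H[OF ne])
    fix t assume t: "0 < t" "t < v"
    have "v \<le> 1" by (rule LIMSEQ_le_const2[OF lim]) (use s in auto)
    then have t1: "t \<le> 1" using t by simp
    \<comment> \<open>A block fills 1 / 2^(n + 3) of its parent, and one more factor 2 matches the
      one in the hypothesis on sizes, which then holds with equality.\<close>
    define w where "w i = (2::real) ^ (n0 + i + 4)" for i
    \<comment> \<open>The last factor \<open>N i\<close> of \<open>Q (Suc i)\<close> suffices. With
      n = n0 + i and X = \<open>scale n + n + 4\<close>, its exponent is about
      \<open>s (m n)\<close> * (n + 2) * X, while t * ((n + 4) * X + n + 5) + 1 is required; this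
      holds eventually because \<open>s (m n)\<close> stays above some \<sigma> > t.\<close>
    have "eventually (\<lambda>i. 2 * (2 ^ scale (n0 + i) * w i) powr t \<le> real (C.Q i)) sequentially"
    proof (subst eventually_sequentially_Suc[symmetric])
      define \<sigma> where "\<sigma> = (t + v) / 2"
      have \<sigma>: "t < \<sigma>" "\<sigma> < v" using t by (auto simp: \<sigma>_def)
      have "eventually (\<lambda>n. \<sigma> < s (m n) \<and> t * (real n + 5) + 2 \<le> (\<sigma> * (real n + 2) - t * (real n + 4)) * (real n + 4)
          \<and> 0 \<le> \<sigma> * (real n + 2) - t * (real n + 4)) sequentially"
      proof (intro eventually_conj)
        show "eventually (\<lambda>n. \<sigma> < s (m n)) sequentially" using order_tendstoD(1)[OF lim \<sigma>(2)] .
        define \<tau> where "\<tau> = \<sigma> - t"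
        have \<tau>: "0 < \<tau>" "\<sigma> = t + \<tau>" using \<sigma> by (auto simp: \<tau>_def)
        show "eventually (\<lambda>n. t * (real n + 5) + 2 \<le> (\<sigma> * (real n + 2) - t * (real n + 4)) * (real n + 4)) sequentially"
          unfolding \<tau>(2) using \<tau>(1) t(1) by real_asymp
        show "eventually (\<lambda>n. 0 \<le> \<sigma> * (real n + 2) - t * (real n + 4)) sequentially"
          unfolding \<tau>(2) using \<tau>(1) t(1) by real_asymp
      qed
      then have "eventually (\<lambda>i. \<sigma> < s (m (i + n0)) \<and> t * (real (i + n0) + 5) + 2 \<le> (\<sigma> * (real (i + n0) + 2) - t * (real (i + n0) + 4)) * (real (i + n0) + 4)
          \<and> 0 \<le> \<sigma> * (real (i + n0) + 2) - t * (real (i + n0) + 4)) sequentially"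
        by (rule sequentially_offset)
      then show "eventually (\<lambda>i. 2 * (2 ^ scale (n0 + Suc i) * w (Suc i)) powr t \<le> real (C.Q (Suc i))) sequentially"
      proof eventually_elim
        case (elim i)
        define n where "n = n0 + i"
        define X where "X = real (scale n + n + 4)"
        have e: "\<sigma> < s (m n)" "t * (real n + 5) + 2 \<le> (\<sigma> * (real n + 2) - t * (real n + 4)) * (real n + 4)"
          "0 \<le> \<sigma> * (real n + 2) - t * (real n + 4)"
          using elim by (simp_all add: n_def add.commute)
        have "(\<sigma> * (real n + 2) - t * (real n + 4)) * (real n + 4) \<le> (\<sigma> * (real n + 2) - t * (real n + 4)) * X"
          using e(3) by (intro mult_left_mono) (auto simp: X_def)
        then have "t * ((real n + 4) * X + real n + 5) + 2 \<le> \<sigma> * ((real n + 2) * X)"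
          using e(2) by (simp add: algebra_simps)
        also have "\<dots> \<le> s (m n) * ((real n + 2) * X)"
          using e(1) by (intro mult_right_mono) (auto simp: X_def)
        also have "\<dots> = s (m n) * real ((n + 2) * (scale n + n + 4))"
          unfolding X_def of_nat_mult by simp
        also have "\<dots> \<le> real (branching n (m n)) + 1" using branching_ge[of "m n" n] by simp
        finally have "1 + t * ((real n + 4) * X + real n + 5) \<le> real (branching n (m n))" by simp
        then have "2 powr (1 + t * ((real n + 4) * X + real n + 5)) \<le> 2 powr (real (branching n (m n)))" by simp
        moreover have "2 * (2 ^ scale (n0 + Suc i) * w (Suc i)) powr t = 2 powr (1 + t * ((real n + 4) * X + real n + 5))"
        proof -
          have "real (scale (Suc n)) = (real n + 4) * X" by (simp add: X_def scale.simps)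
          then have "2 ^ scale (n0 + Suc i) * w (Suc i) = 2 powr ((real n + 4) * X + real n + 5)"
            unfolding w_def by (simp add: n_def powr_J[symmetric] powr_realpow[symmetric] add_ac flip: powr_add)
          moreover have "2 * (2 powr Y) powr t = 2 powr (1 + t * Y)" for Y :: real
            by (simp add: powr_powr powr_add mult.commute)
          ultimately show ?thesis by (simp only:)
        qed
        moreover have "2 powr (real (branching n (m n))) \<le> real (C.Q (Suc i))"
        proof -
          have "1 * N i \<le> C.Q i * N i" using C.Q_pos[of i] by (intro mult_right_mono) auto
          then have "N i \<le> C.Q (Suc i)" by (simp add: C.Q_def)
          then have "real (N i) \<le> real (C.Q (Suc i))" by simp
          then show ?thesis by (simp add: N_def n_def powr_realpow)
        qed
        ultimately show ?case by linarith
      qed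
    qed
    then obtain c where c: "\<And>i. 2 * (2 ^ scale (n0 + i) * w i) powr t \<le> c * real (C.Q i)"
      by (rule eventually_le_imp_bounded_ratio[OF _ C.Q_pos]) blast
    have size: "2 * 2 ^ scale (n0 + Suc i) \<le> real (N i) * S i * (2 ^ scale (n0 + i) * w i)" for i
    proof -
      define n where "n = n0 + i"
      have "real (N i) * S i = real_of_int (half_block n)"
        using arg_cong[OF spacing_branching[of n "m n"], of real_of_int] by (simp add: N_def S_def n_def)
      moreover have "2 * (2::real) ^ scale (Suc n) = real_of_int (half_block n) * (2 ^ scale n * 2 ^ (n + 4))"
        unfolding scale_Suc power_add[of _ "scale n"]
        using arg_cong[OF pow_gap[of n], of real_of_int] by (simp add: power_add)
      ultimately show ?thesis by (simp add: w_def n_def)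
    qed
    have "0 < 2 * (2 ^ scale (n0 + 0) * w 0) powr t" by (simp add: w_def)
    then have "0 < c * real (C.Q 0)" using c[of 0] by linarith
    then have c0: "0 < c" using C.Q_pos[of 0] by (simp add: zero_less_mult_iff)
    show "hausdorff_measure t Z \<noteq> 0"
    proof (rule hausdorff_measure_nonzero[OF c0 pt_Z])
      fix y y' :: real assume y: "y \<in> {0..<1}" "y' \<in> {0..<1}"
      have "\<bar>y - y'\<bar> \<le> c * \<bar>C.pt y - C.pt y'\<bar> powr t"
        by (rule C.pt_inverse_hoelder[OF t(1) t1 _ size c y]) (simp add: w_def)
      then show "\<bar>y - y'\<bar> \<le> c * (if t = 0 then 1 else \<bar>C.pt y - C.pt y'\<bar> powr t)" using t(1) by simp
    qed (use t in auto)
  qed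
qed

end

text \<open>The indices are slowed down to satisfy \<open>m n \<le> n\<close>, since only the labels up to \<open>n\<close> are used at level \<open>n\<close>.\<close>
lemma dense_enumeration:
  fixes G :: "'a :: second_countable_topology set"
  assumes "G \<noteq> {}"
  obtains p :: "nat \<Rightarrow> 'a" where "range p \<subseteq> G"
    "\<And>g. g \<in> G \<Longrightarrow> \<exists>m. (\<forall>n. m n \<le> n) \<and> (\<lambda>n. p (m n)) \<longlonglongrightarrow> g"
proof -
  obtain B :: "'a set set" where B: "countable B" "topological_basis B"
    using ex_countable_basis by blast
  \<comment> \<open>One point of \<open>G\<close> from each basic open set that meets
    \<open>G\<close>.\<close>
  define T where "T = (\<lambda>b. SOME x. x \<in> b \<inter> G) ` {b \<in> B. b \<inter> G \<noteq> {}}"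
  have T: "countable T" unfolding T_def
    by (intro countable_image countable_subset[OF _ B(1)]) blast
  have some: "(SOME x. x \<in> b \<inter> G) \<in> b \<inter> G" if "b \<inter> G \<noteq> {}" for b
    by (rule someI_ex) (use that in blast)
  have TG: "T \<subseteq> G"
  proof
    fix x assume "x \<in> T"
    then obtain b where "b \<inter> G \<noteq> {}" "x = (SOME x. x \<in> b \<inter> G)" unfolding T_def by blast
    then show "x \<in> G" using some[of b] by simp
  qed
  have dense: "G \<subseteq> closure T"
  proof
    fix g assume g: "g \<in> G"
    show "g \<in> closure T"
      unfolding closure_iff_nhds_not_empty
    proof (intro allI impI)
      fix A U assume "U \<subseteq> A" "open U" "g \<in> U"
      obtain b where b: "b \<in> B" "g \<in> b" "b \<subseteq> U"
        using topological_basisE[OF B(2) \<open>open U\<close> \<open>g \<in> U\<close>] .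
      have ne: "b \<inter> G \<noteq> {}" using g b(2) by blast
      have "(SOME x. x \<in> b \<inter> G) \<in> T" unfolding T_def using b(1) ne by (intro imageI) simp
      moreover have "(SOME x. x \<in> b \<inter> G) \<in> A" using some[OF ne] b(3) \<open>U \<subseteq> A\<close> by blast
      ultimately show "T \<inter> A \<noteq> {}" by blast
    qed
  qed
  have "T \<noteq> {}"
  proof
    assume "T = {}"
    then show False using dense assms by simp
  qed
  define p where "p = from_nat_into T"
  have p: "range p = T" unfolding p_def by (rule range_from_nat_into[OF \<open>T \<noteq> {}\<close> T])
  show ?thesis
  proof (rule that)
    show "range p \<subseteq> G" using p TG by simp
    fix g assume "g \<in> G"
    then have "g \<in> closure T" using dense by (rule subsetD[rotated])
    then obtain y where y: "\<And>k. y k \<in> T" "y \<longlonglongrightarrow> g" unfolding closure_sequential by blast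
    have "\<exists>k. p k = y i" for i
    proof -
      have "y i \<in> range p" using y(1) p by simp
      then show ?thesis by (auto simp: image_iff)
    qed
    then obtain m' where m': "\<And>k. p (m' k) = y k" by metis
    \<comment> \<open>\<open>M k\<close> dominates both k and the index of the k-th approximant.
      With \<kappa> n the last k such that M k \<le> n, the index used at time n is at most M
      (\<kappa> n) \<le> n; repeating approximants does not change the limit because \<kappa> tends
      to infinity.\<close>
    define M where "M k = k + (\<Sum>i\<le>k. m' i)" for k
    have M: "k \<le> M k" "m' k \<le> M k" for k
    proof -
      have "m' k \<le> (\<Sum>i\<le>k. m' i)" by (intro member_le_sum) auto
      then show "k \<le> M k" "m' k \<le> M k" by (auto simp: M_def)
    qed
    define \<kappa> where "\<kappa> n = (GREATEST k. M k \<le> n)" for n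
    have bounded: "\<forall>k. M k \<le> n \<longrightarrow> k \<le> n" for n using M(1) le_trans by blast
    have ex: "M (\<kappa> n) \<le> n" if "M k \<le> n" for k n
      unfolding \<kappa>_def by (rule GreatestI_nat[where P = "\<lambda>k. M k \<le> n" and b = n, OF that]) (use bounded in simp)
    have ge: "k \<le> \<kappa> n" if "M k \<le> n" for k n
      unfolding \<kappa>_def by (rule Greatest_le_nat[where P = "\<lambda>k. M k \<le> n" and b = n, OF that]) (use bounded in simp)
    define m where "m n = (if M 0 \<le> n then m' (\<kappa> n) else 0)" for n
    have "m n \<le> n" for n using ex[of 0 n] M(2)[of "\<kappa> n"] by (auto simp: m_def)
    moreover have "(\<lambda>n. p (m n)) \<longlonglongrightarrow> g"
    proof -
      have "filterlim \<kappa> at_top sequentially"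
        unfolding filterlim_at_top eventually_sequentially by (intro allI exI[of _ "M _"] impI) (rule ge)
      then have "(\<lambda>n. y (\<kappa> n)) \<longlonglongrightarrow> g" by (rule filterlim_compose[OF y(2)])
      moreover have "eventually (\<lambda>n. y (\<kappa> n) = p (m n)) sequentially"
        using eventually_ge_at_top[of "M 0"] by eventually_elim (simp add: m_def m')
      ultimately show ?thesis by (rule Lim_transform_eventually)
    qed
    ultimately show "\<exists>m. (\<forall>n. m n \<le> n) \<and> (\<lambda>n. p (m n)) \<longlonglongrightarrow> g" by blast
  qed
qed

section \<open>Assembly of the spectrum\<close>

lemma strict_mono_eventually_imp_frequently:
  fixes r :: "nat \<Rightarrow> nat"
  assumes "strict_mono r" "eventually (\<lambda>n. P (r n)) sequentially"
  shows "frequently P sequentially"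
proof -
  have "\<exists>n\<ge>N. P n" for N
  proof -
    obtain M where M: "\<And>n. n \<ge> M \<Longrightarrow> P (r n)" using assms(2) unfolding eventually_sequentially by blast
    have "max M N \<le> r (max M N)" by (rule strict_mono_imp_increasing[OF assms(1)])
    then show ?thesis using M[of "max M N"] by (intro exI[of _ "r (max M N)"]) auto
  qed
  then show ?thesis by (simp add: frequently_sequentially)
qed

theorem theorem1p11:
  fixes \<psi> :: "real \<Rightarrow> real" and f :: "ereal \<Rightarrow> ereal"
  assumes wav: "orthonormal_wavelet \<psi>"
    and range_f: "\<forall>h \<in> {0..\<infinity>}. f h = -\<infinity> \<or> (0 \<le> f h \<and> f h \<le> 1)"
    and usc: "usc_on_pos f"
    and dom_closed: "closed {h \<in> {0..\<infinity>}. f h \<noteq> -\<infinity>}"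
    and dom_min: "\<exists>m \<in> {h \<in> {0..\<infinity>}. f h \<noteq> -\<infinity>}.
                    (\<forall>h \<in> {h \<in> {0..\<infinity>}. f h \<noteq> -\<infinity>}. m \<le> h) \<and> 0 < m \<and> m < \<infinity>"
  shows "\<exists>F :: real \<Rightarrow> real. bounded (range F) \<and> hoelder_continuous F \<and>
           homogeneously_multifractal \<psi> F \<and>
           (\<forall>h \<in> {0..\<infinity>}. spectrum \<psi> F h = f h)"
proof -
  define I where "I = {h \<in> {0..\<infinity>}. f h \<noteq> -\<infinity>}"
  have f_I: "0 \<le> f h" "f h \<le> 1" if "h \<in> I" for h using range_f that by (auto simp: I_def)
  obtain m0 where m0: "m0 \<in> I" "\<And>h. h \<in> I \<Longrightarrow> m0 \<le> h" "0 < m0" "m0 < \<infinity>"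
    using dom_min unfolding I_def by blast
  then obtain \<eta> where \<eta>: "m0 = ereal \<eta>" "0 < \<eta>" by (cases m0) auto
  \<comment> \<open>Density in the domain alone would not do: with \<open>f\<close> merely upper
    semicontinuous, the values at points approaching h may stay far below f h. Density in the graph
    lets both coordinates converge.\<close>
  define G where "G = (\<lambda>h. (h, f h)) ` I"
  have "G \<noteq> {}" using m0(1) by (auto simp: G_def)
  then obtain p where p: "range p \<subseteq> G"
    "\<And>g. g \<in> G \<Longrightarrow> \<exists>m. (\<forall>n. m n \<le> n) \<and> (\<lambda>n. p (m n)) \<longlonglongrightarrow> g"
    using dense_enumeration by blast
  define hh where "hh n = fst (p n)" for n
  define s where "s n = real_of_ereal (f (hh n))" for n
  have hh: "hh n \<in> I" and p_eq: "p n = (hh n, f (hh n))" for n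
  proof -
    have "p n \<in> G" using p(1) by blast
    then show "hh n \<in> I" "p n = (hh n, f (hh n))" by (auto simp: hh_def G_def)
  qed
  have s_eq: "ereal (s n) = f (hh n)" for n
    using f_I[OF hh[of n]] by (cases "f (hh n)") (auto simp: s_def)
  interpret prescribed_spectrum \<psi> hh s \<eta>
  proof
    show "ereal \<eta> \<le> hh m" for m using m0(2)[OF hh] \<eta> by simp
    have "0 \<le> ereal (s m) \<and> ereal (s m) \<le> 1" for m unfolding s_eq using f_I[OF hh[of m]] by simp
    then show "0 \<le> s m" "s m \<le> 1" for m by simp_all
  qed (use wav \<eta> in auto)
  \<comment> \<open>The lower limit is a limit along a subsequence of labels. This serves twice: all
    exponents that occur lie in the closed set \<open>I\<close>, and labels close to the exponent
    recur infinitely often.\<close>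
  have subseq: "\<exists>r. strict_mono r \<and> (\<lambda>n. hh (label (r n) (node (r n) x))) \<longlonglongrightarrow> hoelder_exp F x"
    if "x \<in> K" for x
    using liminf_subseq_lim[of "\<lambda>n. hh (label n (node n x))"] hoelder_exp_label[OF that]
    by (simp add: comp_def)
  have exp_I: "hoelder_exp F x \<in> I" if x: "x \<in> K" for x
  proof -
    obtain r where r: "(\<lambda>n. hh (label (r n) (node (r n) x))) \<longlonglongrightarrow> hoelder_exp F x" using subseq[OF x] by blast
    have "closed I" unfolding I_def by (rule dom_closed)
    then show ?thesis by (rule closed_sequentially[OF _ _ r]) (rule hh)
  qed
  have upper: "dim_H (iso_set \<psi> F h \<inter> B) \<le> f h" if h: "h \<in> I" for h B
  proof -
    obtain v where v: "f h = ereal v" "0 \<le> v" using f_I[OF h] by (cases "f h") auto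
    have "dim_H (iso_set \<psi> F h \<inter> B) \<le> ereal v"
    proof (rule dim_upper[OF v(2)])
      show "iso_set \<psi> F h \<inter> B \<subseteq> K" by (auto simp: iso_set_def wsupp_eq)
      fix x \<sigma> assume "x \<in> iso_set \<psi> F h \<inter> B" "v < \<sigma>"
      then have x: "x \<in> K" "hoelder_exp F x = h" by (auto simp: iso_set_def wsupp_eq)
      obtain r where r: "strict_mono r" "(\<lambda>n. hh (label (r n) (node (r n) x))) \<longlonglongrightarrow> h"
        using subseq[OF x(1)] x(2) by blast
      \<comment> \<open>Semicontinuity supplies a neighbourhood of h on which f < \<sigma>; the
        subsequence of labels enters it, which is the recurrence required by
        \<open>dim_upper\<close>. This works for h = \<infinity> as well, since the topology is that
        of the extended half-line.\<close>
      have "openin (top_of_set {0..\<infinity>}) {h \<in> {0..\<infinity>}. f h < ereal \<sigma>}" using usc by (simp add: usc_on_pos_def)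
      then obtain U where U: "open U" "{h \<in> {0..\<infinity>}. f h < ereal \<sigma>} = {0..\<infinity>} \<inter> U"
        unfolding openin_open by blast
      have "h \<in> {h \<in> {0..\<infinity>}. f h < ereal \<sigma>}" using h v(1) \<open>v < \<sigma>\<close> by (auto simp: I_def)
      then have "h \<in> U" using U(2) by blast
      have "eventually (\<lambda>n. hh (label (r n) (node (r n) x)) \<in> U) sequentially"
        by (rule topological_tendstoD[OF r(2) U(1) \<open>h \<in> U\<close>])
      then have "eventually (\<lambda>n. s (label (r n) (node (r n) x)) < \<sigma>) sequentially"
      proof eventually_elim
        case (elim n)
        let ?l = "label (r n) (node (r n) x)"
        have "hh ?l \<in> {0..\<infinity>} \<inter> U" using elim hh[of ?l] by (auto simp: I_def)
        then have "f (hh ?l) < ereal \<sigma>" using U(2) by blast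
        then show ?case unfolding s_eq[symmetric] by simp
      qed
      then show "frequently (\<lambda>n. s (label n (node n x)) < \<sigma>) sequentially"
        by (rule strict_mono_eventually_imp_frequently[OF r(1)])
    qed
    then show ?thesis by (simp add: v)
  qed
  \<comment> \<open>Nodes replace balls: a ball whose interior meets the support contains all points
    of \<open>K\<close> in some node, and the construction can be restarted below any node.\<close>
  have lower: "f h \<le> dim_H (iso_set \<psi> F h \<inter> B) \<and> iso_set \<psi> F h \<inter> B \<noteq> {}"
    if h: "h \<in> I" and k0: "k0 \<in> nodes n0" and B: "\<And>z. z \<in> K \<Longrightarrow> node n0 z = k0 \<Longrightarrow> z \<in> B" for h B k0 n0
  proof -
    obtain v where v: "f h = ereal v" "0 \<le> v" using f_I[OF h] by (cases "f h") auto
    have "(h, f h) \<in> G" using h by (simp add: G_def)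
    then obtain m where m: "\<And>n. m n \<le> n" "(\<lambda>n. p (m n)) \<longlonglongrightarrow> (h, f h)" using p(2) by blast
    have mh: "(\<lambda>n. hh (m n)) \<longlonglongrightarrow> h" using tendsto_fst[OF m(2)] by (simp add: hh_def)
    have "(\<lambda>n. ereal (s (m n))) \<longlonglongrightarrow> ereal v" using tendsto_snd[OF m(2)] by (simp add: p_eq s_eq v)
    then have ms: "(\<lambda>n. s (m n)) \<longlonglongrightarrow> v" by simp
    have Z: "z \<in> iso_set \<psi> F h \<inter> B"
      if z: "z \<in> K" "node n0 z = k0" "\<And>n. n0 \<le> n \<Longrightarrow> label (Suc n) (node (Suc n) z) = m n" for z
    proof -
      have "eventually (\<lambda>n. hh (m n) = hh (label (Suc n) (node (Suc n) z))) sequentially"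
        using eventually_ge_at_top[of n0] by eventually_elim (simp only: z(3))
      with mh have "(\<lambda>n. hh (label (Suc n) (node (Suc n) z))) \<longlonglongrightarrow> h" by (rule Lim_transform_eventually)
      then have "(\<lambda>n. hh (label n (node n z))) \<longlonglongrightarrow> h" by (rule LIMSEQ_imp_Suc)
      then have "hoelder_exp F z = h"
        unfolding hoelder_exp_label[OF z(1)] by (intro lim_imp_Liminf) auto
      then show ?thesis using z B by (auto simp: iso_set_def wsupp_eq)
    qed
    show ?thesis unfolding v(1)
      by (intro conjI dim_lower[OF k0 m(1) ms]) (rule Z; assumption)+
  qed
  have dim_eq: "dim_H (iso_set \<psi> F h \<inter> B) = f h"
    if "h \<in> I" "k0 \<in> nodes n0" "\<And>z. z \<in> K \<Longrightarrow> node n0 z = k0 \<Longrightarrow> z \<in> B" for h B k0 n0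
    using upper[OF that(1), of B] lower[OF that] by (auto intro: antisym)
  \<comment> \<open>This includes negative h, over which \<open>homogeneously_multifractal\<close>
    quantifies too.\<close>
  have empty: "iso_set \<psi> F h = {}" if "h \<notin> I" for h
    using exp_I that by (auto simp: iso_set_def wsupp_eq)
  have ball_eq: "dim_H (iso_set \<psi> F h \<inter> B) = f h" if h: "h \<in> I" and B: "interior B \<inter> wsupp \<psi> F \<noteq> {}" for h B
  proof -
    obtain x where x: "x \<in> interior B" "x \<in> K" using B by (auto simp: wsupp_eq)
    obtain e where e: "e > 0" "ball x e \<subseteq> B" using x(1) mem_interior by blast
    have "eventually (\<lambda>n. 1 / 2 ^ n < e) sequentially" using e(1) by real_asymp
    then obtain n0 where n0: "1 / 2 ^ n0 < e" unfolding eventually_sequentially by blast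
    have "1 / 2 ^ scale n0 \<le> (1::real) / 2 ^ n0"
      using J_ge[of n0] by (intro divide_left_mono power_increasing) auto
    then have e': "1 / 2 ^ scale n0 < e" using n0 by linarith
    show ?thesis
    proof (rule dim_eq[OF h])
      show "node n0 x \<in> nodes n0" using x(2) by (simp add: K_def)
      fix z assume "z \<in> K" "node n0 z = node n0 x"
      then have "\<bar>2 ^ scale n0 * z - 2 ^ scale n0 * x\<bar> \<le> 1" unfolding node_def by linarith
      then have "2 ^ scale n0 * \<bar>x - z\<bar> \<le> 1"
        by (simp add: abs_mult right_diff_distrib[symmetric] abs_minus_commute)
      then have "\<bar>x - z\<bar> \<le> 1 / 2 ^ scale n0" by (simp add: field_simps)
      then have "z \<in> ball x e" using e' by (simp add: dist_real_def)
      then show "z \<in> B" using e(2) by blast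
    qed
  qed
  have "homogeneously_multifractal \<psi> F"
    unfolding homogeneously_multifractal_def
  proof (intro allI impI)
    fix h B B'
    assume "interior B \<inter> wsupp \<psi> F \<noteq> {}" "interior B' \<inter> wsupp \<psi> F \<noteq> {}"
    then show "dim_H (iso_set \<psi> F h \<inter> B) = dim_H (iso_set \<psi> F h \<inter> B')"
      by (cases "h \<in> I") (simp_all add: ball_eq empty)
  qed
  moreover have "spectrum \<psi> F h = f h" if "h \<in> {0..\<infinity>}" for h
  proof (cases "h \<in> I")
    case True
    have "dim_H (iso_set \<psi> F h \<inter> UNIV) = f h"
      by (rule dim_eq[OF True, of 0 0]) auto
    then show ?thesis by (simp add: spectrum_def)
  next
    case False
    then show ?thesis using that by (simp add: spectrum_def empty dim_H_def I_def)
  qed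
  ultimately show ?thesis using F_bounded F_hoelder by blast
qed

end
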